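(* Let $E\subset\mathbb{T}$ be a nonempty closed set and let $q>0$. Let $v$ be a subharmonic function in $\mathbb{D}$, $v\not\equiv-\infty$, with Riesz measure $\mu$, and suppose that $$v(z)\le \frac{1}{\rho^q(z,E)}\qquad\text{for all } z\in\mathbb{D}.$$ (i) If $I(q,E)<\infty$, then $$\int_{\mathbb{D}}(1-|\lambda|)\,d\mu(\lambda)<\infty.$$ Moreover, if $v(0)\ge 0$, then $$\int_{\mathbb{D}}(1-|\lambda|)\,d\mu(\lambda)\le 1+q2^q I(q,E).$$ (ii) If $I(q,E)=\infty$ and $I(\alpha,E)<\infty$ for some real $\alpha<q$, then $$\int_{\mathbb{D}}(1-|\lambda|)\,\bigl(\rho(\lambda,E)\bigr)^{q-\alpha}\,d\mu(\lambda)<\infty.$$ Moreover, if $v(0)\ge0$, then $$\int_{\mathbb{D}}(1-|\lambda|)\,\bigl(\rho(\lambda,E)\bigr)^{q-\alpha}\,d\mu(\lambda)<36\bigl(2^{-\alpha}+q\,(90)^{q-\alpha}\,I(\alpha,E)\bigr).$$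
   Context: $\mathbb{D}=\{z\in\mathbb{C}:|z|<1\}$ is the open unit disk and $\mathbb{T}=\{z\in\mathbb{C}:|z|=1\}$ the unit circle. For a closed set $E\subset\mathbb{T}$, $\rho(z,E)=\mathrm{dist}(z,E)$ is the Euclidean distance from $z$ to $E$, and $\rho^q(z,E)=(\rho(z,E))^q$. For $t>0$ put $E_t=\{\zeta\in\mathbb{T}:\rho(\zeta,E)<t\}$ and $\nu_E(t)=|E_t|$, where $|A|$ denotes the normalized Lebesgue measure of $A\subset\mathbb{T}$ (so $|\mathbb{T}|=1$). For $\alpha\in\mathbb{R}$, $$I(\alpha,E)=\int_0^2\frac{\nu_E(s)}{s^{\alpha+1}}\,ds\in[0,+\infty].$$ The Riesz measure of a subharmonic function $v\not\equiv-\infty$ on $\mathbb{D}$ is the positive Radon measure $\mu=\frac{1}{2\pi}\triangle v$ on $\mathbb{D}$, the Laplacian being taken in the sense of distributions. *)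

theory Defs
  imports "HOL-Analysis.Analysis"
begin

definition circle_measure :: "complex measure" where
  "circle_measure = distr (uniform_measure lborel {0..<2 * pi}) borel cis"

text \<open>Extended-real valued means: the truncation in \<^const>\<open>e2ennreal\<close> separates the positive
  and negative parts. For a function that is bounded above on the circle the positive part has a
  finite integral, so the difference below is never \<open>\<infinity> - \<infinity>\<close>; it may be \<open>-\<infinity>\<close>.\<close>

definition circle_mean :: "(complex \<Rightarrow> ereal) \<Rightarrow> complex \<Rightarrow> real \<Rightarrow> ereal" where
  "circle_mean v c r =
     enn2ereal (\<integral>\<^sup>+\<zeta>. e2ennreal (v (c + of_real r * \<zeta>)) \<partial>circle_measure)
     - enn2ereal (\<integral>\<^sup>+\<zeta>. e2ennreal (- v (c + of_real r * \<zeta>)) \<partial>circle_measure)"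

text \<open>Only the values of \<open>v\<close> on the open set \<open>S\<close> matter.
  The function that is identically \<open>-\<infinity>\<close> counts as subharmonic.\<close>

definition subharmonic_on :: "(complex \<Rightarrow> ereal) \<Rightarrow> complex set \<Rightarrow> bool" where
  "subharmonic_on v S \<longleftrightarrow>
     open S \<and>
     (\<forall>z\<in>S. v z < \<infinity>) \<and>
     (\<forall>a. open {z \<in> S. v z < a}) \<and>
     (\<forall>c r. 0 < r \<and> cball c r \<subseteq> S \<longrightarrow> v c \<le> circle_mean v c r)"

definition dir_deriv :: "complex \<Rightarrow> (complex \<Rightarrow> real) \<Rightarrow> complex \<Rightarrow> real" where
  "dir_deriv h f z = frechet_derivative f (at z) h"

text \<open>Real smoothness of functions on the plane: all iterated partial derivatives in the
  directions \<open>1\<close> and \<open>\<i>\<close> exist and are (real) differentiable.\<close>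

definition smooth_plane :: "(complex \<Rightarrow> real) \<Rightarrow> bool" where
  "smooth_plane f \<longleftrightarrow>
     (\<forall>hs. set hs \<subseteq> {1, \<i>} \<longrightarrow> foldr dir_deriv hs f differentiable_on UNIV)"

definition laplacian :: "(complex \<Rightarrow> real) \<Rightarrow> complex \<Rightarrow> real" where
  "laplacian f z = dir_deriv 1 (dir_deriv 1 f) z + dir_deriv \<i> (dir_deriv \<i> f) z"

definition test_function :: "complex set \<Rightarrow> (complex \<Rightarrow> real) \<Rightarrow> bool" where
  "test_function S \<phi> \<longleftrightarrow>
     smooth_plane \<phi> \<and> compact (closure {z. \<phi> z \<noteq> 0}) \<and> closure {z. \<phi> z \<noteq> 0} \<subseteq> S"

text \<open>\<open>M\<close> is a Radon measure on the Borel sets of \<open>S\<close> with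
  \<open>M = (1 / 2\<pi>) \<Delta> v\<close> in the sense of distributions on \<open>S\<close>. The predicate is meaningful for locally
  integrable \<open>v\<close>; such a \<open>v\<close> is infinite only on a null set, so the value \<open>0\<close> that
  \<^const>\<open>real_of_ereal\<close> assigns there is irrelevant.\<close>

definition riesz_measure_on :: "complex set \<Rightarrow> (complex \<Rightarrow> ereal) \<Rightarrow> complex measure \<Rightarrow> bool" where
  "riesz_measure_on S v M \<longleftrightarrow>
     sets M = sets (restrict_space borel S) \<and>
     (\<forall>K. compact K \<and> K \<subseteq> S \<longrightarrow> emeasure M K < \<infinity>) \<and>
     (\<forall>\<phi>. test_function S \<phi> \<longrightarrow>
        (\<integral>z. \<phi> z \<partial>M) = 1 / (2 * pi) * (LINT z:S|lborel. real_of_ereal (v z) * laplacian \<phi> z))"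

definition nu :: "complex set \<Rightarrow> real \<Rightarrow> ennreal" where
  "nu E t = emeasure circle_measure {\<zeta> \<in> sphere 0 1. infdist \<zeta> E < t}"

definition I_int :: "real \<Rightarrow> complex set \<Rightarrow> ennreal" where
  "I_int \<alpha> E = (\<integral>\<^sup>+s\<in>{0<..2}. nu E s / ennreal (s powr (\<alpha> + 1)) \<partial>lborel)"

end

theory Submission
  imports Defs "HOL-Complex_Analysis.Complex_Analysis"
begin

text \<open>The Riesz measure is tested against functions \<open>\<phi>\<close> that look like Green functions with pole
  \<open>0\<close> of a subdomain of the disk: \<open>\<phi>\<close> is a smooth convex function of
  \<open>log (1 / |z|) - u(z)\<close> with \<open>u \<ge> 0\<close> harmonic, the logarithm being smoothed near the origin. Then
  \<open>\<Delta>\<phi> = a - b\<close> with \<open>a \<ge> 0\<close> concentrated where \<open>log (1 / |z|)\<close> is about \<open>u\<close>, and \<open>b \<ge> 0\<close> radial of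
  total mass \<open>2\<pi>\<close> near the origin. An upper bound for \<open>v\<close> is needed only on the support of \<open>a\<close>, and
  the sub-mean value property at \<open>0\<close> controls the integral of \<open>v b\<close> from below.

  For (i) take \<open>u = 0\<close> and average over circles, using \<open>\<rho>(r\<zeta>, E) \<ge> \<rho>(\<zeta>, E) / 2\<close>. For (ii) take for \<open>u\<close>
  the Poisson integral of \<open>7t\<close> times the indicator of \<open>E\<^sub>t\<close>. It exceeds \<open>log (1 / |z|)\<close> where
  \<open>\<rho>(z, E) \<le> t\<close>, and is at most \<open>(1 - |z|) / 2\<close> where \<open>\<rho>(z, E) \<ge> 90t\<close>. On the support of \<open>a\<close>
  the function \<open>v\<close> is dominated by \<open>17\<close> times the Poisson integral of \<open>max(\<rho>, t)\<^sup>-\<^sup>q\<close>, because the arc of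
  points that are at least as close to \<open>E\<close> as \<open>z\<close> has harmonic measure bounded below at \<open>z\<close>.
  Integrating the resulting inequality against \<open>(q - \<alpha>) t\<^bsup>q - \<alpha> - 1\<^esup> dt\<close> over \<open>0 < t \<le> 1 / 45\<close>
  gives (ii).\<close>

subsection \<open>A smooth convex ramp\<close>

text \<open>The distributional Laplacian can only be paired with smooth compactly supported
  functions, so the Green function itself is not admissible. The parameter \<open>e\<close> smooths
  it at the boundary at a cost of \<open>2 * e\<close>, which Fatou's lemma removes. The pole is
  spread over a fixed annulus because v(0) may be -\<infinity>: the resulting mean
  \<open>core_mass v\<close> is always finite and enters every estimate with a minus sign.
  Finiteness follows from this alone; the explicit constants follow once v(0) \<ge> 0 makes it
  nonnegative. If I(q, E) is infinite, \<rho>^(-q) has infinite mean on the circle. Truncation at t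
  restores a finite mean but no longer dominates v within t of E; the barrier removes exactly those
  points from the estimate. Beyond distance 90t at least half of 1 - |z| survives the barrier, and t
  \<le> 1/45 is the range in which 90t \<le> 2, the largest possible distance. The final factor is 2
  * 17 * 101/99 < 36: 2 from the surviving half, 17 from the domination, 101/99 from Harnack's
  inequality on the disk where the pole is spread.\<close>

definition flat_exp :: "real poly \<Rightarrow> real \<Rightarrow> real" where
  "flat_exp p x = (if x > 0 then poly p (1 / x) * exp (- 1 / x) else 0)"

lemma poly_times_exp_minus_tendsto_0:
  fixes p :: "real poly"
  shows "((\<lambda>y. poly p y * exp (- y)) \<longlongrightarrow> 0) at_top"
proof -
  have "((\<lambda>y. \<Sum>i\<le>degree p. coeff p i * (y ^ i / exp y)) \<longlongrightarrow> (\<Sum>i\<le>degree p. coeff p i * 0)) at_top"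
    by (intro tendsto_sum tendsto_mult tendsto_const tendsto_power_div_exp_0)
  then show ?thesis
    by (simp add: poly_altdef sum_distrib_right exp_minus divide_inverse mult.assoc)
qed

text \<open>The polynomial factor makes the family closed under differentiation: with y = 1/x, p(y)
  becomes y^2 (p - p')(y). One formula thus yields derivatives of every order, also at 0, where the
  exponential beats each polynomial in 1/x.\<close>

lemma DERIV_flat_exp: "(flat_exp p has_real_derivative flat_exp ([:0, 0, 1:] * (p - pderiv p)) x) (at x)"
proof -
  consider "x < 0" | "x = 0" | "x > 0" by linarith
  then show ?thesis
  proof cases
    case 1
    have "((\<lambda>_. 0) has_real_derivative 0) (at x)" by simp
    then have "(flat_exp p has_real_derivative 0) (at x)"
      by (rule has_field_derivative_transform_within_open[of _ _ _ "{..<0}"]) (use 1 in \<open>auto simp: flat_exp_def\<close>)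
    then show ?thesis using 1 by (simp add: flat_exp_def)
  next
    case 3
    have "((\<lambda>x. poly p (1 / x) * exp (- 1 / x)) has_real_derivative
        flat_exp ([:0, 0, 1:] * (p - pderiv p)) x) (at x)"
      unfolding flat_exp_def using 3
      by (auto intro!: derivative_eq_intros simp: field_simps power2_eq_square)
    then show ?thesis
      by (rule has_field_derivative_transform_within_open[of _ _ _ "{0<..}"])
        (use 3 in \<open>auto simp: flat_exp_def\<close>)
  next
    case 2
    have "((\<lambda>h. flat_exp p h / h) \<longlongrightarrow> 0) (at_right 0)"
    proof -
      have "((\<lambda>x. poly ([:0, 1:] * p) (inverse x) * exp (- (inverse x))) \<longlongrightarrow> 0) (at_right (0::real))"
        by (rule filterlim_compose[OF poly_times_exp_minus_tendsto_0 filterlim_inverse_at_top_right])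
      then show ?thesis
        by (rule Lim_transform_eventually)
          (auto simp: eventually_at_filter flat_exp_def field_simps)
    qed
    moreover have "((\<lambda>h. flat_exp p h / h) \<longlongrightarrow> 0) (at_left 0)"
      by (rule Lim_transform_eventually[OF tendsto_const])
        (auto simp: eventually_at_filter flat_exp_def)
    ultimately have "((\<lambda>h. flat_exp p h / h) \<longlongrightarrow> 0) (at 0)"
      by (simp add: filterlim_at_split)
    then show ?thesis using 2 by (simp add: DERIV_def flat_exp_def)
  qed
qed

text \<open>An explicit sequence of all derivatives is produced because
  \<open>smooth_upto_compose\<close> consumes one. Derivatives of the bump are finite sums of
  products of a \<open>flat_exp\<close> at x and one at 1 - x.\<close>

lemma bump_derivatives:
  "\<exists>c :: nat \<Rightarrow> real \<Rightarrow> real. c 0 = (\<lambda>x. flat_exp 1 x * flat_exp 1 (1 - x)) \<and>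
     (\<forall>n x. (c n has_real_derivative c (Suc n) x) (at x))"
proof -
  define D :: "real poly \<Rightarrow> real poly" where "D p = [:0, 0, 1:] * (p - pderiv p)" for p
  define S :: "(real poly \<times> real poly) list \<Rightarrow> real \<Rightarrow> real"
    where "S L x = (\<Sum>(p, q)\<leftarrow>L. flat_exp p x * flat_exp q (1 - x))" for L x
  \<comment> \<open>A list of polynomial pairs encodes such a sum, and \<open>N\<close> is Leibniz's
    rule on lists; the minus sign comes from the inner derivative of 1 - x.\<close>
  define N where "N L = map (\<lambda>(p, q). (D p, q)) L @ map (\<lambda>(p, q). (p, - D q)) L" for L
  have minus: "flat_exp (- q) x = - flat_exp q x" for q x by (simp add: flat_exp_def)
  have dS: "(S L has_real_derivative S (N L) x) (at x)" for L x
  proof (induction L)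
    case Nil
    then show ?case by (simp add: S_def[abs_def] N_def)
  next
    case (Cons pq L)
    obtain p q where pq: "pq = (p, q)" by (cases pq)
    have "((\<lambda>x. flat_exp q (1 - x)) has_real_derivative flat_exp (D q) (1 - x) * (- 1)) (at x)"
      by (rule DERIV_chain2[OF DERIV_flat_exp[folded D_def]]) (auto intro!: derivative_eq_intros)
    note DERIV_mult[OF DERIV_flat_exp[of p, folded D_def] this]
    from DERIV_add[OF this Cons.IH]
    have "((\<lambda>x. flat_exp p x * flat_exp q (1 - x) + S L x) has_real_derivative
        flat_exp (D p) x * flat_exp q (1 - x) - flat_exp (D q) (1 - x) * flat_exp p x + S (N L) x) (at x)"
      by simp
    moreover have "S (N (pq # L)) x =
        flat_exp (D p) x * flat_exp q (1 - x) - flat_exp (D q) (1 - x) * flat_exp p x + S (N L) x"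
      by (simp add: S_def N_def pq minus)
    moreover have "S (pq # L) = (\<lambda>x. flat_exp p x * flat_exp q (1 - x) + S L x)"
      by (simp add: S_def pq fun_eq_iff)
    ultimately show ?case by simp
  qed
  show ?thesis
    by (rule exI[of _ "\<lambda>n. S ((N ^^ n) [(1, 1)])"]) (use dS in \<open>auto simp: S_def fun_eq_iff\<close>)
qed

lemma antiderivative_vanishing_on_negatives:
  fixes f :: "real \<Rightarrow> real"
  assumes cont: "continuous_on UNIV f" and neg: "\<And>x. x \<le> 0 \<Longrightarrow> f x = 0"
  obtains G where "\<And>x. (G has_real_derivative f x) (at x)" "\<And>x. x \<le> 0 \<Longrightarrow> G x = 0"
proof
  \<comment> \<open>The base point -1 makes every x \<ge> 0 interior to {-1..x+1}. For x < -1 the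
    interval {-1..x} is empty and the integral is 0, in agreement with the required
    vanishing.\<close>
  define G where "G x = integral {-1..x} f" for x
  show G0: "G x = 0" if "x \<le> 0" for x
  proof -
    have "integral {-1..x} f = integral {-1..x} (\<lambda>_. 0)"
      by (rule Henstock_Kurzweil_Integration.integral_cong) (use neg that in auto)
    then show ?thesis by (simp add: G_def)
  qed
  show "(G has_real_derivative f x) (at x)" for x
  proof (cases "x < 0")
    case True
    have "((\<lambda>_. 0) has_real_derivative 0) (at x)" by simp
    then have "(G has_real_derivative 0) (at x)"
      by (rule has_field_derivative_transform_within_open[of _ _ _ "{..<0}"]) (use True G0 in auto)
    then show ?thesis using True neg by simp
  next
    case False
    have "(G has_real_derivative f x) (at x within {-1..x+1})"
      unfolding G_def using False
      by (intro integral_has_real_derivative continuous_on_subset[OF cont]) auto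
    moreover have "at x within {-1..x+1} = at x"
      by (rule at_within_interior) (use False in auto)
    ultimately show ?thesis by simp
  qed
qed

text \<open>A smooth convex substitute for the positive part, listed with its derivatives. The slope
  is exactly 1 from 1 onwards, not just asymptotically: this lets the Laplacian of the core pass
  through the composition unchanged.\<close>

definition ramp_spec :: "(nat \<Rightarrow> real \<Rightarrow> real) \<Rightarrow> bool" where
  "ramp_spec c \<longleftrightarrow> (\<forall>n x. (c n has_real_derivative c (Suc n) x) (at x)) \<and>
     (\<forall>x. 0 \<le> c 0 x \<and> x - 1 \<le> c 0 x \<and> c 0 x \<le> max 0 x \<and> 0 \<le> c 2 x) \<and>
     (\<forall>x\<le>0. c 0 x = 0 \<and> c 1 x = 0 \<and> c 2 x = 0) \<and> (\<forall>x\<ge>1. c 1 x = 1 \<and> c 2 x = 0)"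

text \<open>The bump is integrated twice: after division by its total mass \<open>G 1\<close> the
  first integral rises from 0 to 1 on the unit interval, and the second one is the ramp.\<close>

lemma ramp_exists: "\<exists>c. ramp_spec c"
proof -
  obtain b :: "nat \<Rightarrow> real \<Rightarrow> real" where b0: "b 0 = (\<lambda>x. flat_exp 1 x * flat_exp 1 (1 - x))"
    and b: "\<And>n x. (b n has_real_derivative b (Suc n) x) (at x)"
    using bump_derivatives by blast
  have cont: "continuous_on UNIV (b 0)"
    using DERIV_isCont[OF b] by (intro continuous_at_imp_continuous_on) simp
  have bnn: "0 \<le> b 0 x" for x by (simp add: b0 flat_exp_def)
  have bz: "b 0 x = 0" if "x \<le> 0 \<or> x \<ge> 1" for x using that by (auto simp: b0 flat_exp_def)
  have bpos: "b 0 x > 0" if "0 < x" "x < 1" for x using that by (simp add: b0 flat_exp_def)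
  obtain G where G: "\<And>x. (G has_real_derivative b 0 x) (at x)" and G0: "\<And>x. x \<le> 0 \<Longrightarrow> G x = 0"
    using antiderivative_vanishing_on_negatives[OF cont] bz by blast
  have contG: "continuous_on A G" for A
    using DERIV_isCont[OF G] by (intro continuous_at_imp_continuous_on) simp
  have G1: "G 1 > 0"
  proof -
    have "G 0 < G 1"
      by (rule DERIV_pos_imp_increasing_open[of 0 1 G]) (use G bpos contG in auto)
    then show ?thesis by (simp add: G0)
  qed
  have mono: "G x \<le> G y" if "x \<le> y" for x y
    by (rule DERIV_nonneg_imp_nondecreasing[OF that]) (use G bnn in blast)
  have Gc: "G x = G 1" if "x \<ge> 1" for x
  proof (rule antisym)
    show "G x \<le> G 1"
    proof (rule DERIV_nonpos_imp_nonincreasing[OF that])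
      fix y :: real assume "1 \<le> y"
      then show "\<exists>z. (G has_real_derivative z) (at y) \<and> z \<le> 0"
        using G[of y] bz[of y] by (intro exI[of _ 0]) auto
    qed
  qed (rule mono[OF that])
  define s where "s x = G x / G 1" for x
  have s: "(s has_real_derivative b 0 x / G 1) (at x)" for x
    unfolding s_def by (intro DERIV_cdivide G)
  have Gnn: "0 \<le> G x" for x
    using mono[of 0 x] G0[of 0] G0[of x] by (cases "x \<le> 0") simp_all
  have Gle: "G x \<le> G 1" for x
    using mono[of x 1] Gc[of x] by (cases "x \<le> 1") simp_all
  have s01: "0 \<le> s x" "s x \<le> 1" for x
    using Gnn[of x] Gle[of x] G1 by (simp_all add: s_def)
  have s0: "s x = 0" if "x \<le> 0" for x using that G0 by (simp add: s_def)
  have s1: "s x = 1" if "x \<ge> 1" for x using Gc[OF that] G1 by (simp add: s_def)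
  have conts: "continuous_on UNIV s"
    using DERIV_isCont[OF s] by (intro continuous_at_imp_continuous_on) simp
  obtain H where H: "\<And>x. (H has_real_derivative s x) (at x)" and H0: "\<And>x. x \<le> 0 \<Longrightarrow> H x = 0"
    using antiderivative_vanishing_on_negatives[OF conts] s0 by blast
  have Hmono: "H x \<le> H y" if "x \<le> y" for x y
    by (rule DERIV_nonneg_imp_nondecreasing[OF that]) (use H s01 in blast)
  have Hle: "H x \<le> x" if "x \<ge> 0" for x
  proof -
    have "(\<lambda>x. H x - x) x \<le> (\<lambda>x. H x - x) 0"
    proof (rule DERIV_nonpos_imp_nonincreasing[OF that])
      fix y show "\<exists>z. ((\<lambda>x. H x - x) has_real_derivative z) (at y) \<and> z \<le> 0"
        by (rule exI[of _ "s y - 1"]) (use s01 in \<open>auto intro!: derivative_eq_intros H\<close>)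
    qed
    then show ?thesis by (simp add: H0)
  qed
  have Hge: "x - 1 \<le> H x" if "x \<ge> 1" for x
  proof -
    have "(\<lambda>x. x - H x) x \<le> (\<lambda>x. x - H x) 1"
    proof (rule DERIV_nonpos_imp_nonincreasing[OF that])
      fix y :: real assume "1 \<le> y"
      then show "\<exists>z. ((\<lambda>x. x - H x) has_real_derivative z) (at y) \<and> z \<le> 0"
        by (intro exI[of _ "1 - s y"]) (use s1 in \<open>auto intro!: derivative_eq_intros H\<close>)
    qed
    then show ?thesis using Hmono[of 0 1] H0[of 0] by simp
  qed
  define c where "c n = (if n = 0 then H else if n = 1 then s else (\<lambda>x. b (n - 2) x / G 1))" for n
  have "(c n has_real_derivative c (Suc n) x) (at x)" for n x
  proof -
    consider "n = 0" | "n = 1" | m where "n = Suc (Suc m)" by (metis One_nat_def not0_implies_Suc)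
    then show ?thesis
      by cases (use H s b in \<open>auto simp: c_def intro!: DERIV_cdivide\<close>)
  qed
  moreover have "0 \<le> H x" for x using Hmono[of "min 0 x" x] H0[of "min 0 x"] by simp
  moreover from this have "x - 1 \<le> H x" for x using Hge[of x] by (metis diff_ge_0_iff_ge nle_le order_trans)
  moreover have "H x \<le> max 0 x" for x using Hle[of x] H0[of x] by (cases "x \<ge> 0") auto
  ultimately show ?thesis
    using H0 s0 s1 bz bnn G1
    by (intro exI[of _ c]) (auto simp: ramp_spec_def c_def)
qed

definition ramp :: "nat \<Rightarrow> real \<Rightarrow> real" where
  "ramp = (SOME c. ramp_spec c)"

lemma ramp_spec: "ramp_spec ramp"
  unfolding ramp_def using ramp_exists by (rule someI_ex)

lemma DERIV_ramp: "(ramp n has_real_derivative ramp (Suc n) x) (at x)"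
  and ramp_nonneg: "0 \<le> ramp 0 x" and ramp_ge: "x - 1 \<le> ramp 0 x" and ramp_le: "ramp 0 x \<le> max 0 x"
  and ramp2_nonneg: "0 \<le> ramp 2 x"
  and ramp_neg: "x \<le> 0 \<Longrightarrow> ramp 0 x = 0" "x \<le> 0 \<Longrightarrow> ramp 1 x = 0" "x \<le> 0 \<Longrightarrow> ramp 2 x = 0"
  and ramp_ge1: "x \<ge> 1 \<Longrightarrow> ramp 1 x = 1" "x \<ge> 1 \<Longrightarrow> ramp 2 x = 0"
  using ramp_spec by (auto simp: ramp_spec_def)

lemma continuous_on_ramp: "continuous_on A (ramp n)"
  using DERIV_isCont[OF DERIV_ramp] by (intro continuous_at_imp_continuous_on) simp

text \<open>The offset \<open>ramp 0 1\<close> is never computed; it lies between 0 and 1, and it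
  cancels or is estimated by these bounds wherever it occurs.\<close>

lemma ramp_affine:
  assumes "x \<ge> 1"
  shows "ramp 0 x = x - 1 + ramp 0 1"
proof -
  have "((\<lambda>x. ramp 0 x - x) has_real_derivative 0) (at y within {1..})" if "y \<ge> 1" for y
    using ramp_ge1(1)[OF that]
    by (auto intro!: derivative_eq_intros has_field_derivative_at_within[OF DERIV_ramp])
  then have "\<exists>c. \<forall>y\<in>{1..}. ramp 0 y - y = c"
    by (intro has_field_derivative_zero_constant) auto
  then show ?thesis using assms by (metis add.commute atLeast_iff diff_add_cancel diff_add_eq order_refl)
qed

subsection \<open>Smooth functions on open subsets of the plane\<close>

text \<open>A version of \<open>smooth_plane\<close> relative to a set and recursive in the order,
  so that inductions and local arguments become possible. All derivatives of order at most k are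
  required to be differentiable, hence k counts one less than the order of
  differentiability.\<close>

primrec smooth_upto :: "nat \<Rightarrow> complex set \<Rightarrow> (complex \<Rightarrow> real) \<Rightarrow> bool" where
  "smooth_upto 0 U f \<longleftrightarrow> f differentiable_on U"
| "smooth_upto (Suc k) U f \<longleftrightarrow> f differentiable_on U \<and>
     smooth_upto k U (dir_deriv 1 f) \<and> smooth_upto k U (dir_deriv \<i> f)"

lemma dir_deriv_eqI: "(f has_derivative D) (at z) \<Longrightarrow> dir_deriv h f z = D h"
  by (metis dir_deriv_def frechet_derivative_at)

lemma dir_deriv_cong:
  assumes "open U" "z \<in> U" "\<And>x. x \<in> U \<Longrightarrow> f x = g x"
  shows "dir_deriv h f z = dir_deriv h g z"
proof -
  have "(f has_derivative D) (at z) \<longleftrightarrow> (g has_derivative D) (at z)" for D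
    using assms by (metis has_derivative_transform_within_open)
  then show ?thesis by (simp add: dir_deriv_def frechet_derivative_def)
qed

lemma differentiable_on_cong_open:
  assumes "open U" "\<And>x. x \<in> U \<Longrightarrow> f x = g x" "f differentiable_on U"
  shows "g differentiable_on U"
  unfolding differentiable_on_eq_differentiable_at[OF assms(1)]
proof
  fix z assume z: "z \<in> U"
  then obtain D where "(f has_derivative D) (at z)"
    using assms(1,3) by (auto simp: differentiable_on_eq_differentiable_at differentiable_def)
  from has_derivative_transform_within_open[OF this assms(1) z assms(2)]
  show "g differentiable at z" by (auto simp: differentiable_def)
qed

lemma smooth_upto_cong:
  assumes "open U" "\<And>x. x \<in> U \<Longrightarrow> f x = g x" "smooth_upto k U f"
  shows "smooth_upto k U g"
  using assms(2,3)
proof (induction k arbitrary: f g)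
  case 0
  then show ?case using differentiable_on_cong_open[OF assms(1)] by auto
next
  case (Suc k)
  have "smooth_upto k U (dir_deriv h g)" if "smooth_upto k U (dir_deriv h f)" for h
    by (rule Suc.IH[OF _ that]) (rule dir_deriv_cong[OF assms(1)], use Suc.prems in auto)
  then show ?case using Suc.prems differentiable_on_cong_open[OF assms(1), of f g] by auto
qed

lemma smooth_upto_differentiable: "smooth_upto k U f \<Longrightarrow> f differentiable_on U"
  by (cases k) simp_all

lemma smooth_upto_Suc: "smooth_upto (Suc k) U f \<Longrightarrow> smooth_upto k U f"
proof (induction k arbitrary: f)
  case (Suc k)
  note * = Suc.prems[unfolded smooth_upto.simps(2)[of "Suc k"]]
  show ?case
    unfolding smooth_upto.simps(2) using * Suc.IH by blast
qed simp

text \<open>Functions given by different formulas on overlapping open sets can thereby be checked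
  patch by patch.\<close>

lemma smooth_upto_local:
  assumes "\<And>z. z \<in> U \<Longrightarrow> \<exists>V. open V \<and> z \<in> V \<and> smooth_upto k V f"
  shows "smooth_upto k U f"
  using assms
proof (induction k arbitrary: f)
  have loc: "f differentiable_on U"
    if *: "\<And>z. z \<in> U \<Longrightarrow> \<exists>V. open V \<and> z \<in> V \<and> smooth_upto k V f" for f k
    unfolding differentiable_on_def
  proof
    fix z assume "z \<in> U"
    from *[OF this] obtain V where "open V" "z \<in> V" "f differentiable_on V"
      using smooth_upto_differentiable by blast
    then have "f differentiable at z" by (simp add: differentiable_on_eq_differentiable_at)
    then show "f differentiable (at z within U)" by (rule differentiable_at_withinI)
  qed
  {
    case 0
    then show ?case using loc[of 0] by simp
  next
    case (Suc k)
    have "\<exists>V. open V \<and> z \<in> V \<and> smooth_upto k V (dir_deriv h f)" if "z \<in> U" "h \<in> {1, \<i>}" for z h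
      using Suc.prems[OF that(1)] that(2) by auto
    then show ?case using Suc.IH loc[of "Suc k" f] Suc.prems by simp
  }
qed

lemma smooth_upto_const: "smooth_upto k U (\<lambda>_. c)"
proof (induction k arbitrary: c)
  case (Suc k)
  have "dir_deriv h (\<lambda>_. c) = (\<lambda>_. 0)" for h by (auto simp: dir_deriv_def)
  then show ?case using Suc by simp
qed simp

section \<open>Rules for directional derivatives and Laplacians\<close>

lemma has_derivative_dir_deriv:
  assumes "open U" "z \<in> U" "f differentiable_on U"
  shows "(f has_derivative (\<lambda>h. dir_deriv h f z)) (at z)"
  unfolding dir_deriv_def
  by (rule frechet_derivative_works[THEN iffD1])
    (use assms in \<open>simp add: differentiable_on_eq_differentiable_at\<close>)

context
  fixes U :: "complex set"
  assumes U: "open U"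
begin

lemma dir_deriv_add:
  assumes "f differentiable_on U" "g differentiable_on U" "z \<in> U"
  shows "dir_deriv h (\<lambda>x. f x + g x) z = dir_deriv h f z + dir_deriv h g z"
  by (rule dir_deriv_eqI[OF has_derivative_add[OF has_derivative_dir_deriv[OF U assms(3,1)]
        has_derivative_dir_deriv[OF U assms(3,2)]]])

lemma dir_deriv_mult:
  assumes "f differentiable_on U" "g differentiable_on U" "z \<in> U"
  shows "dir_deriv h (\<lambda>x. f x * g x) z = f z * dir_deriv h g z + dir_deriv h f z * g z"
  by (rule dir_deriv_eqI[OF has_derivative_mult[OF has_derivative_dir_deriv[OF U assms(3,1)]
        has_derivative_dir_deriv[OF U assms(3,2)]]])

lemma differentiable_on_real_compose:
  fixes c c' :: "real \<Rightarrow> real"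
  assumes "f differentiable_on U" "\<And>x. (c has_real_derivative c' x) (at x)"
  shows "(\<lambda>x. c (f x)) differentiable_on U"
  unfolding differentiable_on_eq_differentiable_at[OF U] differentiable_def
  by (intro ballI exI) (rule DERIV_compose_FDERIV[OF assms(2) has_derivative_dir_deriv[OF U _ assms(1)]])

lemma dir_deriv_compose:
  fixes c c' :: "real \<Rightarrow> real"
  assumes "f differentiable_on U" "\<And>x. (c has_real_derivative c' x) (at x)" "z \<in> U"
  shows "dir_deriv h (\<lambda>x. c (f x)) z = c' (f z) * dir_deriv h f z"
proof -
  have "((\<lambda>x. c (f x)) has_derivative (\<lambda>h. c' (f z) * dir_deriv h f z)) (at z)"
    using DERIV_compose_FDERIV[OF assms(2) has_derivative_dir_deriv[OF U assms(3,1)]]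
    by (simp add: mult.commute)
  then show ?thesis by (rule dir_deriv_eqI)
qed

lemma smooth_upto_add:
  "smooth_upto k U f \<Longrightarrow> smooth_upto k U g \<Longrightarrow> smooth_upto k U (\<lambda>x. f x + g x)"
proof (induction k arbitrary: f g)
  case 0
  then show ?case using differentiable_on_add[of f U g] by simp
next
  case (Suc k)
  have "smooth_upto k U (dir_deriv h (\<lambda>x. f x + g x))"
    if "smooth_upto k U (dir_deriv h f)" "smooth_upto k U (dir_deriv h g)" for h
    by (rule smooth_upto_cong[OF U _ Suc.IH[OF that]]) (rule dir_deriv_add[symmetric]; use Suc.prems in simp)
  then show ?case using Suc.prems differentiable_on_add[of f U g] by simp
qed

lemma smooth_upto_mult:
  "smooth_upto k U f \<Longrightarrow> smooth_upto k U g \<Longrightarrow> smooth_upto k U (\<lambda>x. f x * g x)"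
proof (induction k arbitrary: f g)
  case 0
  then show ?case using differentiable_on_mult[of f U g] by simp
next
  case (Suc k)
  have "smooth_upto k U (dir_deriv h (\<lambda>x. f x * g x))"
    if "smooth_upto k U (dir_deriv h f)" "smooth_upto k U (dir_deriv h g)" for h
    by (rule smooth_upto_cong[OF U _ smooth_upto_add[OF
          Suc.IH[OF smooth_upto_Suc[OF Suc.prems(1)] that(2)]
          Suc.IH[OF that(1) smooth_upto_Suc[OF Suc.prems(2)]]]])
       (rule dir_deriv_mult[symmetric]; use Suc.prems in simp)
  then show ?case using Suc.prems differentiable_on_mult[of f U g] by simp
qed

lemma smooth_upto_diff:
  assumes "smooth_upto k U f" "smooth_upto k U g"
  shows "smooth_upto k U (\<lambda>x. f x - g x)"
proof -
  have eq: "(\<lambda>x. f x - g x) = (\<lambda>x. f x + (- 1) * g x)" by auto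
  show ?thesis
    unfolding eq
    by (rule smooth_upto_add[where f=f and g="\<lambda>x. (- 1) * g x"], rule assms,
        rule smooth_upto_mult[where f="\<lambda>x. - 1" and g=g], rule smooth_upto_const, rule assms)
qed

text \<open>The index n stays free in the induction, since differentiating \<open>c n (f x)\<close>
  produces the factor \<open>c (Suc n) (f x)\<close>.\<close>

lemma smooth_upto_compose:
  fixes c :: "nat \<Rightarrow> real \<Rightarrow> real"
  assumes c: "\<And>n x. (c n has_real_derivative c (Suc n) x) (at x)"
  shows "smooth_upto k U f \<Longrightarrow> smooth_upto k U (\<lambda>x. c n (f x))"
proof (induction k arbitrary: f n)
  case 0
  have "(\<lambda>x. c n (f x)) differentiable_on U"
    by (rule differentiable_on_real_compose[OF _ c]) (use 0 in simp)
  then show ?case by simp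
next
  case (Suc k)
  have d: "(\<lambda>x. c n (f x)) differentiable_on U"
    by (rule differentiable_on_real_compose[OF _ c]) (use Suc.prems in simp)
  have "smooth_upto k U (dir_deriv h (\<lambda>x. c n (f x)))" if "smooth_upto k U (dir_deriv h f)" for h
    by (rule smooth_upto_cong[OF U _ smooth_upto_mult[OF Suc.IH[OF smooth_upto_Suc[OF Suc.prems], of "Suc n"] that]])
      (rule dir_deriv_compose[OF _ c, symmetric]; use Suc.prems in simp)
  then show ?case using Suc.prems d by auto
qed

section \<open>Harmonic functions as real parts of holomorphic functions\<close>

lemma has_derivative_Re_holomorphic:
  assumes "F holomorphic_on U" "z \<in> U"
  shows "((\<lambda>z. Re (F z)) has_derivative (\<lambda>h. Re (deriv F z * h))) (at z)"
proof -
  have "(F has_derivative (*) (deriv F z)) (at z)"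
    using holomorphic_derivI[OF assms(1) U assms(2)] by (simp add: has_field_derivative_def)
  then show ?thesis by (rule bounded_linear.has_derivative[OF bounded_linear_Re])
qed

lemma dir_deriv_Re_holomorphic:
  assumes "F holomorphic_on U" "z \<in> U"
  shows "dir_deriv h (\<lambda>z. Re (F z)) z = Re (deriv F z * h)"
  using dir_deriv_eqI[OF has_derivative_Re_holomorphic[OF assms]] .

lemma differentiable_on_Re_holomorphic:
  "F holomorphic_on U \<Longrightarrow> (\<lambda>z. Re (F z)) differentiable_on U"
  unfolding differentiable_on_eq_differentiable_at[OF U] differentiable_def
  by (intro ballI exI) (rule has_derivative_Re_holomorphic)

text \<open>The derivative of Re F in direction h is Re (F' h), again the real part of a holomorphic
  function, so the induction runs within this class.\<close>

lemma smooth_upto_Re_holomorphic: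
  "F holomorphic_on U \<Longrightarrow> smooth_upto k U (\<lambda>z. Re (F z))"
proof (induction k arbitrary: F)
  case 0
  then show ?case using differentiable_on_Re_holomorphic by simp
next
  case (Suc k)
  have "(\<lambda>z. Re (F z)) differentiable_on U"
    by (rule differentiable_on_Re_holomorphic[OF Suc.prems])
  moreover have "smooth_upto k U (dir_deriv h (\<lambda>z. Re (F z)))" for h
    by (rule smooth_upto_cong[OF U dir_deriv_Re_holomorphic[OF Suc.prems, symmetric]])
      (assumption, intro Suc.IH holomorphic_intros holomorphic_deriv U Suc.prems)
  ultimately show ?case by simp
qed

text \<open>The second derivative in direction h is Re (F'' h^2), and 1^2 + \<i>^2 = 0.\<close>

lemma laplacian_Re_holomorphic:
  assumes F: "F holomorphic_on U" and z: "z \<in> U"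
  shows "laplacian (\<lambda>z. Re (F z)) z = 0"
proof -
  have "dir_deriv h (dir_deriv h (\<lambda>z. Re (F z))) z = Re (deriv (deriv F) z * h * h)" for h
  proof -
    have "dir_deriv h (dir_deriv h (\<lambda>z. Re (F z))) z = dir_deriv h (\<lambda>z. Re (deriv F z * h)) z"
      by (rule dir_deriv_cong[OF U z dir_deriv_Re_holomorphic[OF F]])
    also have "\<dots> = Re (deriv (\<lambda>z. deriv F z * h) z * h)"
      by (rule dir_deriv_Re_holomorphic) (intro holomorphic_intros holomorphic_deriv U F z)+
    also have "deriv (\<lambda>z. deriv F z * h) z = deriv (deriv F) z * h"
      by (rule deriv_cmult_right)
        (use holomorphic_deriv[OF F U] U z holomorphic_on_imp_differentiable_at in blast)
    finally show ?thesis .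
  qed
  then show ?thesis by (simp add: laplacian_def)
qed

lemma laplacian_add:
  assumes "smooth_upto 2 U f" "smooth_upto 2 U g" "z \<in> U"
  shows "laplacian (\<lambda>x. f x + g x) z = laplacian f z + laplacian g z"
proof -
  have "dir_deriv h (dir_deriv h (\<lambda>x. f x + g x)) z = dir_deriv h (dir_deriv h f) z + dir_deriv h (dir_deriv h g) z"
    if "h \<in> {1, \<i>}" for h
  proof -
    have "dir_deriv h (dir_deriv h (\<lambda>x. f x + g x)) z = dir_deriv h (\<lambda>x. dir_deriv h f x + dir_deriv h g x) z"
      by (rule dir_deriv_cong[OF U assms(3)], rule dir_deriv_add) (use assms in \<open>simp_all add: numeral_2_eq_2\<close>)
    also have "\<dots> = dir_deriv h (dir_deriv h f) z + dir_deriv h (dir_deriv h g) z"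
      by (rule dir_deriv_add; use assms that in \<open>auto simp: numeral_2_eq_2\<close>)
    finally show ?thesis .
  qed
  then show ?thesis by (simp add: laplacian_def)
qed

lemma laplacian_mult:
  assumes "smooth_upto 2 U f" "smooth_upto 2 U g" "z \<in> U"
  shows "laplacian (\<lambda>x. f x * g x) z = f z * laplacian g z + laplacian f z * g z
    + 2 * (dir_deriv 1 f z * dir_deriv 1 g z + dir_deriv \<i> f z * dir_deriv \<i> g z)"
proof -
  have "dir_deriv h (dir_deriv h (\<lambda>x. f x * g x)) z = f z * dir_deriv h (dir_deriv h g) z
      + dir_deriv h (dir_deriv h f) z * g z + 2 * dir_deriv h f z * dir_deriv h g z"
    if "h \<in> {1, \<i>}" for h
  proof -
    have d: "dir_deriv h f differentiable_on U" "dir_deriv h g differentiable_on U"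
      "f differentiable_on U" "g differentiable_on U"
      using assms that by (auto simp: numeral_2_eq_2)
    have "dir_deriv h (dir_deriv h (\<lambda>x. f x * g x)) z
        = dir_deriv h (\<lambda>x. f x * dir_deriv h g x + dir_deriv h f x * g x) z"
      by (rule dir_deriv_cong[OF U assms(3)], rule dir_deriv_mult) (use assms in \<open>simp_all add: numeral_2_eq_2\<close>)
    also have "\<dots> = dir_deriv h (\<lambda>x. f x * dir_deriv h g x) z + dir_deriv h (\<lambda>x. dir_deriv h f x * g x) z"
      by (rule dir_deriv_add) (intro differentiable_on_mult d assms(3))+
    finally show ?thesis
      using dir_deriv_mult[OF d(3,2) assms(3), of h] dir_deriv_mult[OF d(1,4) assms(3), of h] by simp
  qed
  then show ?thesis by (simp add: laplacian_def algebra_simps)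
qed

lemma laplacian_compose:
  fixes c c' c'' :: "real \<Rightarrow> real"
  assumes "smooth_upto 2 U f" "\<And>x. (c has_real_derivative c' x) (at x)"
    "\<And>x. (c' has_real_derivative c'' x) (at x)" "z \<in> U"
  shows "laplacian (\<lambda>x. c (f x)) z =
    c'' (f z) * ((dir_deriv 1 f z)\<^sup>2 + (dir_deriv \<i> f z)\<^sup>2) + c' (f z) * laplacian f z"
proof -
  have "dir_deriv h (dir_deriv h (\<lambda>x. c (f x))) z = c'' (f z) * (dir_deriv h f z)\<^sup>2
      + c' (f z) * dir_deriv h (dir_deriv h f) z"
    if "h \<in> {1, \<i>}" for h
  proof -
    have d: "dir_deriv h f differentiable_on U" "f differentiable_on U"
      using assms(1) that by (auto simp: numeral_2_eq_2)
    have d': "(\<lambda>x. c' (f x)) differentiable_on U"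
      by (rule differentiable_on_real_compose[OF d(2) assms(3)])
    have "dir_deriv h (dir_deriv h (\<lambda>x. c (f x))) z = dir_deriv h (\<lambda>x. c' (f x) * dir_deriv h f x) z"
      by (rule dir_deriv_cong[OF U assms(4)], rule dir_deriv_compose) (use assms d in auto)
    also have "\<dots> = c' (f z) * dir_deriv h (dir_deriv h f) z + dir_deriv h (\<lambda>x. c' (f x)) z * dir_deriv h f z"
      by (rule dir_deriv_mult[OF d' d(1) assms(4)])
    also have "dir_deriv h (\<lambda>x. c' (f x)) z = c'' (f z) * dir_deriv h f z"
      by (rule dir_deriv_compose[OF d(2) assms(3,4)])
    finally show ?thesis by (simp add: power2_eq_square)
  qed
  then show ?thesis by (simp add: laplacian_def algebra_simps)
qed

end

lemma smooth_plane_iff: "smooth_plane f \<longleftrightarrow> (\<forall>k. smooth_upto k UNIV f)"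
proof
  assume L: "smooth_plane f"
  have "smooth_upto k UNIV (foldr dir_deriv hs f)" if "set hs \<subseteq> {1, \<i>}" for k hs
    using that
  proof (induction k arbitrary: hs)
    case 0
    then show ?case using L by (simp add: smooth_plane_def)
  next
    case (Suc k)
    have "foldr dir_deriv hs f differentiable_on UNIV" using Suc L by (simp add: smooth_plane_def)
    then show ?case using Suc.IH[of "1 # hs"] Suc.IH[of "\<i> # hs"] Suc.prems by simp
  qed
  from this[of "[]"] show "\<forall>k. smooth_upto k UNIV f" by simp
next
  assume R: "\<forall>k. smooth_upto k UNIV f"
  have "\<forall>k. smooth_upto k UNIV (foldr dir_deriv hs f)" if "set hs \<subseteq> {1, \<i>}" for hs
    using that
  proof (induction hs)
    case Nil
    then show ?case using R by simp
  next
    case (Cons h hs)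
    then have *: "smooth_upto (Suc k) UNIV (foldr dir_deriv hs f)" for k by simp
    show ?case using *[unfolded smooth_upto.simps] Cons.prems by auto
  qed
  then show "smooth_plane f" unfolding smooth_plane_def using smooth_upto_differentiable by blast
qed

subsection \<open>Rotations and the normalized measure of the circle\<close>

lemma sets_circle_measure [simp, measurable_cong]: "sets circle_measure = sets borel"
  and space_circle_measure [simp]: "space circle_measure = UNIV"
  by (simp_all add: circle_measure_def)

lemma measurable_cis [measurable]: "cis \<in> borel_measurable borel"
  by (intro borel_measurable_continuous_onI continuous_intros)

lemma emeasure_period [simp]: "emeasure lborel {0..<2 * pi} = ennreal (2 * pi)"
  using emeasure_lborel_Ico[of 0 "2 * pi"] by simp

lemma nn_integral_circle_measure:
  assumes [measurable]: "f \<in> borel_measurable borel"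
  shows "(\<integral>\<^sup>+\<zeta>. f \<zeta> \<partial>circle_measure) = (\<integral>\<^sup>+\<tau>. f (cis \<tau>) * indicator {0..<2 * pi} \<tau> \<partial>lborel) / ennreal (2 * pi)"
  unfolding circle_measure_def by (simp add: nn_integral_distr nn_integral_uniform_measure)

lemma emeasure_circle_measure_UNIV: "emeasure circle_measure UNIV = 1"
  using nn_integral_circle_measure[of "\<lambda>_. 1"] by (simp add: ennreal_divide_self)

lemma finite_measure_circle_measure: "finite_measure circle_measure"
  by (rule finite_measureI) (simp add: emeasure_circle_measure_UNIV)

lemma AE_circle_measure: "AE \<zeta> in circle_measure. cmod \<zeta> = 1"
  unfolding circle_measure_def by (subst AE_distr_iff) auto

lemma nn_integral_translate:
  fixes f :: "'a::euclidean_space \<Rightarrow> ennreal"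
  assumes [measurable]: "f \<in> borel_measurable borel"
  shows "(\<integral>\<^sup>+x. f (c + x) \<partial>lborel) = (\<integral>\<^sup>+x. f x \<partial>lborel)"
proof -
  have "(\<integral>\<^sup>+x. f x \<partial>lborel) = (\<integral>\<^sup>+x. f x \<partial>distr lborel borel ((+) c))"
    by (simp add: lborel_distr_plus)
  also have "\<dots> = (\<integral>\<^sup>+x. f (c + x) \<partial>lborel)" by (simp add: nn_integral_distr)
  finally show ?thesis ..
qed

text \<open>The shifted window {a..<a + p} is cut at p, and periodicity moves the overhang {p..<p +
  a} back to {0..<a}.\<close>

lemma nn_integral_period_shift:
  fixes g :: "real \<Rightarrow> ennreal"
  assumes [measurable]: "g \<in> borel_measurable borel" and per: "\<And>x. g (p + x) = g x"
    and a: "0 \<le> a" "a \<le> p"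
  shows "(\<integral>\<^sup>+\<tau>. g (a + \<tau>) * indicator {0..<p} \<tau> \<partial>lborel) = (\<integral>\<^sup>+\<tau>. g \<tau> * indicator {0..<p} \<tau> \<partial>lborel)"
proof -
  have "(\<integral>\<^sup>+\<tau>. g (a + \<tau>) * indicator {0..<p} \<tau> \<partial>lborel)
      = (\<integral>\<^sup>+\<tau>. g (a + \<tau>) * indicator {a..<a + p} (a + \<tau>) \<partial>lborel)"
    by (intro nn_integral_cong) (auto simp: indicator_def)
  also have "\<dots> = (\<integral>\<^sup>+\<tau>. g \<tau> * indicator {a..<a + p} \<tau> \<partial>lborel)"
    by (rule nn_integral_translate[of "\<lambda>x. g x * indicator {a..<a + p} x"]) simp
  also have "\<dots> = (\<integral>\<^sup>+\<tau>. g \<tau> * indicator {a..<p} \<tau> + g \<tau> * indicator {p..<p + a} \<tau> \<partial>lborel)"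
    by (intro nn_integral_cong) (use a in \<open>auto simp: indicator_def\<close>)
  also have "\<dots> = (\<integral>\<^sup>+\<tau>. g \<tau> * indicator {a..<p} \<tau> \<partial>lborel) + (\<integral>\<^sup>+\<tau>. g \<tau> * indicator {p..<p + a} \<tau> \<partial>lborel)"
    by (rule nn_integral_add) auto
  also have "(\<integral>\<^sup>+\<tau>. g \<tau> * indicator {p..<p + a} \<tau> \<partial>lborel) = (\<integral>\<^sup>+\<tau>. g (p + \<tau>) * indicator {p..<p + a} (p + \<tau>) \<partial>lborel)"
    by (rule nn_integral_translate[symmetric, of "\<lambda>x. g x * indicator {p..<p + a} x"]) simp
  also have "\<dots> = (\<integral>\<^sup>+\<tau>. g \<tau> * indicator {0..<a} \<tau> \<partial>lborel)"
    by (intro nn_integral_cong) (auto simp: indicator_def per)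
  also have "(\<integral>\<^sup>+\<tau>. g \<tau> * indicator {a..<p} \<tau> \<partial>lborel) + \<dots>
      = (\<integral>\<^sup>+\<tau>. g \<tau> * indicator {a..<p} \<tau> + g \<tau> * indicator {0..<a} \<tau> \<partial>lborel)"
    by (rule nn_integral_add[symmetric]) auto
  also have "\<dots> = (\<integral>\<^sup>+\<tau>. g \<tau> * indicator {0..<p} \<tau> \<partial>lborel)"
    by (intro nn_integral_cong) (use a in \<open>auto simp: indicator_def\<close>)
  finally show ?thesis .
qed

lemma nn_integral_circle_rotate:
  assumes [measurable]: "f \<in> borel_measurable borel" and c: "cmod c = 1"
  shows "(\<integral>\<^sup>+\<zeta>. f (c * \<zeta>) \<partial>circle_measure) = (\<integral>\<^sup>+\<zeta>. f \<zeta> \<partial>circle_measure)"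
proof -
  obtain a where a: "0 \<le> a" "a < 2 * pi" "c = cis a"
    using complex_unimodular_polar[OF c] by (auto simp: cis.code)
  have per: "cis (2 * pi + x) = cis x" for x by (simp add: cis_mult[symmetric])
  show ?thesis
    using nn_integral_period_shift[of "\<lambda>\<tau>. f (cis \<tau>)" "2 * pi" a] a
    by (simp add: nn_integral_circle_measure cis_mult per)
qed

text \<open>Source of the lower bounds for Poisson integrals. Rotating the arc so that it starts at
  angle 0 avoids any case distinction about arcs that cross the end of the parameter
  interval.\<close>

lemma nn_integral_circle_arc_ge:
  assumes [measurable]: "f \<in> borel_measurable borel"
    and e: "cmod e = 1" and xy: "x \<le> y" "y - x \<le> 2 * pi"
    and f: "\<And>\<tau>. x \<le> \<tau> \<Longrightarrow> \<tau> \<le> y \<Longrightarrow> c \<le> f (e * cis \<tau>)"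
  shows "c * ennreal ((y - x) / (2 * pi)) \<le> (\<integral>\<^sup>+\<zeta>. f \<zeta> \<partial>circle_measure)"
proof -
  have "c * ennreal ((y - x) / (2 * pi)) = (\<integral>\<^sup>+\<tau>. c * indicator {0..<y - x} \<tau> \<partial>lborel) / ennreal (2 * pi)"
    using xy by (simp add: nn_integral_cmult_indicator divide_ennreal[symmetric] ennreal_times_divide)
  also have "\<dots> \<le> (\<integral>\<^sup>+\<tau>. f (e * cis x * cis \<tau>) * indicator {0..<2 * pi} \<tau> \<partial>lborel) / ennreal (2 * pi)"
    by (intro divide_right_mono_ennreal nn_integral_mono)
      (use xy f in \<open>auto simp: indicator_def cis_mult mult.assoc\<close>)
  also have "\<dots> = (\<integral>\<^sup>+\<zeta>. f (e * cis x * \<zeta>) \<partial>circle_measure)"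
    by (simp add: nn_integral_circle_measure)
  also have "\<dots> = (\<integral>\<^sup>+\<zeta>. f \<zeta> \<partial>circle_measure)"
    by (rule nn_integral_circle_rotate) (use e in \<open>auto simp: norm_mult\<close>)
  finally show ?thesis .
qed

text \<open>Averaging over unit translates identifies the rotated integral: both orders of integration
  only see the area of a unit disk.\<close>

lemma nn_integral_rotate:
  fixes f :: "complex \<Rightarrow> ennreal"
  assumes [measurable]: "f \<in> borel_measurable borel" and c: "cmod c = 1"
  shows "(\<integral>\<^sup>+z. f (c * z) \<partial>lborel) = (\<integral>\<^sup>+z. f z \<partial>lborel)"
proof -
  have c0: "c \<noteq> 0" using c by auto
  have vol: "emeasure lborel (ball y 1) = ennreal pi" for y :: complex
    by (simp add: emeasure_ball unit_ball_vol_2)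
  let ?B = "ball (0::complex) 1"
  have [measurable]: "?B \<in> sets borel" by simp
  have "(\<integral>\<^sup>+z. f (c * z) \<partial>lborel) * ennreal pi
      = (\<integral>\<^sup>+y. (\<integral>\<^sup>+z. f (c * z) \<partial>lborel) * indicator ?B y \<partial>lborel)"
    by (simp add: nn_integral_cmult_indicator vol)
  also have "\<dots> = (\<integral>\<^sup>+y. (\<integral>\<^sup>+z. f (c * z + y) * indicator ?B y \<partial>lborel) \<partial>lborel)"
  proof (rule nn_integral_cong)
    fix y
    have eq: "c * (y / c + z) = c * z + y" for z using c0 by (simp add: distrib_left)
    have "(\<integral>\<^sup>+z. f (c * z) \<partial>lborel) = (\<integral>\<^sup>+z. f (c * (y / c + z)) \<partial>lborel)"
      by (rule nn_integral_translate[symmetric]) simp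
    then show "(\<integral>\<^sup>+z. f (c * z) \<partial>lborel) * indicator ?B y = (\<integral>\<^sup>+z. f (c * z + y) * indicator ?B y \<partial>lborel)"
      by (simp add: nn_integral_multc eq)
  qed
  also have "\<dots> = (\<integral>\<^sup>+z. (\<integral>\<^sup>+y. f (c * z + y) * indicator ?B y \<partial>lborel) \<partial>lborel)"
    by (rule lborel_pair.Fubini', measurable)
  also have "\<dots> = (\<integral>\<^sup>+z. (\<integral>\<^sup>+y. f y * indicator ?B (y - c * z) \<partial>lborel) \<partial>lborel)"
  proof (rule nn_integral_cong)
    fix z
    have "(\<integral>\<^sup>+y. f (c * z + y) * indicator ?B (c * z + y - c * z) \<partial>lborel) = (\<integral>\<^sup>+y. f y * indicator ?B (y - c * z) \<partial>lborel)"
      by (rule nn_integral_translate[of "\<lambda>y. f y * indicator ?B (y - c * z)"]) simp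
    then show "(\<integral>\<^sup>+y. f (c * z + y) * indicator ?B y \<partial>lborel) = (\<integral>\<^sup>+y. f y * indicator ?B (y - c * z) \<partial>lborel)"
      by simp
  qed
  also have "\<dots> = (\<integral>\<^sup>+y. (\<integral>\<^sup>+z. f y * indicator ?B (y - c * z) \<partial>lborel) \<partial>lborel)"
    by (rule lborel_pair.Fubini', measurable)
  also have "\<dots> = (\<integral>\<^sup>+y. f y * ennreal pi \<partial>lborel)"
  proof (rule nn_integral_cong)
    fix y
    have "cmod (y - c * z) = dist (y / c) z" for z
    proof -
      have "y - c * z = c * (y / c - z)" using c0 by (simp add: field_simps)
      then show ?thesis by (metis c dist_norm mult_1 norm_mult)
    qed
    then have "indicator ?B (y - c * z) = (indicator (ball (y / c) 1) z :: ennreal)" for z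
      by (simp add: indicator_def)
    then show "(\<integral>\<^sup>+z. f y * indicator ?B (y - c * z) \<partial>lborel) = f y * ennreal pi"
      by (simp add: nn_integral_cmult_indicator vol)
  qed
  also have "\<dots> = (\<integral>\<^sup>+y. f y \<partial>lborel) * ennreal pi" by (simp add: nn_integral_multc)
  finally show ?thesis
    using ennreal_mult_cancel_left[of "ennreal pi"] by (auto simp: mult.commute)
qed

text \<open>Integration in polar coordinates in a form that needs only invariance: the integral does
  not change when the plane is rotated by \<zeta>, so it may be averaged over \<zeta>, and after
  exchanging the integrals the radial factor k comes out.\<close>

lemma nn_integral_radial_average:
  fixes f k :: "complex \<Rightarrow> ennreal"
  assumes [measurable]: "f \<in> borel_measurable borel" "k \<in> borel_measurable borel"
    and k: "\<And>z. k z = k (of_real (cmod z))"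
  shows "(\<integral>\<^sup>+z. k z * f z \<partial>lborel)
    = (\<integral>\<^sup>+z. k z * (\<integral>\<^sup>+\<zeta>. f (of_real (cmod z) * \<zeta>) \<partial>circle_measure) \<partial>lborel)"
proof -
  interpret m: finite_measure circle_measure by (rule finite_measure_circle_measure)
  interpret P: pair_sigma_finite circle_measure "lborel :: complex measure" ..
  have "(\<integral>\<^sup>+z. k z * f z \<partial>lborel) = (\<integral>\<^sup>+\<zeta>. (\<integral>\<^sup>+z. k z * f z \<partial>lborel) \<partial>circle_measure)"
    by (simp add: emeasure_circle_measure_UNIV)
  also have "\<dots> = (\<integral>\<^sup>+\<zeta>. (\<integral>\<^sup>+z. k z * f (\<zeta> * z) \<partial>lborel) \<partial>circle_measure)"
  proof (rule nn_integral_cong_AE, use AE_circle_measure in eventually_elim)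
    fix \<zeta> :: complex assume \<zeta>: "cmod \<zeta> = 1"
    have "(\<integral>\<^sup>+z. k z * f z \<partial>lborel) = (\<integral>\<^sup>+z. k (\<zeta> * z) * f (\<zeta> * z) \<partial>lborel)"
      by (rule nn_integral_rotate[symmetric]) (use \<zeta> in auto)
    then show "(\<integral>\<^sup>+z. k z * f z \<partial>lborel) = (\<integral>\<^sup>+z. k z * f (\<zeta> * z) \<partial>lborel)"
      using k[of "\<zeta> * z" for z] k \<zeta> by (simp add: norm_mult)
  qed
  also have "\<dots> = (\<integral>\<^sup>+z. (\<integral>\<^sup>+\<zeta>. k z * f (\<zeta> * z) \<partial>circle_measure) \<partial>lborel)"
    by (rule P.Fubini'[symmetric]) simp
  also have "\<dots> = (\<integral>\<^sup>+z. k z * (\<integral>\<^sup>+\<zeta>. f (of_real (cmod z) * \<zeta>) \<partial>circle_measure) \<partial>lborel)"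
  proof (rule nn_integral_cong)
    fix z :: complex
    have "(\<integral>\<^sup>+\<zeta>. f (\<zeta> * z) \<partial>circle_measure) = (\<integral>\<^sup>+\<zeta>. f (of_real (cmod z) * (sgn z * \<zeta>)) \<partial>circle_measure)"
      by (intro nn_integral_cong arg_cong[where f=f]) (simp add: sgn_eq)
    also have "\<dots> = (\<integral>\<^sup>+\<zeta>. f (of_real (cmod z) * \<zeta>) \<partial>circle_measure)"
    proof (cases "z = 0")
      case False
      then show ?thesis
        by (intro nn_integral_circle_rotate[of "\<lambda>\<zeta>. f (of_real (cmod z) * \<zeta>)"]) (auto simp: norm_sgn)
    qed simp
    finally show "(\<integral>\<^sup>+\<zeta>. k z * f (\<zeta> * z) \<partial>circle_measure)
        = k z * (\<integral>\<^sup>+\<zeta>. f (of_real (cmod z) * \<zeta>) \<partial>circle_measure)"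
      by (simp add: nn_integral_cmult)
  qed
  finally show ?thesis .
qed

text \<open>In the variable s = |z|^2 the area of an annulus is \<pi> times the length of the
  s-interval, so the image of the area measure of the disk has constant density. The areas of disks
  are all that is used.\<close>

lemma nn_integral_norm_square_disk:
  fixes g :: "real \<Rightarrow> ennreal"
  assumes [measurable]: "g \<in> borel_measurable borel"
  shows "(\<integral>\<^sup>+z. g ((cmod z)\<^sup>2) * indicator (ball 0 1) z \<partial>lborel)
    = ennreal pi * (\<integral>\<^sup>+s. g s * indicator {0..<1} s \<partial>lborel)"
proof -
  have ind: "(indicator (ball 0 1) :: complex \<Rightarrow> ennreal) \<in> borel_measurable lborel"
    by (rule borel_measurable_indicator) simp
  define N where "N = distr (density lborel (indicator (ball (0::complex) 1))) borel (\<lambda>z. (cmod z)\<^sup>2)"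
  define M where "M = density lborel (\<lambda>s::real. ennreal pi * indicator {0..<1} s)"
  have vol: "emeasure lborel (ball (0::complex) r) = ennreal (pi * r\<^sup>2)"
    "emeasure lborel (cball (0::complex) r) = ennreal (pi * r\<^sup>2)" if "r \<ge> 0" for r
    using that by (simp_all add: emeasure_ball emeasure_cball unit_ball_vol_2 power2_eq_square)
  have N: "emeasure N {x<..} = ennreal (pi * (1 - max 0 (min 1 x)))" for x
  proof -
    have meas: "{z :: complex. x < (cmod z)\<^sup>2} \<in> sets borel" by measurable
    have "emeasure N {x<..} = emeasure (density lborel (indicator (ball 0 1))) {z :: complex. x < (cmod z)\<^sup>2}"
      unfolding N_def by (simp add: emeasure_distr vimage_def)
    also have "\<dots> = (\<integral>\<^sup>+z. indicator (ball 0 1) z * indicator {z. x < (cmod z)\<^sup>2} z \<partial>(lborel :: complex measure))"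
      by (rule emeasure_density[OF ind]) (use meas in simp)
    also have "\<dots> = (\<integral>\<^sup>+z. indicator (ball 0 1 \<inter> {z. x < (cmod z)\<^sup>2}) z \<partial>(lborel :: complex measure))"
      by (intro nn_integral_cong) (auto simp: indicator_def)
    also have "\<dots> = emeasure lborel (ball (0::complex) 1 \<inter> {z. x < (cmod z)\<^sup>2})"
      by (rule nn_integral_indicator) measurable
    also have "\<dots> = ennreal (pi * (1 - max 0 (min 1 x)))"
    proof -
      consider "x < 0" | "0 \<le> x" "x < 1" | "1 \<le> x" by linarith
      then show ?thesis
      proof cases
        case 1
        then have "ball (0::complex) 1 \<inter> {z. x < (cmod z)\<^sup>2} = ball 0 1"
          by (auto intro: less_le_trans)
        then show ?thesis using 1 vol(1)[of 1] by simp
      next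
        case 2
        then have "ball (0::complex) 1 \<inter> {z. x < (cmod z)\<^sup>2} = ball 0 1 - cball 0 (sqrt x)"
          by (auto simp: real_sqrt_less_iff not_le dest: real_less_lsqrt intro: real_less_rsqrt)
            (metis norm_ge_zero not_le real_sqrt_less_iff real_sqrt_unique sqrt_le_D)+
        moreover have "emeasure lborel (ball (0::complex) 1 - cball 0 (sqrt x))
            = emeasure lborel (ball (0::complex) 1) - emeasure lborel (cball (0::complex) (sqrt x))"
        proof (rule emeasure_Diff)
          show "cball 0 (sqrt x) \<subseteq> ball (0::complex) 1"
            using 2 real_sqrt_lt_1_iff[of x] by (auto simp del: real_sqrt_lt_1_iff)
          show "emeasure lborel (cball (0::complex) (sqrt x)) \<noteq> \<infinity>" using 2 by (simp add: vol)
        qed auto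
        ultimately show ?thesis using 2 by (simp add: vol ennreal_minus algebra_simps)
      next
        case 3
        have "\<not> x < (cmod z)\<^sup>2" if "cmod z < 1" for z
          using power_strict_mono[OF that, of 2] 3 by simp
        then have "ball (0::complex) 1 \<inter> {z. x < (cmod z)\<^sup>2} = {}" by auto
        then show ?thesis using 3 by simp
      qed
    qed
    finally show ?thesis .
  qed
  have M: "emeasure M {x<..} = ennreal (pi * (1 - max 0 (min 1 x)))" for x
  proof -
    have "emeasure M {x<..} = (\<integral>\<^sup>+s. ennreal pi * indicator ({0..<1} \<inter> {x<..}) s \<partial>lborel)"
      unfolding M_def by (subst emeasure_density) (auto intro!: nn_integral_cong simp: indicator_def)
    also have "\<dots> = ennreal pi * emeasure lborel ({0..<1} \<inter> {x<..})"
      by (rule nn_integral_cmult_indicator) simp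
    also have "emeasure lborel ({0..<1} \<inter> {x<..}) = ennreal (1 - max 0 (min 1 x))"
    proof -
      consider "x < 0" | "0 \<le> x" "x < 1" | "1 \<le> x" by linarith
      then show ?thesis
      proof cases
        case 1
        then have "{0..<1} \<inter> {x<..} = {0..<1}" by auto
        then show ?thesis using 1 by simp
      next
        case 2
        then have "{0..<1} \<inter> {x<..} = {x<..<1}" by auto
        then show ?thesis using 2 by simp
      next
        case 3
        then have "{0..<1} \<inter> {x<..} = {}" by auto
        then show ?thesis using 3 by simp
      qed
    qed
    finally show ?thesis by (simp add: ennreal_mult')
  qed
  have "N = M"
    by (rule measure_eqI_lessThan) (auto simp: N M less_top, auto simp: N_def M_def)
  have "(\<integral>\<^sup>+z. g ((cmod z)\<^sup>2) * indicator (ball 0 1) z \<partial>lborel) = (\<integral>\<^sup>+s. g s \<partial>N)"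
    unfolding N_def by (simp add: nn_integral_distr nn_integral_density[OF ind] mult.commute)
  also have "\<dots> = (\<integral>\<^sup>+s. ennreal pi * (g s * indicator {0..<1} s) \<partial>lborel)"
    unfolding \<open>N = M\<close> M_def by (simp add: nn_integral_density mult.assoc mult.commute mult.left_commute)
  also have "\<dots> = ennreal pi * (\<integral>\<^sup>+s. g s * indicator {0..<1} s \<partial>lborel)"
    by (rule nn_integral_cmult) simp
  finally show ?thesis .
qed

subsection \<open>Integration by parts against harmonic functions\<close>

lemma integral_translate:
  fixes f :: "'a::euclidean_space \<Rightarrow> real"
  assumes f: "integrable lborel f"
  shows "integrable lborel (\<lambda>x. f (c + x))" "(\<integral>x. f (c + x) \<partial>lborel) = (\<integral>x. f x \<partial>lborel)"
proof -
  have [measurable]: "f \<in> borel_measurable borel" using f by auto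
  show "integrable lborel (\<lambda>x. f (c + x))"
    using f integrable_distr_eq[of "(+) c" lborel borel f] by (simp add: lborel_distr_plus)
  show "(\<integral>x. f (c + x) \<partial>lborel) = (\<integral>x. f x \<partial>lborel)"
    using integral_distr[of "(+) c" lborel borel f] by (simp add: lborel_distr_plus)
qed

lemma integrable_continuous_compact_support:
  fixes f :: "'a::euclidean_space \<Rightarrow> real"
  assumes "continuous_on UNIV f" "compact K" "\<And>z. z \<notin> K \<Longrightarrow> f z = 0"
  shows "integrable lborel f"
proof -
  have "integrable lborel (\<lambda>x. indicator K x *\<^sub>R f x)"
    by (rule borel_integrable_compact[OF assms(2) continuous_on_subset[OF assms(1)]]) simp
  moreover have "(\<lambda>x. indicator K x *\<^sub>R f x) = f" using assms(3) by (auto simp: indicator_def fun_eq_iff)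
  ultimately show ?thesis by simp
qed

lemma bounded_continuous_compact_support:
  fixes f :: "'a::euclidean_space \<Rightarrow> real"
  assumes "continuous_on UNIV f" "compact K" "\<And>z. z \<notin> K \<Longrightarrow> f z = 0"
  obtains C where "C \<ge> 0" "\<And>z. \<bar>f z\<bar> \<le> C"
proof -
  have "bounded (f ` K)"
    by (intro compact_imp_bounded compact_continuous_image continuous_on_subset[OF assms(1)] assms(2)) simp
  then obtain C where C: "\<And>z. z \<in> K \<Longrightarrow> \<bar>f z\<bar> \<le> C" by (auto simp: bounded_iff)
  show ?thesis
    by (rule that[of "max 0 C"]) (use C assms(3) in \<open>auto simp: le_max_iff_disj\<close>)
qed

text \<open>By translation invariance every difference quotient has integral 0. The quotients
  converge to the derivative and are bounded by its maximum, through the mean value theorem along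
  lines, so dominated convergence applies.\<close>

lemma integral_dir_deriv_eq_0:
  assumes X: "X differentiable_on UNIV" and cont: "continuous_on UNIV (dir_deriv h X)"
    and supp: "\<And>z. z \<notin> cball 0 R \<Longrightarrow> X z = 0"
  shows "(\<integral>z. dir_deriv h X z \<partial>lborel) = 0"
proof -
  have contX: "continuous_on UNIV X" by (rule differentiable_imp_continuous_on[OF X])
  have dX0: "dir_deriv h X z = 0" if "z \<notin> cball 0 R" for z
  proof -
    have "dir_deriv h X z = dir_deriv h (\<lambda>_. 0) z"
      by (rule dir_deriv_cong[of "- cball 0 R"]) (use that supp in auto)
    then show ?thesis by (simp add: dir_deriv_def)
  qed
  obtain C where C: "C \<ge> 0" "\<And>z. \<bar>dir_deriv h X z\<bar> \<le> C"
    using bounded_continuous_compact_support[OF cont compact_cball dX0] by blast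
  have line: "((\<lambda>t. X (of_real t * h + z)) has_real_derivative dir_deriv h X (of_real t * h + z)) (at t)" for t z
  proof -
    let ?z = "of_real t * h + z"
    have D: "(X has_derivative (\<lambda>k. dir_deriv k X ?z)) (at ?z)"
      by (rule has_derivative_dir_deriv[OF open_UNIV UNIV_I X])
    have "((\<lambda>t. of_real t * h + z) has_derivative (\<lambda>s. of_real s * h)) (at t)"
      by (auto intro!: derivative_eq_intros)
    from has_derivative_compose[OF this D]
    have "((\<lambda>t. X (of_real t * h + z)) has_derivative (\<lambda>s. dir_deriv (of_real s * h) X ?z)) (at t)" .
    moreover have "(\<lambda>s. dir_deriv (of_real s * h) X ?z) = (*) (dir_deriv h X ?z)"
      using linear_scale[OF has_derivative_linear[OF D], of _ h]
      by (auto simp: scaleR_conv_of_real mult.commute)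
    ultimately show ?thesis by (simp only: has_field_derivative_def)
  qed
  define D where "D n z = (X (of_real (inverse (real (Suc n))) * h + z) - X z) * real (Suc n)" for n z
  have lim: "(\<lambda>n. D n z) \<longlonglongrightarrow> dir_deriv h X z" for z
  proof -
    have "((\<lambda>t. (X (of_real t * h + z) - X z) / t) \<longlongrightarrow> dir_deriv h X z) (at 0)"
      using line[where t = 0 and z = z] by (simp add: DERIV_def)
    then have "(\<lambda>n. (X (of_real (inverse (real (Suc n))) * h + z) - X z) / inverse (real (Suc n))) \<longlonglongrightarrow> dir_deriv h X z"
      by (rule tendsto_at_iff_sequentially[THEN iffD1, rule_format, unfolded o_def])
         (use LIMSEQ_inverse_real_of_nat in auto)
    then show ?thesis by (simp add: D_def divide_inverse)
  qed
  have bound: "\<bar>D n z\<bar> \<le> C" for n z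
  proof -
    define e where "e = inverse (real (Suc n))"
    have e: "0 < e" by (simp add: e_def)
    obtain t where "X (of_real e * h + z) - X (of_real 0 * h + z) = (e - 0) * dir_deriv h X (of_real t * h + z)"
      using MVT2[OF e line] by blast
    then have "D n z = dir_deriv h X (of_real t * h + z)"
      unfolding D_def e_def[symmetric] using e by (simp add: e_def field_simps)
    then show ?thesis using C by simp
  qed
  \<comment> \<open>The steps have length at most |h|, hence all quotients live on one ball,
    enlarged by |h|.\<close>
  have D0: "D n z = 0" if z: "z \<notin> cball 0 (R + norm h)" for n z
  proof -
    define k where "k = of_real (inverse (real (Suc n))) * h"
    have "norm k = inverse (real (Suc n)) * norm h"
      by (simp only: k_def norm_mult norm_of_real abs_inverse abs_of_nat)
    also have "\<dots> \<le> 1 * norm h" by (intro mult_right_mono) (auto simp: inverse_le_1_iff)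
    finally have "norm k \<le> norm h" by simp
    moreover have tri: "norm z - norm k \<le> norm (k + z)"
      using norm_triangle_ineq2[of z "- k"] by (simp add: add.commute)
    ultimately have "z \<notin> cball 0 R" "k + z \<notin> cball 0 R"
      using z tri norm_ge_zero[of h] unfolding mem_cball_0 by linarith+
    then have "X z = 0" "X (k + z) = 0" using supp by blast+
    then show ?thesis by (simp add: D_def k_def)
  qed
  have iX: "integrable lborel X"
    by (rule integrable_continuous_compact_support[OF contX compact_cball supp])
  have [measurable]: "X \<in> borel_measurable borel" "dir_deriv h X \<in> borel_measurable borel"
    using contX cont by (auto intro: borel_measurable_continuous_onI)
  have "(\<lambda>n. (\<integral>z. D n z \<partial>lborel)) \<longlonglongrightarrow> (\<integral>z. dir_deriv h X z \<partial>lborel)"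
  proof (rule integral_dominated_convergence[where w = "\<lambda>z. C * indicator (cball 0 (R + norm h)) z"])
    show "integrable lborel (\<lambda>z. C * indicator (cball (0::complex) (R + norm h)) z)"
      by (intro integrable_mult_right integrable_real_indicator)
         (use emeasure_bounded_finite[OF bounded_cball, of "0::complex" "R + norm h"] in simp_all)
    show "AE z in lborel. norm (D n z) \<le> C * indicator (cball 0 (R + norm h)) z" for n
      using bound D0 by (auto simp: indicator_def)
  qed (use lim in \<open>auto simp: D_def\<close>)
  moreover have "(\<integral>z. D n z \<partial>lborel) = 0" for n
    unfolding D_def using integral_translate[OF iX] iX by simp
  ultimately show ?thesis by (simp add: LIMSEQ_const_iff)
qed

lemma smooth_upto_subset: "smooth_upto k U f \<Longrightarrow> V \<subseteq> U \<Longrightarrow> smooth_upto k V f"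
proof (induction k arbitrary: f)
  case 0
  then show ?case using differentiable_on_subset by auto
next
  case (Suc k)
  then show ?case using differentiable_on_subset[of f U V] by simp
qed

lemma test_function_props:
  assumes "test_function S \<phi>"
  obtains K where "compact K" "K \<subseteq> S" "\<And>z. z \<notin> K \<Longrightarrow> \<phi> z = 0" "\<And>k U. smooth_upto k U \<phi>"
    "\<And>z. z \<notin> K \<Longrightarrow> laplacian \<phi> z = 0" "continuous_on UNIV (laplacian \<phi>)" "continuous_on UNIV \<phi>"
proof
  let ?K = "closure {z. \<phi> z \<noteq> 0}"
  show sm: "smooth_upto k U \<phi>" for k U
    by (rule smooth_upto_subset[of k UNIV]) (use assms in \<open>auto simp: test_function_def smooth_plane_iff\<close>)
  show "compact ?K" "?K \<subseteq> S" using assms by (auto simp: test_function_def)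
  show \<phi>0: "\<phi> z = 0" if "z \<notin> ?K" for z using that closure_subset[of "{z. \<phi> z \<noteq> 0}"] by blast
  have d0: "dir_deriv h f z = 0" if "z \<notin> ?K" "\<And>z. z \<notin> ?K \<Longrightarrow> f z = 0" for z h f
  proof -
    have "dir_deriv h f z = dir_deriv h (\<lambda>_. 0) z"
      by (rule dir_deriv_cong[of "- ?K"]) (use that in auto)
    then show ?thesis by (simp add: dir_deriv_def)
  qed
  show "laplacian \<phi> z = 0" if "z \<notin> ?K" for z
  proof -
    have "dir_deriv h (dir_deriv h \<phi>) z = 0" for h by (rule d0[OF that d0[OF _ \<phi>0]])
    then show ?thesis by (simp add: laplacian_def)
  qed
  show "continuous_on UNIV (laplacian \<phi>)"
    using sm[of 2 UNIV] unfolding laplacian_def[abs_def] numeral_2_eq_2 smooth_upto.simps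
    by (intro continuous_on_add differentiable_imp_continuous_on) auto
  show "continuous_on UNIV \<phi>"
    using sm[of 0 UNIV] differentiable_imp_continuous_on by auto
qed

text \<open>Green's second identity: for H = Re G the difference of H \<Delta>\<phi> and \<phi>
  \<Delta>H is the divergence of the field \<open>X\<close>. This field extends smoothly by 0 beyond
  S because \<phi> and its derivatives vanish off a compact subset of S.\<close>

lemma integral_Re_holomorphic_laplacian:
  assumes S: "open S" and G: "G holomorphic_on S" and \<phi>: "test_function S \<phi>"
  shows "(\<integral>z. indicator S z * (Re (G z) * laplacian \<phi> z) \<partial>lborel) = 0"
proof -
  obtain K where K: "compact K" "K \<subseteq> S" "\<And>z. z \<notin> K \<Longrightarrow> \<phi> z = 0" "\<And>k U. smooth_upto k U \<phi>"
    "\<And>z. z \<notin> K \<Longrightarrow> laplacian \<phi> z = 0" "continuous_on UNIV (laplacian \<phi>)"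
    "continuous_on UNIV \<phi>"
    by (rule test_function_props[OF \<phi>]) (rule that; (assumption | simp))
  have oK: "open (- K)" using compact_imp_closed[OF K(1)] by (rule open_Compl)
  obtain R where "\<forall>z\<in>K. norm z \<le> R"
    using compact_imp_bounded[OF K(1)] unfolding bounded_iff by blast
  then have R: "K \<subseteq> cball 0 R" by auto
  define H where "H z = Re (G z)" for z
  have H: "smooth_upto k S H" for k
    unfolding H_def[abs_def] by (rule smooth_upto_Re_holomorphic[OF S G])
  have lapH: "laplacian H z = 0" if "z \<in> S" for z
    unfolding H_def[abs_def] by (rule laplacian_Re_holomorphic[OF S G that])
  have d\<phi>0: "dir_deriv h \<phi> z = 0" if "z \<notin> K" for z h
  proof -
    have "dir_deriv h \<phi> z = dir_deriv h (\<lambda>_. 0) z"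
      by (rule dir_deriv_cong[OF oK]) (use that K in auto)
    then show ?thesis by (simp add: dir_deriv_def)
  qed
  define X where "X h z = (if z \<in> S then H z * dir_deriv h \<phi> z - \<phi> z * dir_deriv h H z else 0)" for h z
  have X0: "X h z = 0" if "z \<notin> K" for h z using that K(3) d\<phi>0 by (simp add: X_def)
  have sm: "smooth_upto k S H" "smooth_upto k S (dir_deriv h H)" "smooth_upto k S \<phi>" "smooth_upto k S (dir_deriv h \<phi>)"
    if "h \<in> {1, \<i>}" for h k
    using H[of k] H[of "Suc k"] K(4)[of k S] K(4)[of "Suc k" S] that by auto
  have smX: "smooth_upto k UNIV (X h)" if h: "h \<in> {1, \<i>}" for h k
  proof (rule smooth_upto_local)
    fix z
    consider "z \<in> S" | "z \<in> - K" using K(2) by auto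
    then show "\<exists>V. open V \<and> z \<in> V \<and> smooth_upto k V (X h)"
    proof cases
      case 1
      have "smooth_upto k S (\<lambda>z. H z * dir_deriv h \<phi> z - \<phi> z * dir_deriv h H z)"
        by (intro smooth_upto_diff smooth_upto_mult S sm[OF h])
      then have "smooth_upto k S (X h)"
        by (rule smooth_upto_cong[OF S, rotated]) (simp add: X_def)
      then show ?thesis using 1 S by blast
    next
      case 2
      have "smooth_upto k (- K) (X h)"
        by (rule smooth_upto_cong[OF oK _ smooth_upto_const[of _ _ 0]]) (use X0 in auto)
      then show ?thesis using 2 oK by blast
    qed
  qed
  have int0: "(\<integral>z. dir_deriv h (X h) z \<partial>lborel) = 0" "integrable lborel (dir_deriv h (X h))"
    if h: "h \<in> {1, \<i>}" for h
  proof -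
    have d: "X h differentiable_on UNIV" "dir_deriv h (X h) differentiable_on UNIV"
      using smX[OF h, of 1] h by (auto simp: One_nat_def)
    show "(\<integral>z. dir_deriv h (X h) z \<partial>lborel) = 0"
    proof (rule integral_dir_deriv_eq_0[OF d(1) differentiable_imp_continuous_on[OF d(2)]])
      fix z :: complex assume "z \<notin> cball 0 R"
      then show "X h z = 0" using R by (intro X0) auto
    qed
    have "dir_deriv h (X h) z = 0" if "z \<notin> K" for z
    proof -
      have "dir_deriv h (X h) z = dir_deriv h (\<lambda>_. 0) z"
        by (rule dir_deriv_cong[OF oK]) (use that X0 in auto)
      then show ?thesis by (simp add: dir_deriv_def)
    qed
    then show "integrable lborel (dir_deriv h (X h))"
      by (rule integrable_continuous_compact_support[OF differentiable_imp_continuous_on[OF d(2)] K(1)])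
  qed
  have dX: "dir_deriv h (X h) z = indicator S z * (H z * dir_deriv h (dir_deriv h \<phi>) z - \<phi> z * dir_deriv h (dir_deriv h H) z)"
    if h: "h \<in> {1, \<i>}" for h z
  proof (cases "z \<in> S")
    case True
    note d = sm[OF h, of 0, unfolded smooth_upto.simps]
    have "dir_deriv h (X h) z = dir_deriv h (\<lambda>z. H z * dir_deriv h \<phi> z + (- 1) * (\<phi> z * dir_deriv h H z)) z"
      by (rule dir_deriv_cong[OF S True]) (simp add: X_def)
    also have "\<dots> = dir_deriv h (\<lambda>z. H z * dir_deriv h \<phi> z) z + dir_deriv h (\<lambda>z. (- 1) * (\<phi> z * dir_deriv h H z)) z"
      by (rule dir_deriv_add[OF S _ _ True]) (intro differentiable_on_mult d differentiable_on_const)+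
    also have "dir_deriv h (\<lambda>z. (- 1) * (\<phi> z * dir_deriv h H z)) z
        = (- 1) * dir_deriv h (\<lambda>z. \<phi> z * dir_deriv h H z) z + dir_deriv h (\<lambda>_. - 1) z * (\<phi> z * dir_deriv h H z)"
      by (rule dir_deriv_mult[OF S _ _ True]) (intro differentiable_on_mult d differentiable_on_const)+
    finally show ?thesis
      using dir_deriv_mult[OF S d(1,4) True, of h] dir_deriv_mult[OF S d(3,2) True, of h] True
      by (simp add: dir_deriv_def[of h "\<lambda>_. - 1"] algebra_simps)
  next
    case False
    then have "z \<in> - K" using K(2) by auto
    then have "dir_deriv h (X h) z = dir_deriv h (\<lambda>_. 0) z"
      by (intro dir_deriv_cong[OF oK]) (use X0 in auto)
    then show ?thesis using False by (simp add: dir_deriv_def)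
  qed
  have "(\<integral>z. indicator S z * (H z * laplacian \<phi> z) \<partial>lborel)
      = (\<integral>z. dir_deriv 1 (X 1) z + dir_deriv \<i> (X \<i>) z \<partial>lborel)"
  proof (rule Bochner_Integration.integral_cong[OF refl])
    fix z
    have "\<phi> z * laplacian H z = 0" if "z \<in> S" using lapH[OF that] by simp
    then show "indicator S z * (H z * laplacian \<phi> z) = dir_deriv 1 (X 1) z + dir_deriv \<i> (X \<i>) z"
      by (cases "z \<in> S") (simp_all add: dX laplacian_def algebra_simps)
  qed
  also have "\<dots> = 0" using int0[of 1] int0[of \<i>] by simp
  finally show ?thesis by (simp add: H_def)
qed

subsection \<open>Poisson integrals\<close>

definition poisson :: "complex \<Rightarrow> complex \<Rightarrow> real" where
  "poisson z \<zeta> = (1 - (cmod z)\<^sup>2) / (cmod (z - \<zeta>))\<^sup>2"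

text \<open>The holomorphic function whose real part is the Poisson integral of f. Working with it
  makes Poisson integrals smooth and harmonic by the results on real parts of holomorphic
  functions.\<close>

definition herglotz :: "(complex \<Rightarrow> real) \<Rightarrow> complex \<Rightarrow> complex" where
  "herglotz f z = (\<integral>\<zeta>. of_real (f \<zeta>) * ((\<zeta> + z) / (\<zeta> - z)) \<partial>circle_measure)"

lemma poisson_nonneg: "cmod z \<le> 1 \<Longrightarrow> 0 \<le> poisson z \<zeta>"
  by (simp add: poisson_def power_le_one)

lemma measurable_poisson [measurable]: "poisson z \<in> borel_measurable borel"
  unfolding poisson_def[abs_def] by measurable

lemma Re_herglotz_kernel:
  assumes "cmod \<zeta> = 1"
  shows "Re ((\<zeta> + z) / (\<zeta> - z)) = poisson z \<zeta>"
proof -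
  have "Re ((\<zeta> + z) / (\<zeta> - z)) = Re ((\<zeta> + z) * cnj (\<zeta> - z)) / (cmod (\<zeta> - z))\<^sup>2"
    by (simp add: complex_div_cnj[of "\<zeta> + z"] flip: of_real_power)
  also have "Re ((\<zeta> + z) * cnj (\<zeta> - z)) = (cmod \<zeta>)\<^sup>2 - (cmod z)\<^sup>2"
    unfolding cmod_power2 by (simp add: algebra_simps power2_eq_square)
  finally show ?thesis by (simp add: poisson_def assms norm_minus_commute)
qed

lemma norm_circle_diff_ge: "cmod \<zeta> = 1 \<Longrightarrow> 1 - cmod z \<le> cmod (\<zeta> - z)"
  using norm_triangle_ineq2[of \<zeta> z] by simp

lemma poisson_le_Harnack:
  assumes "cmod z < 1" "cmod \<zeta> = 1"
  shows "poisson z \<zeta> \<le> (1 + cmod z) / (1 - cmod z)"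
proof -
  have "poisson z \<zeta> \<le> (1 - (cmod z)\<^sup>2) / (1 - cmod z)\<^sup>2"
    unfolding poisson_def
    by (intro divide_left_mono power_mono)
      (use assms norm_circle_diff_ge[OF assms(2), of z] in \<open>auto simp: norm_minus_commute power_le_one intro!: mult_pos_pos zero_less_power\<close>)
  also have "\<dots> = (1 + cmod z) / (1 - cmod z)"
  proof -
    have "1 - (cmod z)\<^sup>2 = (1 - cmod z) * (1 + cmod z)" by (simp add: power2_eq_square algebra_simps)
    then show ?thesis using assms(1) by (simp add: power2_eq_square)
  qed
  finally show ?thesis .
qed

context
  fixes f :: "complex \<Rightarrow> real" and C :: real
  assumes f [measurable]: "f \<in> borel_measurable borel" and C: "\<And>\<zeta>. \<bar>f \<zeta>\<bar> \<le> C"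
begin

lemma integrable_circle_bounded:
  fixes k :: "complex \<Rightarrow> 'b :: {banach, second_countable_topology}"
  assumes "k \<in> borel_measurable borel" "\<And>\<zeta>. cmod \<zeta> = 1 \<Longrightarrow> norm (k \<zeta>) \<le> B"
  shows "integrable circle_measure k"
proof -
  interpret finite_measure circle_measure by (rule finite_measure_circle_measure)
  show ?thesis
    by (rule integrable_const_bound[where B = B])
       (use assms AE_circle_measure in \<open>auto elim!: eventually_mono simp: measurable_cong_sets[OF sets_circle_measure refl]\<close>)
qed

text \<open>The identity (\<zeta> + z) / (\<zeta> - z) = 2 \<zeta> / (\<zeta> - z) - 1 leaves z only
  in a Cauchy kernel, whose difference quotients are explicit.\<close>

lemma herglotz_alt:
  assumes z: "cmod z < 1"
  shows "herglotz f z = (\<integral>\<zeta>. of_real (f \<zeta>) * 2 * \<zeta> / (\<zeta> - z) \<partial>circle_measure) - of_real (\<integral>\<zeta>. f \<zeta> \<partial>circle_measure)"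
proof -
  have C0: "0 \<le> C" using C[of 0] by (meson abs_ge_zero order_trans)
  have i1: "integrable circle_measure (\<lambda>\<zeta>. of_real (f \<zeta>) * 2 * \<zeta> / (\<zeta> - z))"
  proof (rule integrable_circle_bounded[where B = "C * 2 / (1 - cmod z)"])
    fix \<zeta> :: complex assume \<zeta>: "cmod \<zeta> = 1"
    show "cmod (of_real (f \<zeta>) * 2 * \<zeta> / (\<zeta> - z)) \<le> C * 2 / (1 - cmod z)"
      using norm_circle_diff_ge[OF \<zeta>, of z] z C[of \<zeta>] C0 \<zeta>
      by (auto simp: norm_mult norm_divide intro!: frac_le)
  qed measurable
  have i2: "integrable circle_measure (\<lambda>\<zeta>. of_real (f \<zeta>) :: complex)"
    by (rule integrable_circle_bounded[where B = C]) (use C in auto)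
  have "herglotz f z = (\<integral>\<zeta>. of_real (f \<zeta>) * 2 * \<zeta> / (\<zeta> - z) - of_real (f \<zeta>) \<partial>circle_measure)"
    unfolding herglotz_def
  proof (rule integral_cong_AE)
    show "AE \<zeta> in circle_measure. of_real (f \<zeta>) * ((\<zeta> + z) / (\<zeta> - z)) = of_real (f \<zeta>) * 2 * \<zeta> / (\<zeta> - z) - of_real (f \<zeta>)"
      using AE_circle_measure
    proof eventually_elim
      case (elim \<zeta>)
      then have "\<zeta> - z \<noteq> 0" using z by auto
      then show ?case by (simp add: field_simps)
    qed
  qed measurable
  then show ?thesis using i1 i2 by simp
qed

text \<open>The difference quotient of 1 / (\<zeta> - z) between y and z0 is exactly 1 / ((\<zeta> -
  y) (\<zeta> - z0)). On a disk of radius midway between |z0| and 1 it is bounded uniformly in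
  \<zeta>, so dominated convergence gives the derivative.\<close>

lemma holomorphic_herglotz: "herglotz f holomorphic_on ball 0 1"
proof -
  have C0: "0 \<le> C" using C[of 0] by (meson abs_ge_zero order_trans)
  define \<Phi> where "\<Phi> z = (\<integral>\<zeta>. of_real (f \<zeta>) * 2 * \<zeta> / (\<zeta> - z) \<partial>circle_measure)" for z
  have "\<exists>D. (\<Phi> has_field_derivative D) (at z0)" if z0: "z0 \<in> ball 0 1" for z0
  proof -
    define \<rho> where "\<rho> = (1 + cmod z0) / 2"
    have \<rho>: "cmod z0 < \<rho>" "\<rho> < 1" using z0 by (auto simp: \<rho>_def)
    have int: "integrable circle_measure (\<lambda>\<zeta>. of_real (f \<zeta>) * 2 * \<zeta> / (\<zeta> - z))" if z: "cmod z < \<rho>" for z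
    proof (rule integrable_circle_bounded[where B = "C * 2 / (1 - cmod z)"])
      fix \<zeta> :: complex assume \<zeta>: "cmod \<zeta> = 1"
      show "cmod (of_real (f \<zeta>) * 2 * \<zeta> / (\<zeta> - z)) \<le> C * 2 / (1 - cmod z)"
        using norm_circle_diff_ge[OF \<zeta>, of z] z \<rho> C[of \<zeta>] C0 \<zeta>
        by (auto simp: norm_mult norm_divide intro!: frac_le)
    qed measurable
    have "((\<lambda>y. (\<Phi> y - \<Phi> z0) / (y - z0)) \<longlongrightarrow> (\<integral>\<zeta>. of_real (f \<zeta>) * 2 * \<zeta> / (\<zeta> - z0)\<^sup>2 \<partial>circle_measure)) (at z0 within ball 0 \<rho>)"
      unfolding tendsto_at_iff_sequentially o_def
    proof (intro allI impI)
      fix X :: "nat \<Rightarrow> complex"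
      assume X: "\<forall>i. X i \<in> ball 0 \<rho> - {z0}" "X \<longlonglongrightarrow> z0"
      have eq: "(\<Phi> (X n) - \<Phi> z0) / (X n - z0) = (\<integral>\<zeta>. of_real (f \<zeta>) * 2 * \<zeta> / ((\<zeta> - X n) * (\<zeta> - z0)) \<partial>circle_measure)" for n
      proof -
        have Xn: "cmod (X n) < \<rho>" "X n \<noteq> z0" using X by auto
        have "(\<Phi> (X n) - \<Phi> z0) / (X n - z0)
            = (\<integral>\<zeta>. (of_real (f \<zeta>) * 2 * \<zeta> / (\<zeta> - X n) - of_real (f \<zeta>) * 2 * \<zeta> / (\<zeta> - z0)) / (X n - z0) \<partial>circle_measure)"
          unfolding \<Phi>_def using int[OF Xn(1)] int[OF \<rho>(1)] by simp
        also have "\<dots> = (\<integral>\<zeta>. of_real (f \<zeta>) * 2 * \<zeta> / ((\<zeta> - X n) * (\<zeta> - z0)) \<partial>circle_measure)"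
        proof (rule integral_cong_AE)
          show "AE \<zeta> in circle_measure. (of_real (f \<zeta>) * 2 * \<zeta> / (\<zeta> - X n) - of_real (f \<zeta>) * 2 * \<zeta> / (\<zeta> - z0)) / (X n - z0)
              = of_real (f \<zeta>) * 2 * \<zeta> / ((\<zeta> - X n) * (\<zeta> - z0))"
            using AE_circle_measure
          proof eventually_elim
            case (elim \<zeta>)
            then have "\<zeta> - z0 \<noteq> 0" "\<zeta> - X n \<noteq> 0" "X n - z0 \<noteq> 0" using Xn \<rho> by auto
            then show ?case by (simp add: divide_simps) (simp add: algebra_simps)
          qed
        qed measurable
        finally show ?thesis .
      qed
      show "(\<lambda>n. (\<Phi> (X n) - \<Phi> z0) / (X n - z0)) \<longlonglongrightarrow> (\<integral>\<zeta>. of_real (f \<zeta>) * 2 * \<zeta> / (\<zeta> - z0)\<^sup>2 \<partial>circle_measure)"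
        unfolding eq
      proof (rule integral_dominated_convergence[where w = "\<lambda>_. C * 2 / ((1 - \<rho>) * (1 - \<rho>))"])
        show "integrable circle_measure (\<lambda>_. C * 2 / ((1 - \<rho>) * (1 - \<rho>)))"
          by (rule integrable_circle_bounded[where B = "\<bar>C * 2 / ((1 - \<rho>) * (1 - \<rho>))\<bar>"]) auto
        show "AE \<zeta> in circle_measure. (\<lambda>n. of_real (f \<zeta>) * 2 * \<zeta> / ((\<zeta> - X n) * (\<zeta> - z0)))
            \<longlonglongrightarrow> of_real (f \<zeta>) * 2 * \<zeta> / (\<zeta> - z0)\<^sup>2"
          using AE_circle_measure
        proof eventually_elim
          case (elim \<zeta>)
          then have "\<zeta> - z0 \<noteq> 0" using \<rho> by auto
          then show ?case
            unfolding power2_eq_square by (intro tendsto_intros X) auto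
        qed
        show "AE \<zeta> in circle_measure. cmod (of_real (f \<zeta>) * 2 * \<zeta> / ((\<zeta> - X n) * (\<zeta> - z0))) \<le> C * 2 / ((1 - \<rho>) * (1 - \<rho>))" for n
          using AE_circle_measure
        proof eventually_elim
          case (elim \<zeta>)
          have "cmod (X n) < \<rho>" using X by auto
          then have "1 - \<rho> \<le> cmod (\<zeta> - X n)" "1 - \<rho> \<le> cmod (\<zeta> - z0)"
            using norm_circle_diff_ge[OF elim, of z0] norm_circle_diff_ge[OF elim, of "X n"] \<rho> by auto
          then show ?case
            using \<rho> C[of \<zeta>] C0 elim unfolding norm_mult norm_divide
            by (intro frac_le) (auto intro!: mult_mono)
        qed
      qed measurable
    qed
    moreover have "at z0 within ball 0 \<rho> = at z0" by (rule at_within_open) (use \<rho> in auto)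
    ultimately show ?thesis by (auto simp: has_field_derivative_iff)
  qed
  then have "\<Phi> holomorphic_on ball 0 1"
    by (auto simp: holomorphic_on_open)
  then have "(\<lambda>z. \<Phi> z - of_real (\<integral>\<zeta>. f \<zeta> \<partial>circle_measure)) holomorphic_on ball 0 1"
    by (intro holomorphic_intros)
  then show ?thesis
    by (rule holomorphic_transform) (simp add: herglotz_alt \<Phi>_def)
qed

lemma integrable_poisson:
  assumes z: "cmod z < 1"
  shows "integrable circle_measure (\<lambda>\<zeta>. f \<zeta> * poisson z \<zeta>)"
proof (rule integrable_circle_bounded[where B = "C * ((1 + cmod z) / (1 - cmod z))"])
  have C0: "0 \<le> C" using C[of 0] by (meson abs_ge_zero order_trans)
  fix \<zeta> :: complex assume \<zeta>: "cmod \<zeta> = 1"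
  show "norm (f \<zeta> * poisson z \<zeta>) \<le> C * ((1 + cmod z) / (1 - cmod z))"
    unfolding real_norm_def abs_mult
    using C[of \<zeta>] C0 poisson_le_Harnack[OF z \<zeta>] poisson_nonneg[of z \<zeta>] z by (intro mult_mono) auto
qed measurable

lemma Re_herglotz:
  assumes z: "cmod z < 1"
  shows "Re (herglotz f z) = (\<integral>\<zeta>. f \<zeta> * poisson z \<zeta> \<partial>circle_measure)"
proof -
  have C0: "0 \<le> C" using C[of 0] by (meson abs_ge_zero order_trans)
  have "integrable circle_measure (\<lambda>\<zeta>. of_real (f \<zeta>) * ((\<zeta> + z) / (\<zeta> - z)))"
  proof (rule integrable_circle_bounded[where B = "C * (2 / (1 - cmod z))"])
    fix \<zeta> :: complex assume \<zeta>: "cmod \<zeta> = 1"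
    have "cmod (\<zeta> + z) \<le> 2" using norm_triangle_ineq[of \<zeta> z] \<zeta> z by simp
    then show "cmod (of_real (f \<zeta>) * ((\<zeta> + z) / (\<zeta> - z))) \<le> C * (2 / (1 - cmod z))"
      unfolding norm_mult norm_divide norm_of_real
      using norm_circle_diff_ge[OF \<zeta>, of z] z C[of \<zeta>] C0 by (intro mult_mono frac_le) auto
  qed measurable
  then have "Re (herglotz f z) = (\<integral>\<zeta>. Re (of_real (f \<zeta>) * ((\<zeta> + z) / (\<zeta> - z))) \<partial>circle_measure)"
    unfolding herglotz_def by simp
  also have "\<dots> = (\<integral>\<zeta>. f \<zeta> * poisson z \<zeta> \<partial>circle_measure)"
  proof (rule integral_cong_AE)
    show "AE \<zeta> in circle_measure. Re (of_real (f \<zeta>) * ((\<zeta> + z) / (\<zeta> - z))) = f \<zeta> * poisson z \<zeta>"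
      using AE_circle_measure
    proof eventually_elim
      case (elim \<zeta>)
      then show ?case
        using Re_herglotz_kernel[OF elim, of z] by (simp del: times_divide_eq_right)
    qed
  qed measurable
  finally show ?thesis .
qed

end

text \<open>The Herglotz transform of a constant is holomorphic and rotation invariant, hence constant.\<close>

lemma integral_poisson_eq_1:
  assumes z: "cmod z < 1"
  shows "(\<integral>\<zeta>. poisson z \<zeta> \<partial>circle_measure) = 1"
proof -
  let ?u = "\<lambda>z. \<integral>\<zeta>. poisson z \<zeta> \<partial>circle_measure"
  define \<Phi> where "\<Phi> = herglotz (\<lambda>_. 1)"
  have hol: "\<Phi> holomorphic_on ball 0 1"
    unfolding \<Phi>_def by (rule holomorphic_herglotz[where C = 1]) auto
  have rot: "\<Phi> (cis t * w) = \<Phi> w" for t w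
  proof -
    have rotm: "distr circle_measure borel ((*) (cis t)) = circle_measure"
    proof (rule measure_eqI)
      fix A assume A: "A \<in> sets (distr circle_measure borel ((*) (cis t)))"
      then have [measurable]: "A \<in> sets borel" by simp
      have "emeasure (distr circle_measure borel ((*) (cis t))) A = (\<integral>\<^sup>+\<zeta>. indicator A \<zeta> \<partial>distr circle_measure borel ((*) (cis t)))"
        by simp
      also have "\<dots> = (\<integral>\<^sup>+\<zeta>. indicator A (cis t * \<zeta>) \<partial>circle_measure)" by (rule nn_integral_distr) auto
      also have "\<dots> = (\<integral>\<^sup>+\<zeta>. indicator A \<zeta> \<partial>circle_measure)" by (rule nn_integral_circle_rotate) auto
      finally show "emeasure (distr circle_measure borel ((*) (cis t))) A = emeasure circle_measure A" by simp
    qed simp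
    have "\<Phi> (cis t * w) = (\<integral>\<zeta>. (\<zeta> + cis t * w) / (\<zeta> - cis t * w) \<partial>distr circle_measure borel ((*) (cis t)))"
      by (simp add: rotm \<Phi>_def herglotz_def)
    also have "\<dots> = (\<integral>\<zeta>. (cis t * \<zeta> + cis t * w) / (cis t * \<zeta> - cis t * w) \<partial>circle_measure)"
      by (rule integral_distr) auto
    also have "\<dots> = \<Phi> w"
      unfolding \<Phi>_def herglotz_def
      by (simp flip: distrib_left right_diff_distrib)
    finally show ?thesis .
  qed
  \<comment> \<open>The curve t \<mapsto> \<Phi>(cis t * w) is constant, and its derivative at 0 is
    \<i> w \<Phi>'(w). The origin remains as a single exceptional point, which continuity takes care
    of.\<close>
  have d0: "deriv \<Phi> w = 0" if w: "w \<in> ball 0 1 - {0}" for w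
  proof -
    have D: "(\<Phi> has_field_derivative deriv \<Phi> w) (at w)"
      by (rule holomorphic_derivI[OF hol]) (use w in auto)
    have "((\<lambda>t. cis t * w) has_vector_derivative (\<i> * w)) (at 0)"
      unfolding cis_conv_exp
      by (rule has_vector_derivative_real_field[of "\<lambda>t. exp (\<i> * t) * w"]) (auto intro!: derivative_eq_intros)
    then have "((\<Phi> \<circ> (\<lambda>t. cis t * w)) has_vector_derivative (\<i> * w * deriv \<Phi> w)) (at 0)"
      by (rule field_vector_diff_chain_at) (use D in simp)
    moreover have "\<Phi> \<circ> (\<lambda>t. cis t * w) = (\<lambda>_. \<Phi> w)" by (simp add: rot fun_eq_iff)
    ultimately have "\<i> * w * deriv \<Phi> w = 0"
      using vector_derivative_unique_at[OF _ has_vector_derivative_const] by metis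
    then show ?thesis using w by simp
  qed
  have "\<Phi> constant_on ball 0 1"
  proof (rule DERIV_zero_connected_constant_on[of _ "{0}"])
    show "continuous_on (ball 0 1) \<Phi>" by (rule holomorphic_on_imp_continuous_on[OF hol])
    show "\<forall>x\<in>ball 0 1 - {0}. (\<Phi> has_field_derivative 0) (at x)"
      using holomorphic_derivI[OF hol open_ball] d0 by (metis Diff_iff)
  qed auto
  then have "\<Phi> z = \<Phi> 0" using z by (auto simp: constant_on_def)
  moreover have "\<Phi> 0 = 1"
  proof -
    have "\<Phi> 0 = (\<integral>\<zeta>. 1 \<partial>circle_measure)"
      unfolding \<Phi>_def herglotz_def
      by (rule integral_cong_AE) (use AE_circle_measure in \<open>auto elim!: eventually_mono\<close>)
    then show ?thesis by (simp add: measure_def emeasure_circle_measure_UNIV)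
  qed
  moreover have "Re (\<Phi> z) = ?u z"
    unfolding \<Phi>_def by (subst Re_herglotz[where C = 1]) (use z in auto)
  ultimately show ?thesis by simp
qed

subsection \<open>Test functions resembling Green functions\<close>

lemma laplacian_cong:
  assumes "open U" "z \<in> U" "\<And>x. x \<in> U \<Longrightarrow> f x = g x"
  shows "laplacian f z = laplacian g z"
proof -
  have "dir_deriv h (dir_deriv h f) z = dir_deriv h (dir_deriv h g) z" for h
    by (rule dir_deriv_cong[OF assms(1,2)], rule dir_deriv_cong[OF assms(1) _ assms(3)])
  then show ?thesis by (simp add: laplacian_def)
qed

text \<open>A branch of the logarithm exists only locally on the punctured plane. On the disk about
  w of radius |w| the quotient z / w stays in the right half plane, where the principal branch is
  holomorphic.\<close>

lemma minus_ln_norm_eq_Re: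
  fixes w :: complex
  assumes w: "w \<noteq> 0"
  obtains V F where "open V" "w \<in> V" "F holomorphic_on V" "\<And>z. z \<in> V \<Longrightarrow> - ln (cmod z) = Re (F z)"
    "deriv F w = - 1 / w"
proof
  let ?V = "ball w (cmod w)" and ?F = "\<lambda>z. - Ln (z / w) - of_real (ln (cmod w))"
  show "open ?V" "w \<in> ?V" using w by auto
  have nn: "z / w \<notin> \<real>\<^sub>\<le>\<^sub>0" "z \<noteq> 0" if z: "z \<in> ?V" for z
  proof -
    have "cmod (1 - z / w) < 1"
    proof -
      have "1 - z / w = (w - z) / w" using w by (simp add: field_simps)
      then show ?thesis using z w by (simp add: norm_divide dist_norm)
    qed
    moreover have "1 - Re (z / w) \<le> cmod (1 - z / w)" using complex_Re_le_cmod[of "1 - z / w"] by simp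
    ultimately have "Re (z / w) > 0" by linarith
    then show "z / w \<notin> \<real>\<^sub>\<le>\<^sub>0" "z \<noteq> 0" by (auto simp: complex_nonpos_Reals_iff)
  qed
  show "?F holomorphic_on ?V"
    by (intro holomorphic_intros) (use w nn in auto)
  show "- ln (cmod z) = Re (?F z)" if "z \<in> ?V" for z
    using nn[OF that] w by (simp add: norm_divide ln_div)
  have "(?F has_field_derivative - 1 / w) (at w)"
    using w by (auto intro!: derivative_eq_intros simp: complex_nonpos_Reals_iff field_simps)
  then show "deriv ?F w = - 1 / w" by (rule DERIV_imp_deriv)
qed

lemma smooth_upto_minus_ln_norm: "smooth_upto k (- {0}) (\<lambda>z. - ln (cmod z))"
proof (rule smooth_upto_local)
  fix w :: complex assume "w \<in> - {0}"
  then have "w \<noteq> 0" by simp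
  then obtain V F where V: "open V" "w \<in> V" "F holomorphic_on V"
    "\<And>z. z \<in> V \<Longrightarrow> - ln (cmod z) = Re (F z)"
    by (rule minus_ln_norm_eq_Re) (rule that; (assumption | simp))
  have "smooth_upto k V (\<lambda>z. - ln (cmod z))"
    by (rule smooth_upto_cong[OF V(1) _ smooth_upto_Re_holomorphic[OF V(1,3)]]) (simp add: V(4))
  then show "\<exists>V. open V \<and> w \<in> V \<and> smooth_upto k V (\<lambda>z. - ln (cmod z))" using V by blast
qed

lemma minus_ln_norm_derivatives:
  assumes w: "w \<noteq> 0"
  shows "laplacian (\<lambda>z. - ln (cmod z)) w = 0"
    and "(dir_deriv 1 (\<lambda>z. - ln (cmod z)) w)\<^sup>2 + (dir_deriv \<i> (\<lambda>z. - ln (cmod z)) w)\<^sup>2 = 1 / (cmod w)\<^sup>2"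
proof -
  obtain V F where V: "open V" "w \<in> V" "F holomorphic_on V"
    "\<And>z. z \<in> V \<Longrightarrow> - ln (cmod z) = Re (F z)" and F: "deriv F w = - (1 / w)"
    by (rule minus_ln_norm_eq_Re[OF w]) (rule that; (assumption | simp))
  have "laplacian (\<lambda>z. - ln (cmod z)) w = laplacian (\<lambda>z. Re (F z)) w"
    by (rule laplacian_cong[OF V(1,2,4)])
  then show "laplacian (\<lambda>z. - ln (cmod z)) w = 0"
    using laplacian_Re_holomorphic[OF V(1,3,2)] by simp
  have d: "dir_deriv h (\<lambda>z. - ln (cmod z)) w = Re (- (1 / w) * h)" for h
  proof -
    have "dir_deriv h (\<lambda>z. - ln (cmod z)) w = dir_deriv h (\<lambda>z. Re (F z)) w"
      by (rule dir_deriv_cong[OF V(1,2,4)])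
    then show ?thesis using dir_deriv_Re_holomorphic[OF V(1,3,2)] F by simp
  qed
  have "(Re (- k * 1))\<^sup>2 + (Re (- k * \<i>))\<^sup>2 = (cmod k)\<^sup>2" for k
    by (simp add: cmod_power2)
  from this[of "1 / w"] show "(dir_deriv 1 (\<lambda>z. - ln (cmod z)) w)\<^sup>2 + (dir_deriv \<i> (\<lambda>z. - ln (cmod z)) w)\<^sup>2 = 1 / (cmod w)\<^sup>2"
    unfolding d by (simp add: norm_divide power_divide)
qed

text \<open>A smooth version of \<open>log (1 / |z|)\<close>, constant near the origin, and minus its Laplacian.
  Isabelle's \<open>ln 0 = 0\<close> makes \<open>core_density\<close> vanish at the origin.\<close>

definition trunc_log :: "complex \<Rightarrow> real" where
  "trunc_log z = (if z = 0 then 6 - ramp 0 1 else - ln (cmod z) - ramp 0 (- ln (cmod z) - 5))"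

definition core_density :: "complex \<Rightarrow> real" where
  "core_density z = ramp 2 (- ln (cmod z) - 5) / (cmod z)\<^sup>2"

lemma norm_le_exp_minus_iff:
  assumes "z \<noteq> 0"
  shows "cmod z \<le> exp (- c) \<longleftrightarrow> c \<le> - ln (cmod z)" "exp (- c) \<le> cmod z \<longleftrightarrow> - ln (cmod z) \<le> c"
  using ln_le_cancel_iff[of "cmod z" "exp (- c)"] ln_le_cancel_iff[of "exp (- c)" "cmod z"] assms by auto

lemma trunc_log_eq_ln:
  assumes "exp (- 5) \<le> cmod z"
  shows "trunc_log z = - ln (cmod z)"
proof -
  have z: "z \<noteq> 0" using assms exp_gt_zero[of "- 5 :: real"] by (metis norm_zero not_le)
  then have "- ln (cmod z) - 5 \<le> 0" using norm_le_exp_minus_iff(2)[OF z, of 5] assms by simp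
  then show ?thesis using z ramp_neg(1) by (simp add: trunc_log_def)
qed

text \<open>With L = - ln |z| \<ge> 6 the ramp equals L - 6 + \<open>ramp 0 1\<close>, so L cancels.
  This is the origin of the value assigned at 0.\<close>

lemma trunc_log_const:
  assumes "cmod z \<le> exp (- 6)"
  shows "trunc_log z = 6 - ramp 0 1"
proof (cases "z = 0")
  case False
  then have "1 \<le> - ln (cmod z) - 5" using norm_le_exp_minus_iff(1)[OF False, of 6] assms by simp
  from ramp_affine[OF this] show ?thesis using False by (simp add: trunc_log_def)
qed (simp add: trunc_log_def)

lemma trunc_log_ge_5:
  assumes "cmod z \<le> exp (- 5)"
  shows "5 \<le> trunc_log z"
proof (cases "z = 0")
  case False
  then have "0 \<le> - ln (cmod z) - 5" using norm_le_exp_minus_iff(1)[OF False, of 5] assms by simp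
  then show ?thesis using False ramp_le[of "- ln (cmod z) - 5"] by (simp add: trunc_log_def)
qed (use ramp_le[of 1] in \<open>simp add: trunc_log_def\<close>)

lemma trunc_log_ge:
  assumes "cmod z < 1"
  shows "1 - cmod z \<le> trunc_log z"
proof (cases "cmod z \<le> exp (- 5)")
  case True
  then show ?thesis using trunc_log_ge_5[OF True] norm_ge_zero[of z] by linarith
next
  case False
  then have "0 < cmod z" using exp_gt_zero[of "- 5 :: real"] by linarith
  then show ?thesis using False trunc_log_eq_ln[of z] ln_le_minus_one[of "cmod z"] by simp
qed

lemma core_density_nonneg: "0 \<le> core_density z"
  by (simp add: core_density_def ramp2_nonneg)

lemma core_density_nonzero:
  assumes "core_density z \<noteq> 0"
  shows "exp (- 6) < cmod z" "cmod z < exp (- 5)"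
proof -
  have z: "z \<noteq> 0" and r: "ramp 2 (- ln (cmod z) - 5) \<noteq> 0"
    using assms by (auto simp: core_density_def)
  have 1: "0 < - ln (cmod z) - 5" using r ramp_neg(3) by (metis not_le)
  have 2: "- ln (cmod z) - 5 < 1" using r ramp_ge1(2) by (metis not_le)
  have e: "exp (ln (cmod z)) = cmod z" using z by simp
  have "exp (- 6) < exp (ln (cmod z))" "exp (ln (cmod z)) < exp (- 5)" using 1 2 by simp_all
  then show "exp (- 6) < cmod z" "cmod z < exp (- 5)" unfolding e .
qed

lemma measurable_core_density [measurable]: "core_density \<in> borel_measurable borel"
proof -
  have [measurable]: "ramp 2 \<in> borel_measurable borel"
    by (rule borel_measurable_continuous_onI[OF continuous_on_ramp])
  show ?thesis unfolding core_density_def[abs_def] by measurable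
qed

lemma smooth_upto_trunc_log: "smooth_upto k (- {0}) trunc_log"
proof (rule smooth_upto_cong)
  show "smooth_upto k (- {0}) (\<lambda>z. - ln (cmod z) - ramp 0 (- ln (cmod z) - 5))"
    by (intro smooth_upto_diff smooth_upto_minus_ln_norm smooth_upto_const
        smooth_upto_compose[where c = ramp] DERIV_ramp) auto
qed (auto simp: trunc_log_def)

text \<open>Away from 0 the function is a one-variable function of the harmonic - ln |z|, whose
  gradient has length 1 / |z|. The gradient formula serves to recognize the positive part of the
  test function's Laplacian as radial when there is no barrier.\<close>

lemma trunc_log_derivatives:
  assumes w: "w \<noteq> 0"
  shows "laplacian trunc_log w = - core_density w"
    and "(dir_deriv 1 trunc_log w)\<^sup>2 + (dir_deriv \<i> trunc_log w)\<^sup>2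
      = (1 - ramp 1 (- ln (cmod w) - 5))\<^sup>2 / (cmod w)\<^sup>2"
proof -
  have U: "open (- {0 :: complex})" "w \<in> - {0}" using w by auto
  define k :: "real \<Rightarrow> real" where "k x = x - ramp 0 (x - 5)" for x
  define k' :: "real \<Rightarrow> real" where "k' x = 1 - ramp 1 (x - 5)" for x
  define k'' :: "real \<Rightarrow> real" where "k'' x = - ramp 2 (x - 5)" for x
  have shift: "((\<lambda>x. ramp n (x - 5)) has_real_derivative ramp (Suc n) (x - 5)) (at x)" for n x
  proof -
    have "((\<lambda>x. x - 5) has_real_derivative 1) (at x)" by (auto intro!: derivative_eq_intros)
    from DERIV_chain2[where f = "ramp n" and g = "\<lambda>x. x - 5", OF DERIV_ramp this] show ?thesis by simp
  qed
  have k: "(k has_real_derivative k' x) (at x)" for x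
    unfolding k_def[abs_def] k'_def using shift[of 0 x] by (auto intro!: derivative_eq_intros)
  have k': "(k' has_real_derivative k'' x) (at x)" for x
    unfolding k''_def k'_def[abs_def] using shift[of 1 x]
    by (auto intro!: derivative_eq_intros simp: numeral_2_eq_2)
  have eq: "trunc_log z = k (- ln (cmod z))" if "z \<in> - {0}" for z
    using that by (simp add: trunc_log_def k_def)
  have "laplacian trunc_log w = laplacian (\<lambda>z. k (- ln (cmod z))) w"
    by (rule laplacian_cong[OF U eq])
  also have "\<dots> = k'' (- ln (cmod w)) * (1 / (cmod w)\<^sup>2) + k' (- ln (cmod w)) * 0"
    using laplacian_compose[OF U(1) smooth_upto_minus_ln_norm k k' U(2)] minus_ln_norm_derivatives[OF w]
    by simp
  finally show "laplacian trunc_log w = - core_density w" by (simp add: core_density_def k''_def)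
  have "dir_deriv h trunc_log w = k' (- ln (cmod w)) * dir_deriv h (\<lambda>z. - ln (cmod z)) w" for h
  proof -
    have "dir_deriv h trunc_log w = dir_deriv h (\<lambda>z. k (- ln (cmod z))) w"
      by (rule dir_deriv_cong[OF U eq])
    also have "\<dots> = k' (- ln (cmod w)) * dir_deriv h (\<lambda>z. - ln (cmod z)) w"
      by (rule dir_deriv_compose[OF U(1) smooth_upto_differentiable[OF smooth_upto_minus_ln_norm] k U(2)])
    finally show ?thesis .
  qed
  then have "(dir_deriv 1 trunc_log w)\<^sup>2 + (dir_deriv \<i> trunc_log w)\<^sup>2 = (k' (- ln (cmod w)))\<^sup>2 *
    ((dir_deriv 1 (\<lambda>z. - ln (cmod z)) w)\<^sup>2 + (dir_deriv \<i> (\<lambda>z. - ln (cmod z)) w)\<^sup>2)"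
    by (simp add: power_mult_distrib distrib_left)
  then show "(dir_deriv 1 trunc_log w)\<^sup>2 + (dir_deriv \<i> trunc_log w)\<^sup>2
      = (1 - ramp 1 (- ln (cmod w) - 5))\<^sup>2 / (cmod w)\<^sup>2"
    unfolding minus_ln_norm_derivatives(2)[OF w] by (simp add: k'_def)
qed

text \<open>In the variable s = |z|^2 the density is the exact derivative of -2 times the slope of
  the ramp, so the mass is 2 \<pi> times the total increase of that slope, which is 1.\<close>

lemma nn_integral_core_density: "(\<integral>\<^sup>+z. ennreal (core_density z) \<partial>lborel) = ennreal (2 * pi)"
proof -
  define g where "g s = ramp 2 (- ln (sqrt s) - 5) / s" for s :: real
  have [measurable]: "ramp 2 \<in> borel_measurable borel"
    by (rule borel_measurable_continuous_onI[OF continuous_on_ramp])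
  have [measurable]: "g \<in> borel_measurable borel" unfolding g_def[abs_def] by measurable
  have "(\<integral>\<^sup>+z. ennreal (core_density z) \<partial>lborel)
      = (\<integral>\<^sup>+z. ennreal (g ((cmod z)\<^sup>2)) * indicator (ball 0 1) z \<partial>lborel)"
  proof (rule nn_integral_cong)
    fix z
    have e5: "exp (- 5) < (1::real)" by simp
    have "core_density z = 0" if "z \<notin> ball 0 1"
    proof (rule ccontr)
      assume "core_density z \<noteq> 0"
      from core_density_nonzero(2)[OF this] that e5 show False
        unfolding mem_ball_0 by linarith
    qed
    then show "ennreal (core_density z) = ennreal (g ((cmod z)\<^sup>2)) * indicator (ball 0 1) z"
      by (cases "z \<in> ball 0 1") (auto simp: g_def core_density_def)
  qed
  also have "\<dots> = ennreal pi * (\<integral>\<^sup>+s. ennreal (g s) * indicator {0..<1} s \<partial>lborel)"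
    by (rule nn_integral_norm_square_disk) simp
  \<comment> \<open>The lower limit exp(-12) is the square of the radius exp(-6) inside which the
    density vanishes; it keeps the antiderivative away from its singularity at 0.\<close>
  also have "(\<integral>\<^sup>+s. ennreal (g s) * indicator {0..<1} s \<partial>lborel)
      = (\<integral>\<^sup>+s. ennreal (g s) * indicator {exp (- 12)..1} s \<partial>lborel)"
  proof (rule nn_integral_cong)
    fix s :: real
    have "g s = 0" if "0 \<le> s" "s < exp (- 12)"
    proof (cases "s = 0")
      case False
      then have "ln s < - 12" using that by (metis exp_less_cancel_iff exp_ln less_eq_real_def)
      then have "1 \<le> - ln (sqrt s) - 5" using that False by (simp add: ln_sqrt)
      then show ?thesis by (simp add: g_def ramp_ge1)
    qed (simp add: g_def)
    moreover have "g 1 = 0" by (simp add: g_def ramp_neg)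
    moreover have "0 \<le> s" if "\<not> s < exp (- 12)"
      using that exp_gt_zero[of "- 12 :: real"] by linarith
    ultimately show "ennreal (g s) * indicator {0..<1} s = ennreal (g s) * indicator {exp (- 12)..1} s"
      by (cases "s = 1"; cases "s < exp (- 12)") (auto simp: indicator_def)
  qed
  also have "\<dots> = - 2 * ramp 1 (- ln (sqrt 1) - 5) - - 2 * ramp 1 (- ln (sqrt (exp (- 12))) - 5)"
  proof (rule nn_integral_FTC_Icc[where F = "\<lambda>s. - 2 * ramp 1 (- ln (sqrt s) - 5)"])
    fix s :: real assume "s \<in> {exp (- 12)..1}"
    then have s: "s > 0" using exp_gt_zero[of "- 12 :: real"] unfolding atLeastAtMost_iff by linarith
    show "((\<lambda>s. - 2 * ramp 1 (- ln (sqrt s) - 5)) has_real_derivative g s) (at s)"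
    proof -
      have "((\<lambda>s. - ln (sqrt s) - 5) has_real_derivative - (1 / (2 * s))) (at s)"
        using s by (auto intro!: derivative_eq_intros simp: field_simps real_sqrt_mult_self simp flip: real_sqrt_mult)
      from DERIV_cmult[OF DERIV_chain2[where f = "ramp 1", OF DERIV_ramp this], of "- 2"]
      show ?thesis by (simp add: g_def numeral_2_eq_2)
    qed
    show "0 \<le> g s" using s by (simp add: g_def ramp2_nonneg)
  qed auto
  also have "\<dots> = ennreal 2" by (simp add: ramp_neg(2)[unfolded One_nat_def] ramp_ge1(1)[unfolded One_nat_def] ln_sqrt)
  also have "ennreal pi * ennreal 2 = ennreal (2 * pi)" by (subst ennreal_mult[symmetric]) (simp_all add: mult.commute)
  finally show ?thesis .
qed

section \<open>Gluing the Green-like test function\<close>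

lemma dir_deriv_const [simp]: "dir_deriv h (\<lambda>_. c) = (\<lambda>_. 0)"
  by (auto simp: dir_deriv_def)

lemma laplacian_const [simp]: "laplacian (\<lambda>_. c) z = 0"
  by (simp add: laplacian_def)

lemma laplacian_cmult:
  assumes "open U" "smooth_upto 2 U f" "z \<in> U"
  shows "laplacian (\<lambda>x. c * f x) z = c * laplacian f z"
  using laplacian_mult[OF assms(1) smooth_upto_const assms(2,3), of c] by simp

text \<open>The function \<phi> is a smoothed positive part, at scale e, of \<open>trunc_log\<close>
  - Re F - e; the shift by e makes it vanish near the circle. Composing with the convex ramp splits
  the Laplacian into a nonnegative gradient term a and the slope times -
  \<open>core_density\<close>. The last conclusion, radial symmetry of a when F = 0, is what permits
  averaging over circles.\<close>

lemma Green_test_function: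
  fixes F :: "complex \<Rightarrow> complex" and e :: real
  assumes F: "F holomorphic_on ball 0 1" and F0: "\<And>z. z \<in> ball 0 1 \<Longrightarrow> 0 \<le> Re (F z)"
    and F1: "\<And>z. cmod z \<le> exp (- 5) \<Longrightarrow> Re (F z) \<le> 1" and e: "0 < e" "e \<le> 1"
  obtains \<phi> a where "test_function (ball 0 1) \<phi>" "\<And>z. 0 \<le> \<phi> z"
    "\<And>z. z \<in> ball 0 1 \<Longrightarrow> trunc_log z - Re (F z) - 2 * e \<le> \<phi> z"
    "\<And>z. laplacian \<phi> z = a z - core_density z" "\<And>z. 0 \<le> a z" "a \<in> borel_measurable borel"
    "\<exists>C. \<forall>z. a z \<le> C"
    "\<And>z. a z \<noteq> 0 \<Longrightarrow> exp (- 5) < cmod z \<and> cmod z \<le> exp (- e) \<and> - ln (cmod z) - Re (F z) \<le> 2 * e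
        \<and> 0 < - ln (cmod z) - Re (F z)"
    "\<And>z. F = (\<lambda>_. 0) \<Longrightarrow> a z = a (of_real (cmod z))"
proof -
  define u where "u z = Re (F z)" for z
  define W where "W z = (trunc_log z - u z) * (1 / e) - 1" for z
  define \<phi> where "\<phi> z = (if cmod z < 1 then e * ramp 0 (W z) else 0)" for z
  define a where "a z = laplacian \<phi> z + core_density z" for z
  let ?D = "ball (0::complex) 1"
  \<comment> \<open>Three patches cover the plane: the punctured disk, where the defining formula is
    smooth; a central disk, where the logarithm is truncated to a constant and the ramp is affine;
    and the exterior of radius exp(-e), where \<phi> vanishes.\<close>
  let ?U1 = "ball (0::complex) 1 - {0}" and ?U2 = "ball (0::complex) (exp (- 6))" and ?U3 = "- cball (0::complex) (exp (- e))"
  have op: "open ?U1" "open ?U2" "open ?U3" by (auto intro!: open_Diff)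
  have e65: "exp (- 6) < (1::real)" "exp (- 5) < (1::real)" "exp (- 6) < exp (- 5 :: real)" by simp_all
  have sub2: "?U2 \<subseteq> ?D" by (rule subset_ball) (use e65(1) in simp)
  have ee: "exp (- e) < 1" using e by simp
  have eW: "e * W z = trunc_log z - u z - e" for z unfolding W_def using e by (simp add: field_simps)
  have \<phi>1: "\<phi> z = e * ramp 0 (W z)" if "z \<in> ?D" for z using that by (simp add: \<phi>_def)
  \<comment> \<open>Near the center the truncated logarithm is at least 5 and Re F at most 1. The
    gap 4, divided by e \<le> 1, brings W to at least 3, beyond the curved part of the ramp.\<close>
  have Wbig: "1 \<le> W z" if "cmod z \<le> exp (- 5)" for z
  proof -
    have "4 \<le> trunc_log z - u z" using trunc_log_ge_5[OF that] F1[OF that] by (simp add: u_def)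
    also have "\<dots> = (trunc_log z - u z) * 1" by simp
    also have "\<dots> \<le> (trunc_log z - u z) * (1 / e)"
      using e calculation by (intro mult_left_mono) (auto simp: field_simps)
    finally show ?thesis by (simp add: W_def)
  qed
  have \<phi>2: "\<phi> z = (6 - ramp 0 1) - u z - 2 * e + e * ramp 0 1" if "z \<in> ?U2" for z
  proof -
    have z: "cmod z \<le> exp (- 6)" "cmod z \<le> exp (- 5)" "z \<in> ?D"
      using that e65 unfolding mem_ball_0 by linarith+
    have "\<phi> z = e * (W z - 1 + ramp 0 1)" using \<phi>1[OF z(3)] ramp_affine[OF Wbig[OF z(2)]] by simp
    also have "\<dots> = (6 - ramp 0 1) - u z - 2 * e + e * ramp 0 1"
      using eW[of z] trunc_log_const[OF z(1)] by (simp add: distrib_left right_diff_distrib)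
    finally show ?thesis .
  qed
  have \<phi>3: "\<phi> z = 0" if "z \<in> ?U3" for z
  proof (cases "cmod z < 1")
    case True
    have z: "exp (- e) < cmod z" using that by simp
    then have z0: "z \<noteq> 0" using exp_gt_zero[of "- e"] by (metis norm_zero less_asym)
    have "exp (- 5) \<le> exp (- e)" using e by simp
    then have "trunc_log z = - ln (cmod z)" using z by (intro trunc_log_eq_ln) linarith
    moreover have "- ln (cmod z) \<le> e" using norm_le_exp_minus_iff(2)[OF z0, of e] z by simp
    moreover have "0 \<le> u z" using F0[of z] True by (simp add: u_def)
    ultimately have "trunc_log z - u z \<le> e" by simp
    then have "W z \<le> 0" using e by (simp add: W_def field_simps)
    then show ?thesis using True by (simp add: \<phi>_def ramp_neg)
  qed (simp add: \<phi>_def)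
  have smu: "smooth_upto k U u" if "open U" "U \<subseteq> ?D" for k U
    unfolding u_def[abs_def] by (rule smooth_upto_Re_holomorphic[OF that(1) holomorphic_on_subset[OF F that(2)]])
  have smW: "smooth_upto k ?U1 W" for k
    unfolding W_def[abs_def]
    by (intro smooth_upto_diff smooth_upto_mult op smu smooth_upto_const smooth_upto_subset[OF smooth_upto_trunc_log]) auto
  have sm1: "smooth_upto k ?U1 \<phi>" for k
  proof (rule smooth_upto_cong[OF op(1)])
    show "smooth_upto k ?U1 (\<lambda>z. e * ramp 0 (W z))"
      by (intro smooth_upto_mult smooth_upto_const smooth_upto_compose[where c = ramp] DERIV_ramp smW op)
  qed (auto simp: \<phi>_def)
  have sm2: "smooth_upto k ?U2 \<phi>" for k
  proof (rule smooth_upto_cong[OF op(2)])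
    show "smooth_upto k ?U2 (\<lambda>z. (6 - ramp 0 1) - u z - 2 * e + e * ramp 0 1)"
      by (intro smooth_upto_add smooth_upto_diff smooth_upto_const smu op sub2)
  qed (simp add: \<phi>2)
  have sm3: "smooth_upto k ?U3 \<phi>" for k
    by (rule smooth_upto_cong[OF op(3) _ smooth_upto_const[of _ _ 0]]) (simp add: \<phi>3)
  have cover: "z \<in> ?U1 \<or> z \<in> ?U2 \<or> z \<in> ?U3" for z
  proof (cases "cmod z < 1")
    case True
    then show ?thesis by (cases "z = 0") simp_all
  next
    case False
    then have "z \<in> ?U3" unfolding Compl_iff mem_cball_0 using ee by linarith
    then show ?thesis by blast
  qed
  have "smooth_upto k UNIV \<phi>" for k
    by (rule smooth_upto_local) (use cover sm1 sm2 sm3 op in meson)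
  moreover have supp: "closure {z. \<phi> z \<noteq> 0} \<subseteq> cball 0 (exp (- e))"
    by (rule closure_minimal) (use \<phi>3 in force, simp)
  ultimately have test: "test_function ?D \<phi>"
    unfolding test_function_def smooth_plane_iff
  proof (intro conjI allI)
    show "compact (closure {z. \<phi> z \<noteq> 0})"
      using supp by (auto simp: compact_eq_bounded_closed intro: bounded_subset[OF bounded_cball])
    have "cball (0::complex) (exp (- e)) \<subseteq> ?D"
    proof
      fix z :: complex assume "z \<in> cball 0 (exp (- e))"
      then show "z \<in> ?D" unfolding mem_cball_0 mem_ball_0 using ee by linarith
    qed
    then show "closure {z. \<phi> z \<noteq> 0} \<subseteq> ?D" using supp by blast
  qed
  have a1: "a z = e * ramp 2 (W z) * ((dir_deriv 1 W z)\<^sup>2 + (dir_deriv \<i> W z)\<^sup>2)" if z: "z \<in> ?U1" for z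
  proof -
    have z0: "z \<noteq> 0" and zD: "z \<in> ?D" using z by auto
    have "laplacian \<phi> z = laplacian (\<lambda>z. e * ramp 0 (W z)) z"
      by (rule laplacian_cong[OF op(1) z]) (auto simp: \<phi>_def)
    also have "\<dots> = e * laplacian (\<lambda>z. ramp 0 (W z)) z"
      by (rule laplacian_cmult[OF op(1) smooth_upto_compose[where c = ramp and n = 0, OF op(1) DERIV_ramp smW] z])
    also have "laplacian (\<lambda>z. ramp 0 (W z)) z =
        ramp 2 (W z) * ((dir_deriv 1 W z)\<^sup>2 + (dir_deriv \<i> W z)\<^sup>2) + ramp 1 (W z) * laplacian W z"
      by (rule laplacian_compose[OF op(1) smW]) (use DERIV_ramp[of 0] DERIV_ramp[of 1] z in \<open>auto simp: numeral_2_eq_2\<close>)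
    also have "laplacian W z = - core_density z / e"
    proof -
      have sT: "smooth_upto 2 ?U1 trunc_log" by (rule smooth_upto_subset[OF smooth_upto_trunc_log]) auto
      have su: "smooth_upto 2 ?U1 (\<lambda>z. - u z)"
        using smooth_upto_diff[OF op(1) smooth_upto_const smu[OF op(1)], of 2 0] by simp
      have lu: "laplacian (\<lambda>z. - u z) z = 0"
        using laplacian_Re_holomorphic[OF op(1), of "\<lambda>z. - F z" z] holomorphic_on_subset[OF F, of ?U1] z
        by (simp add: u_def[abs_def] holomorphic_on_minus)
      have lT: "laplacian (\<lambda>z. trunc_log z + - u z) z = - core_density z"
        using laplacian_add[OF op(1) sT su z] lu trunc_log_derivatives(1)[OF z0] by simp
      have "laplacian W z = laplacian (\<lambda>z. (1 / e) * (trunc_log z + - u z) + - 1) z"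
        by (rule arg_cong[where f = "\<lambda>f. laplacian f z"]) (simp add: W_def fun_eq_iff)
      also have "\<dots> = laplacian (\<lambda>z. (1 / e) * (trunc_log z + - u z)) z + laplacian (\<lambda>_. - 1) z"
        by (rule laplacian_add[OF op(1) _ smooth_upto_const z]) (intro smooth_upto_mult smooth_upto_const smooth_upto_add sT su op)
      also have "laplacian (\<lambda>z. (1 / e) * (trunc_log z + - u z)) z = (1 / e) * (- core_density z)"
        using laplacian_cmult[OF op(1) smooth_upto_add[OF op(1) sT su] z, of "1 / e"] lT by simp
      finally show ?thesis by simp
    qed
    also have "e * (ramp 2 (W z) * ((dir_deriv 1 W z)\<^sup>2 + (dir_deriv \<i> W z)\<^sup>2) + ramp 1 (W z) * (- core_density z / e))
      = e * ramp 2 (W z) * ((dir_deriv 1 W z)\<^sup>2 + (dir_deriv \<i> W z)\<^sup>2) + e * (ramp 1 (W z) * (- core_density z / e))"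
      by (simp only: distrib_left mult.assoc)
    also have "e * (ramp 1 (W z) * (- core_density z / e)) = - (ramp 1 (W z) * core_density z)" using e by simp
    finally have lap: "laplacian \<phi> z = e * ramp 2 (W z) * ((dir_deriv 1 W z)\<^sup>2 + (dir_deriv \<i> W z)\<^sup>2) - ramp 1 (W z) * core_density z"
      by simp
    \<comment> \<open>This is why the radii are fixed so small: throughout the core the slope is
      exactly 1, so the negative part of the Laplacian depends neither on F nor on e.\<close>
    have "ramp 1 (W z) * core_density z = core_density z"
    proof (cases "core_density z = 0")
      case False
      then have "1 \<le> W z" using core_density_nonzero(2) Wbig by fastforce
      then show ?thesis by (simp only: ramp_ge1(1) mult_1_left)
    qed simp
    then show ?thesis using lap by (simp add: a_def)
  qed
  have a0: "a z = 0" if "z \<notin> ?U1" for z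
  proof -
    have core: "core_density z = 0" if "z = 0 \<or> 1 \<le> cmod z"
    proof (rule ccontr)
      assume "core_density z \<noteq> 0"
      note * = core_density_nonzero[OF this]
      have "0 < cmod z" using *(1) exp_gt_zero[of "- 6 :: real"] by linarith
      then have "1 \<le> cmod z" using that by auto
      then show False using *(2) e65(2) by linarith
    qed
    have "z \<in> ?U2 \<and> z = 0 \<or> z \<in> ?U3 \<and> 1 \<le> cmod z"
    proof (cases "z = 0")
      case False
      then have "1 \<le> cmod z" using that by simp
      then show ?thesis using ee unfolding Compl_iff mem_cball_0 by linarith
    qed simp
    then show ?thesis
    proof
      assume z: "z \<in> ?U2 \<and> z = 0"
      have "laplacian \<phi> z = laplacian (\<lambda>z. Re (of_real ((6 - ramp 0 1) - 2 * e + e * ramp 0 1) - F z)) z"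
        by (rule laplacian_cong[OF op(2)]) (use z \<phi>2 in \<open>auto simp: u_def\<close>)
      also have "\<dots> = 0"
        by (rule laplacian_Re_holomorphic[OF op(2)])
          (use z holomorphic_on_subset[OF F sub2] in \<open>auto intro!: holomorphic_intros\<close>)
      finally show ?thesis using core z by (simp add: a_def)
    next
      assume z: "z \<in> ?U3 \<and> 1 \<le> cmod z"
      have "laplacian \<phi> z = laplacian (\<lambda>_. 0) z"
        by (rule laplacian_cong[OF op(3)]) (use z \<phi>3 in auto)
      then show ?thesis using core z by (simp add: a_def)
    qed
  qed
  obtain K where K: "compact K" "\<And>z. z \<notin> K \<Longrightarrow> laplacian \<phi> z = 0" "continuous_on UNIV (laplacian \<phi>)"
    by (rule test_function_props[OF test]) (rule that; (assumption | simp))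
  show ?thesis
  proof (rule that[of \<phi> a])
    show "test_function ?D \<phi>" by (rule test)
    show "0 \<le> \<phi> z" for z using e ramp_nonneg by (simp add: \<phi>_def)
    show "trunc_log z - Re (F z) - 2 * e \<le> \<phi> z" if "z \<in> ?D" for z
    proof -
      have "e * (W z - 1) \<le> e * ramp 0 (W z)" by (intro mult_left_mono ramp_ge) (use e in simp)
      moreover have "e * (W z - 1) = trunc_log z - Re (F z) - 2 * e"
        using eW[of z] by (simp add: right_diff_distrib u_def)
      ultimately show ?thesis using \<phi>1[OF that] by simp
    qed
    show "laplacian \<phi> z = a z - core_density z" for z by (simp add: a_def)
    show a_nonneg: "0 \<le> a z" for z
      by (cases "z \<in> ?U1") (use a1 a0 e ramp2_nonneg in auto)
    have [measurable]: "laplacian \<phi> \<in> borel_measurable borel"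
      by (rule borel_measurable_continuous_onI[OF K(3)])
    show "a \<in> borel_measurable borel" unfolding a_def[abs_def] by measurable
    show supp_a: "exp (- 5) < cmod z \<and> cmod z \<le> exp (- e) \<and> - ln (cmod z) - Re (F z) \<le> 2 * e
        \<and> 0 < - ln (cmod z) - Re (F z)" if "a z \<noteq> 0" for z
    proof -
      have z: "z \<in> ?U1" using that a0 by blast
      then have "ramp 2 (W z) \<noteq> 0" using that a1 by auto
      then have W: "0 < W z" "W z < 1" using ramp_neg(3)[of "W z"] ramp_ge1(2)[of "W z"] by (meson not_le)+
      have big: "exp (- 5) < cmod z" using Wbig[of z] W by linarith
      then have T: "trunc_log z = - ln (cmod z)" by (intro trunc_log_eq_ln) simp
      have "e < trunc_log z - u z" "trunc_log z - u z < 2 * e"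
        using W e by (simp_all add: W_def field_simps)
      moreover have "z \<notin> ?U3"
      proof
        assume "z \<in> ?U3"
        have "W z \<le> 0"
        proof -
          have "ramp 0 (W z) = 0" using \<phi>3[OF \<open>z \<in> ?U3\<close>] \<phi>1[of z] z e by simp
          have z0: "z \<noteq> 0" using z by simp
          have "- ln (cmod z) \<le> e" using norm_le_exp_minus_iff(2)[OF z0, of e] \<open>z \<in> ?U3\<close> by simp
          moreover have "0 \<le> u z" using F0[of z] z by (simp add: u_def)
          ultimately show ?thesis using T e by (simp add: W_def field_simps)
        qed
        then show False using W by simp
      qed
      ultimately show ?thesis using T big e by (simp add: u_def)
    qed
    obtain C where C: "C \<ge> 0" "\<And>z. \<bar>laplacian \<phi> z\<bar> \<le> C"
      using bounded_continuous_compact_support[OF K(3,1,2)] by blast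
    \<comment> \<open>The supports of a and of the core density are disjoint, so a coincides with
      the bounded Laplacian wherever it is nonzero.\<close>
    have "a z \<le> C" for z
    proof (cases "a z = 0")
      case False
      then have "core_density z = 0" using supp_a[OF False] core_density_nonzero(2)[of z] by linarith
      then show ?thesis using C(2)[of z] by (simp add: a_def)
    qed (use C in simp)
    then show "\<exists>C. \<forall>z. a z \<le> C" by blast
    show "a z = a (of_real (cmod z))" if F0: "F = (\<lambda>_. 0)" for z
    proof -
      have rad: "a z = e * ramp 2 (trunc_log z * (1 / e) - 1) * ((1 / e)\<^sup>2 * ((1 - ramp 1 (- ln (cmod z) - 5))\<^sup>2 / (cmod z)\<^sup>2))"
        if z: "z \<in> ?U1" for z
      proof -
        have W: "W z = (1 / e) * trunc_log z - 1" for z using F0 by (simp add: W_def u_def)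
        have dT: "trunc_log differentiable_on ?U1"
          by (rule smooth_upto_differentiable[OF smooth_upto_subset[OF smooth_upto_trunc_log]]) auto
        have "dir_deriv h W z = (1 / e) * dir_deriv h trunc_log z" for h
        proof -
          have "dir_deriv h W z = dir_deriv h (\<lambda>z. (\<lambda>x. (1 / e) * x - 1) (trunc_log z)) z"
            by (rule arg_cong[where f = "\<lambda>f. dir_deriv h f z"]) (simp add: W fun_eq_iff)
          also have "\<dots> = (\<lambda>_. 1 / e) (trunc_log z) * dir_deriv h trunc_log z"
            by (rule dir_deriv_compose[OF op(1) dT _ z]) (use e in \<open>auto intro!: derivative_eq_intros\<close>)
          finally show ?thesis by simp
        qed
        then have "(dir_deriv 1 W z)\<^sup>2 + (dir_deriv \<i> W z)\<^sup>2
          = (1 / e)\<^sup>2 * ((dir_deriv 1 trunc_log z)\<^sup>2 + (dir_deriv \<i> trunc_log z)\<^sup>2)"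
          by (simp add: power_mult_distrib distrib_left power_divide add_divide_distrib)
        then show ?thesis using a1[OF z] trunc_log_derivatives(2)[of z] z W[of z] by (simp add: mult.commute)
      qed
      have T: "trunc_log (of_real (cmod z)) = trunc_log z" by (simp add: trunc_log_def)
      show ?thesis
      proof (cases "z \<in> ?U1")
        case True
        then have "complex_of_real (cmod z) \<in> ?U1" by simp
        from rad[OF this] show ?thesis using rad[OF True] T by simp
      next
        case False
        then have "complex_of_real (cmod z) \<notin> ?U1" by simp
        then show ?thesis using a0 False by metis
      qed
    qed
  qed
qed

subsection \<open>Local integrability of subharmonic functions\<close>

text \<open>Turns a lower bound for an extended mean into an upper bound for the mean of the
  negative part. An infinite B is excluded because the difference would then be
  -\<infinity>.\<close>

lemma ereal_minus_enn2ereal_lower: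
  assumes "ereal c \<le> enn2ereal A - enn2ereal B" "A \<le> ennreal C" "0 \<le> C"
  shows "B \<le> ennreal (C - c)"
proof (cases B)
  case (real b)
  have "enn2ereal A \<le> ereal C" using assms(2,3) by (metis enn2ereal_ennreal less_eq_ennreal.rep_eq)
  then have "ereal c \<le> ereal C - ereal b"
    using assms(1) real by (metis enn2ereal_ennreal ereal_minus_mono order.refl order.trans)
  then show ?thesis using real by (simp add: ennreal_leI)
next
  case top
  have "enn2ereal A \<le> ereal C" using assms(2,3) by (metis enn2ereal_ennreal less_eq_ennreal.rep_eq)
  then have "enn2ereal A - enn2ereal B = -\<infinity>" using top by (cases "enn2ereal A") auto
  then show ?thesis using assms(1) by simp
qed

text \<open>Outside the disk v is arbitrary, possibly not measurable; with the value 0 there the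
  function becomes Borel on the whole plane.\<close>

definition disk_ext :: "(complex \<Rightarrow> ereal) \<Rightarrow> complex \<Rightarrow> ereal" where
  "disk_ext v z = (if z \<in> ball 0 1 then v z else 0)"

context
  fixes v :: "complex \<Rightarrow> ereal"
  assumes sub: "subharmonic_on v (ball 0 1)"
    and bdd: "\<And>R. R < 1 \<Longrightarrow> \<exists>C\<ge>0. \<forall>z\<in>cball 0 R. v z \<le> ereal C"
begin

lemma measurable_ext [measurable]: "disk_ext v \<in> borel_measurable borel"
proof (rule borel_measurableI_less)
  fix y
  have "open {z \<in> ball 0 1. v z < y}" using sub by (auto simp: subharmonic_on_def)
  then have "{z \<in> ball 0 1. v z < y} \<union> (if 0 < y then - ball 0 1 else {}) \<in> sets borel" by auto
  also have "{z \<in> ball 0 1. v z < y} \<union> (if 0 < y then - ball 0 1 else {}) = {z \<in> space borel. disk_ext v z < y}"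
    by (auto simp: disk_ext_def)
  finally show "{z \<in> space borel. disk_ext v z < y} \<in> sets borel" .
qed

lemma ext_less_top: "disk_ext v z < \<infinity>"
  using sub by (auto simp: disk_ext_def subharmonic_on_def)

text \<open>On the circle the mean of the positive part is at most C, and the mean itself is at
  least c by the sub-mean value property; the difference bounds the mean of the negative
  part.\<close>

lemma mean_minus_le:
  assumes C: "0 \<le> C" "\<And>z. z \<in> cball z0 r \<Longrightarrow> v z \<le> ereal C"
    and r: "0 < r" "cball z0 r \<subseteq> ball 0 1" and c: "ereal c \<le> v z0"
  shows "(\<integral>\<^sup>+\<zeta>. e2ennreal (- disk_ext v (z0 + of_real r * \<zeta>)) \<partial>circle_measure)
    \<le> ennreal (C - c)"
proof -
  have on: "AE \<zeta> in circle_measure. v (z0 + of_real r * \<zeta>) = disk_ext v (z0 + of_real r * \<zeta>) \<and> v (z0 + of_real r * \<zeta>) \<le> ereal C"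
    using AE_circle_measure
  proof eventually_elim
    case (elim \<zeta>)
    then have "z0 + of_real r * \<zeta> \<in> cball z0 r" using r by (auto simp: dist_norm norm_mult)
    then show ?case using r C by (auto simp: disk_ext_def)
  qed
  have "ereal c \<le> circle_mean v z0 r"
    using sub r c by (auto simp: subharmonic_on_def intro: order_trans)
  moreover have "(\<integral>\<^sup>+\<zeta>. e2ennreal (v (z0 + of_real r * \<zeta>)) \<partial>circle_measure) \<le> (\<integral>\<^sup>+\<zeta>. ennreal C \<partial>circle_measure)"
  proof (rule nn_integral_mono_AE, use on in eventually_elim)
    case (elim \<zeta>)
    then show ?case using e2ennreal_mono[of _ "ereal C"] by (metis e2ennreal_ereal)
  qed
  then have "(\<integral>\<^sup>+\<zeta>. e2ennreal (v (z0 + of_real r * \<zeta>)) \<partial>circle_measure) \<le> ennreal C"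
    by (simp add: emeasure_circle_measure_UNIV)
  ultimately have "(\<integral>\<^sup>+\<zeta>. e2ennreal (- v (z0 + of_real r * \<zeta>)) \<partial>circle_measure) \<le> ennreal (C - c)"
    unfolding circle_mean_def using C(1) by (intro ereal_minus_enn2ereal_lower)
  moreover have "(\<integral>\<^sup>+\<zeta>. e2ennreal (- v (z0 + of_real r * \<zeta>)) \<partial>circle_measure)
      = (\<integral>\<^sup>+\<zeta>. e2ennreal (- disk_ext v (z0 + of_real r * \<zeta>)) \<partial>circle_measure)"
    by (rule nn_integral_cong_AE) (use on in \<open>auto elim!: eventually_mono\<close>)
  ultimately show ?thesis by simp
qed

text \<open>The bound on circles about z0 does not depend on the radius, so radial averaging
  integrates it over the disk. The center is left out as a null set, since circles need a positive
  radius.\<close>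

lemma nn_integral_minus_finite_ball:
  assumes z0: "v z0 \<noteq> -\<infinity>" and R: "0 < R" "cball z0 R \<subseteq> ball 0 1"
  shows "(\<integral>\<^sup>+z. e2ennreal (- disk_ext v z) * indicator (ball z0 R) z \<partial>lborel) < \<infinity>"
proof -
  have "z0 \<in> cball z0 R" using R by simp
  then have zD: "z0 \<in> ball 0 1" using R by blast
  then have "v z0 < \<infinity>" using sub by (auto simp: subharmonic_on_def)
  then obtain c where c: "v z0 = ereal c" using z0 by (cases "v z0") auto
  have "\<exists>S<1. cball z0 R \<subseteq> cball 0 S"
  proof -
    have "compact (norm ` cball z0 R)" by (intro compact_continuous_image continuous_intros) auto
    moreover have "norm ` cball z0 R \<noteq> {}" using R by auto
    ultimately obtain s where "s \<in> norm ` cball z0 R" "\<forall>t\<in>norm ` cball z0 R. t \<le> s"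
      using compact_attains_sup by blast
    then show ?thesis using R by (intro exI[of _ s]) auto
  qed
  then obtain S where "S < 1" "cball z0 R \<subseteq> cball 0 S" by blast
  then obtain C where C: "0 \<le> C" "\<And>z. z \<in> cball z0 R \<Longrightarrow> v z \<le> ereal C"
    using bdd[of S] by (meson subsetD)
  let ?k = "indicator (ball 0 R) :: complex \<Rightarrow> ennreal"
  have [measurable]: "?k \<in> borel_measurable borel" by (rule borel_measurable_indicator) simp
  have [measurable]: "(indicator (ball z0 R) :: complex \<Rightarrow> ennreal) \<in> borel_measurable borel"
    by (rule borel_measurable_indicator) simp
  have "(\<integral>\<^sup>+z. e2ennreal (- disk_ext v z) * indicator (ball z0 R) z \<partial>lborel)
      = (\<integral>\<^sup>+w. e2ennreal (- disk_ext v (z0 + w)) * indicator (ball z0 R) (z0 + w) \<partial>lborel)"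
    by (rule nn_integral_translate[symmetric]) simp
  also have "\<dots> = (\<integral>\<^sup>+w. ?k w * e2ennreal (- disk_ext v (z0 + w)) \<partial>lborel)"
    by (intro nn_integral_cong) (auto simp: indicator_def dist_norm)
  also have "\<dots> = (\<integral>\<^sup>+w. ?k w * (\<integral>\<^sup>+\<zeta>. e2ennreal (- disk_ext v (z0 + of_real (cmod w) * \<zeta>)) \<partial>circle_measure) \<partial>lborel)"
    by (rule nn_integral_radial_average) (auto simp: indicator_def)
  also have "\<dots> \<le> (\<integral>\<^sup>+w. ennreal (C - c) * ?k w \<partial>lborel)"
  proof (rule nn_integral_mono_AE)
    have "AE w in lborel. w \<noteq> (0::complex)" by (rule AE_lborel_singleton)
    then show "AE w in lborel. ?k w * (\<integral>\<^sup>+\<zeta>. e2ennreal (- disk_ext v (z0 + of_real (cmod w) * \<zeta>)) \<partial>circle_measure) \<le> ennreal (C - c) * ?k w"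
    proof eventually_elim
      case (elim w)
      show ?case
      proof (cases "w \<in> ball 0 R")
        case True
        have "(\<integral>\<^sup>+\<zeta>. e2ennreal (- disk_ext v (z0 + of_real (cmod w) * \<zeta>)) \<partial>circle_measure) \<le> ennreal (C - c)"
        proof (rule mean_minus_le)
          have "cball z0 (cmod w) \<subseteq> cball z0 R" using True by auto
          then show "cball z0 (cmod w) \<subseteq> ball 0 1" "\<And>z. z \<in> cball z0 (cmod w) \<Longrightarrow> v z \<le> ereal C"
            using R C by auto
        qed (use elim c C in auto)
        then show ?thesis using True by simp
      qed simp
    qed
  qed
  also have "\<dots> = ennreal (C - c) * emeasure lborel (ball (0::complex) R)"
    by (rule nn_integral_cmult_indicator) simp
  also have "\<dots> < \<infinity>"
    using emeasure_bounded_finite[OF bounded_ball, of "0::complex" R]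
    by (simp add: ennreal_mult_less_top)
  finally show ?thesis .
qed

text \<open>A connectedness argument: the points with a neighborhood of finite integral form an open
  set A, and so do the remaining ones. Indeed, arbitrarily close to a point of A there is some y
  with v(y) finite, since otherwise the integral would be infinite, and a disk about y of definite
  size reaches back to the point under consideration. Compactness then passes from disks to
  \<open>cball 0 R\<close>.\<close>

lemma nn_integral_minus_finite:
  assumes ne: "\<exists>z\<in>ball 0 1. v z \<noteq> -\<infinity>" and R: "R < 1"
  shows "(\<integral>\<^sup>+z. e2ennreal (- disk_ext v z) * indicator (cball 0 R) z \<partial>lborel) < \<infinity>"
proof -
  let ?D = "ball (0::complex) 1"
  have ind [measurable]: "(indicator (ball z e) :: complex \<Rightarrow> ennreal) \<in> borel_measurable borel" for z e
    by (rule borel_measurable_indicator) simp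
  define J where "J z e = (\<integral>\<^sup>+w. e2ennreal (- disk_ext v w) * indicator (ball z e) w \<partial>lborel)" for z e
  have J_mono: "J z e \<le> J z' e'" if "ball z e \<subseteq> ball z' e'" for z e z' e'
    unfolding J_def by (intro nn_integral_mono mult_left_mono) (use that in \<open>auto simp: indicator_def\<close>)
  define A where "A = {z \<in> ?D. \<exists>e>0. J z e < \<infinity>}"
  have "open A"
  proof (rule openI)
    fix z assume "z \<in> A"
    then obtain e where e: "z \<in> ?D" "e > 0" "J z e < \<infinity>" by (auto simp: A_def)
    obtain d where d: "d > 0" "ball z d \<subseteq> ?D" using e(1) open_ball openE by blast
    show "\<exists>T>0. ball z T \<subseteq> A"
    proof (intro exI conjI subsetI)
      show "min d (e / 2) > 0" using d e by simp
      fix w assume w: "w \<in> ball z (min d (e / 2))"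
      have "ball w (e / 2) \<subseteq> ball z e"
      proof
        fix x assume "x \<in> ball w (e / 2)"
        then show "x \<in> ball z e" using w dist_triangle[of z x w] by simp
      qed
      then have "J w (e / 2) < \<infinity>" using J_mono e(3) by (metis order.strict_trans1)
      then show "w \<in> A" using w d e by (auto simp: A_def intro!: exI[of _ "e / 2"])
    qed
  qed
  moreover have "open (?D - A)"
  proof (rule openI)
    fix z assume z: "z \<in> ?D - A"
    then obtain d where d: "d > 0" "ball z d \<subseteq> ?D" using open_ball openE by blast
    \<comment> \<open>With y within e of z, the closed disk of radius 2e about y contains
      \<open>ball z e\<close> and stays within 3e < d of z, hence inside the unit disk.\<close>
    define e where "e = d / 4"
    have e: "e > 0" using d by (simp add: e_def)
    have "w \<notin> A" if w: "w \<in> ball z e" for w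
    proof
      assume "w \<in> A"
      then obtain e' where e': "e' > 0" "J w e' < \<infinity>" by (auto simp: A_def)
      define s where "s = min e' (e - dist z w)"
      have s: "s > 0" using e' w by (simp add: s_def)
      have "\<exists>y\<in>ball w s. v y \<noteq> -\<infinity>"
      proof (rule ccontr)
        assume neg: "\<not> ?thesis"
        have sD: "ball w s \<subseteq> ?D"
        proof
          fix y assume "y \<in> ball w s"
          then have "dist z y < e" using dist_triangle[of z y w] by (simp add: s_def)
          then show "y \<in> ?D" using d e by (intro subsetD[OF d(2)]) (simp add: e_def)
        qed
        have "J w s = (\<integral>\<^sup>+y. \<infinity> * indicator (ball w s) y \<partial>lborel)"
          unfolding J_def
          by (intro nn_integral_cong) (use neg sD in \<open>auto simp: indicator_def disk_ext_def e2ennreal_infty\<close>)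
        also have "\<dots> = \<infinity> * emeasure lborel (ball w s)" by (rule nn_integral_cmult_indicator) simp
        also have "\<dots> = \<infinity>"
          using s by (simp add: emeasure_ball unit_ball_vol_2 ennreal_top_mult)
        finally have "J w s = \<infinity>" .
        moreover have "J w s \<le> J w e'" by (rule J_mono) (auto simp: s_def)
        ultimately show False using e' by (simp add: top_unique)
      qed
      then obtain y where y: "y \<in> ball w s" "v y \<noteq> -\<infinity>" by blast
      have zy: "dist z y < e" using y dist_triangle[of z y w] by (simp add: s_def)
      have "cball y (2 * e) \<subseteq> ?D"
      proof
        fix x assume "x \<in> cball y (2 * e)"
        then have "dist z x < d" using zy dist_triangle[of z x y] e by (simp add: e_def)
        then show "x \<in> ?D" using d by auto
      qed
      from nn_integral_minus_finite_ball[OF y(2) _ this] have "J y (2 * e) < \<infinity>" using e by (simp add: J_def)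
      moreover have "J z e \<le> J y (2 * e)"
      proof (rule J_mono, rule subsetI)
        fix x assume "x \<in> ball z e"
        then show "x \<in> ball y (2 * e)" using zy dist_triangle[of y x z] by (simp add: dist_commute)
      qed
      ultimately have "z \<in> A" using z e by (auto simp: A_def)
      then show False using z by simp
    qed
    moreover have "ball z e \<subseteq> ?D" using d e by (auto simp: e_def)
    ultimately show "\<exists>T>0. ball z T \<subseteq> ?D - A" using e by blast
  qed
  moreover have "A \<noteq> {}"
  proof -
    obtain z0 where z0: "z0 \<in> ?D" "v z0 \<noteq> -\<infinity>" using ne by blast
    obtain r where "r > 0" "cball z0 r \<subseteq> ?D" using z0(1) open_contains_cball[of ?D, THEN iffD1, OF open_ball] by blast
    then show ?thesis using nn_integral_minus_finite_ball[OF z0(2)] z0 by (auto simp: A_def J_def)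
  qed
  moreover have "connected ?D" by (rule convex_connected) (rule convex_ball)
  moreover have "A \<subseteq> ?D" by (auto simp: A_def)
  ultimately have AD: "A = ?D"
    using connectedD[of ?D A "?D - A"] by blast
  have "\<forall>z\<in>cball 0 R. \<exists>e>0. J z e < \<infinity>"
    using AD R by (auto simp: A_def)
  then obtain e where e: "\<And>z. z \<in> cball 0 R \<Longrightarrow> e z > 0 \<and> J z (e z) < \<infinity>" by metis
  obtain T where T: "T \<subseteq> cball 0 R" "finite T" "cball 0 R \<subseteq> (\<Union>z\<in>T. ball z (e z))"
    by (rule compactE_image[of "cball (0::complex) R" "cball 0 R" "\<lambda>z. ball z (e z)"]) (use e in force)+
  have "(\<integral>\<^sup>+z. e2ennreal (- disk_ext v z) * indicator (cball 0 R) z \<partial>lborel)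
      \<le> (\<integral>\<^sup>+z. (\<Sum>t\<in>T. e2ennreal (- disk_ext v z) * indicator (ball t (e t)) z) \<partial>lborel)"
  proof (rule nn_integral_mono)
    fix z
    show "e2ennreal (- disk_ext v z) * indicator (cball 0 R) z \<le> (\<Sum>t\<in>T. e2ennreal (- disk_ext v z) * indicator (ball t (e t)) z)"
    proof (cases "z \<in> cball 0 R")
      case True
      then obtain t where t: "t \<in> T" "z \<in> ball t (e t)" using T by blast
      have "e2ennreal (- disk_ext v z) * indicator (ball t (e t)) z \<le> (\<Sum>t\<in>T. e2ennreal (- disk_ext v z) * indicator (ball t (e t)) z)"
        by (rule member_le_sum) (use t T in auto)
      then show ?thesis using t True by simp
    qed simp
  qed
  also have "\<dots> = (\<Sum>t\<in>T. J t (e t))"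
    unfolding J_def by (rule nn_integral_sum) simp
  also have "\<dots> < \<infinity>" using e T by (auto simp: less_top[symmetric])
  finally show ?thesis .
qed

end

section \<open>Pairing the Riesz measure with a test function\<close>

lemma ennreal_real_of_ereal_eq: "x < \<infinity> \<Longrightarrow> ennreal (real_of_ereal x) = e2ennreal x"
  by (cases x) (auto simp: e2ennreal_ereal e2ennreal_neg)

lemma ennreal_minus_real_of_ereal_le: "ennreal (- real_of_ereal x) \<le> e2ennreal (- x)"
  by (cases x) (auto simp: e2ennreal_ereal e2ennreal_neg)

text \<open>A smoothed mean of v over small circles about 0, since \<open>core_density\<close> has
  mass 2 \<pi>. It replaces v(0) in the Jensen-type formula and is finite even if v(0) =
  -\<infinity>.\<close>

definition core_mass :: "(complex \<Rightarrow> ereal) \<Rightarrow> real" where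
  "core_mass v = 1 / (2 * pi) * (\<integral>z. real_of_ereal (disk_ext v z) * core_density z \<partial>lborel)"

lemma core_density_bounded: "\<exists>C. \<forall>z. \<bar>core_density z\<bar> \<le> C"
proof -
  have "compact (ramp 2 ` {0..1})" by (intro compact_continuous_image continuous_on_ramp) auto
  then obtain C where C: "\<And>x. 0 \<le> x \<Longrightarrow> x \<le> 1 \<Longrightarrow> \<bar>ramp 2 x\<bar> \<le> C"
    using compact_imp_bounded by (fastforce simp: bounded_iff)
  have C2: "\<bar>ramp 2 x\<bar> \<le> max C 0" for x
    using C[of x] ramp_neg(3)[of x] ramp_ge1(2)[of x] by (cases "x \<le> 0"; cases "x \<ge> 1") auto
  have "\<bar>core_density z\<bar> \<le> max C 0 / (exp (- 6))\<^sup>2" for z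
  proof (cases "core_density z = 0")
    case False
    from core_density_nonzero(1)[OF this] have "exp (- 6) < cmod z" .
    then have "(exp (- 6))\<^sup>2 \<le> (cmod z)\<^sup>2" by (intro power_mono) auto
    then show ?thesis unfolding core_density_def abs_divide by (intro frac_le C2) auto
  qed simp
  then show ?thesis by blast
qed

context
  fixes v :: "complex \<Rightarrow> ereal" and M :: "complex measure"
  assumes sub: "subharmonic_on v (ball 0 1)"
    and bdd: "\<And>R. R < 1 \<Longrightarrow> \<exists>C\<ge>0. \<forall>z\<in>cball 0 R. v z \<le> ereal C"
    and ne: "\<exists>z\<in>ball 0 1. v z \<noteq> -\<infinity>"
    and riesz: "riesz_measure_on (ball 0 1) v M"
begin

text \<open>Points where v is -\<infinity> contribute 0, and elsewhere on the support |v| is at most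
  its negative part plus an upper bound of v. Hence local integrability of the negative part
  suffices.\<close>

lemma integrable_times_bounded:
  assumes R: "R < 1" and k [measurable]: "k \<in> borel_measurable borel"
    and C: "\<And>z. \<bar>k z\<bar> \<le> C" and supp: "\<And>z. k z \<noteq> 0 \<Longrightarrow> cmod z \<le> R"
  shows "integrable lborel (\<lambda>z. real_of_ereal (disk_ext v z) * k z)"
proof (rule integrableI_bounded)
  note [measurable] = measurable_ext[OF sub bdd]
  have [measurable]: "(indicator (cball 0 R) :: complex \<Rightarrow> ennreal) \<in> borel_measurable borel"
    by (rule borel_measurable_indicator) simp
  show "(\<lambda>z. real_of_ereal (disk_ext v z) * k z) \<in> borel_measurable lborel" by measurable
  obtain C' where C': "0 \<le> C'" "\<And>z. z \<in> cball 0 R \<Longrightarrow> v z \<le> ereal C'" using bdd[OF R] by blast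
  have C0: "0 \<le> C" using C[of 0] by (meson abs_ge_zero order_trans)
  have pt: "ennreal (norm (real_of_ereal (disk_ext v z) * k z))
      \<le> ennreal C * (e2ennreal (- disk_ext v z) * indicator (cball 0 R) z + ennreal C' * indicator (cball 0 R) z)" for z
  proof (cases "k z = 0")
    case False
    then have z: "z \<in> cball 0 R" using supp by auto
    then have ex: "disk_ext v z \<le> ereal C'" using C' R by (auto simp: disk_ext_def)
    have "ennreal \<bar>real_of_ereal (disk_ext v z)\<bar> \<le> e2ennreal (- disk_ext v z) + ennreal C'"
    proof (cases "disk_ext v z")
      case (real x)
      then have "\<bar>x\<bar> \<le> max 0 (- x) + C'" using ex C' by auto
      then have "ennreal \<bar>x\<bar> \<le> ennreal (max 0 (- x) + C')" by (rule ennreal_leI)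
      also have "\<dots> = ennreal (- x) + ennreal C'" using C' by (simp add: ennreal_plus max_def ennreal_neg)
      finally show ?thesis using real by (simp add: e2ennreal_ereal)
    qed (use ex in auto)
    then have "ennreal C * ennreal \<bar>real_of_ereal (disk_ext v z)\<bar> \<le> ennreal C * (e2ennreal (- disk_ext v z) + ennreal C')"
      by (rule mult_left_mono) simp
    moreover have "ennreal (norm (real_of_ereal (disk_ext v z) * k z)) \<le> ennreal C * ennreal \<bar>real_of_ereal (disk_ext v z)\<bar>"
      using C[of z] C0 by (auto simp: abs_mult mult.commute intro!: ennreal_leI mult_right_mono real_of_ereal_pos simp flip: ennreal_mult')
    ultimately show ?thesis using z by (auto intro: order_trans)
  qed simp
  have "(\<integral>\<^sup>+z. ennreal (norm (real_of_ereal (disk_ext v z) * k z)) \<partial>lborel)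
      \<le> (\<integral>\<^sup>+z. ennreal C * (e2ennreal (- disk_ext v z) * indicator (cball 0 R) z + ennreal C' * indicator (cball 0 R) z) \<partial>lborel)"
    by (rule nn_integral_mono) (rule pt)
  also have "\<dots> = ennreal C * ((\<integral>\<^sup>+z. e2ennreal (- disk_ext v z) * indicator (cball 0 R) z \<partial>lborel) + ennreal C' * emeasure lborel (cball (0::complex) R))"
    by (simp add: nn_integral_cmult nn_integral_add nn_integral_cmult_indicator)
  also have "\<dots> < \<infinity>"
    using nn_integral_minus_finite[OF sub bdd ne R] emeasure_bounded_finite[OF bounded_cball, of "0::complex" R]
    by (simp add: ennreal_mult_less_top)
  finally show "(\<integral>\<^sup>+z. ennreal (norm (real_of_ereal (disk_ext v z) * k z)) \<partial>lborel) < \<infinity>" .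
qed

text \<open>Both signs are handled separately: radial averaging turns each part into an integral of
  circular means P and Q, and the sub-mean value property with v(0) \<ge> 0 gives Q \<le> P on every
  circle met by the core.\<close>

lemma core_mass_nonneg:
  assumes v0: "0 \<le> v 0"
  shows "0 \<le> core_mass v"
proof -
  note [measurable] = measurable_ext[OF sub bdd]
  have e5: "exp (- 5) < (1::real)" by simp
  let ?k = "\<lambda>z. ennreal (core_density z)"
  have rad: "core_density z = core_density (of_real (cmod z))" for z by (simp add: core_density_def)
  obtain C where C: "0 \<le> C" "\<And>z. z \<in> cball 0 (exp (- 5)) \<Longrightarrow> v z \<le> ereal C" using bdd[OF e5] by blast
  define P where "P r = (\<integral>\<^sup>+\<zeta>. e2ennreal (disk_ext v (of_real r * \<zeta>)) \<partial>circle_measure)" for r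
  define Q where "Q r = (\<integral>\<^sup>+\<zeta>. e2ennreal (- disk_ext v (of_real r * \<zeta>)) \<partial>circle_measure)" for r
  have PQ: "Q r \<le> P r \<and> P r \<le> ennreal C" if r: "0 < r" "r < exp (- 5)" for r
  proof -
    have r1': "r < 1" using r e5 by linarith
    have r1: "cball 0 r \<subseteq> ball (0::complex) 1" using r1' by auto
    have on: "AE \<zeta> in circle_measure. v (0 + of_real r * \<zeta>) = disk_ext v (of_real r * \<zeta>) \<and> disk_ext v (of_real r * \<zeta>) \<le> ereal C"
      using AE_circle_measure
    proof eventually_elim
      case (elim \<zeta>)
      then have "cmod (of_real r * \<zeta>) = r" using r by (simp add: norm_mult)
      then have "of_real r * \<zeta> \<in> ball 0 1" "of_real r * \<zeta> \<in> cball 0 (exp (- 5))" using r r1' by simp_all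
      then show ?case using C by (auto simp: disk_ext_def)
    qed
    have PC: "P r \<le> ennreal C"
    proof -
      have "P r \<le> (\<integral>\<^sup>+\<zeta>. ennreal C \<partial>circle_measure)"
        unfolding P_def
      proof (rule nn_integral_mono_AE, use on in eventually_elim)
        case (elim \<zeta>)
        then show ?case using e2ennreal_mono[of _ "ereal C"] by (metis e2ennreal_ereal)
      qed
      then show ?thesis by (simp add: emeasure_circle_measure_UNIV)
    qed
    have "0 \<le> circle_mean v 0 r"
      using sub r r1 v0 by (auto simp: subharmonic_on_def intro: order_trans)
    also have "circle_mean v 0 r = enn2ereal (P r) - enn2ereal (Q r)"
    proof -
      have "(\<integral>\<^sup>+\<zeta>. e2ennreal (v (0 + of_real r * \<zeta>)) \<partial>circle_measure) = P r"
        unfolding P_def by (rule nn_integral_cong_AE) (use on in \<open>auto elim!: eventually_mono\<close>)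
      moreover have "(\<integral>\<^sup>+\<zeta>. e2ennreal (- v (0 + of_real r * \<zeta>)) \<partial>circle_measure) = Q r"
        unfolding Q_def by (rule nn_integral_cong_AE) (use on in \<open>auto elim!: eventually_mono\<close>)
      ultimately show ?thesis by (simp only: circle_mean_def)
    qed
    finally have "enn2ereal (Q r) \<le> enn2ereal (P r)"
    proof -
      assume *: "0 \<le> enn2ereal (P r) - enn2ereal (Q r)"
      have "P r < \<infinity>" using PC by (auto intro: le_less_trans)
      then have "\<bar>enn2ereal (P r)\<bar> \<noteq> \<infinity>" by (cases "P r") auto
      then show ?thesis using * by (cases "enn2ereal (P r)"; cases "enn2ereal (Q r)") auto
    qed
    then show ?thesis using PC by (simp add: less_eq_ennreal.rep_eq)
  qed
  have kr: "?k z * Q (cmod z) \<le> ?k z * P (cmod z) \<and> ?k z * P (cmod z) \<le> ennreal C * ?k z" for z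
  proof (cases "core_density z = 0")
    case False
    note * = core_density_nonzero[OF this]
    have "0 < cmod z" using *(1) exp_gt_zero[of "- 6 :: real"] by linarith
    from PQ[OF this *(2)] show ?thesis
      by (auto intro!: mult_left_mono simp: mult.commute[of "ennreal C"])
  qed simp
  let ?f = "\<lambda>z. real_of_ereal (disk_ext v z) * core_density z"
  have "(\<integral>\<^sup>+z. ennreal (- ?f z) \<partial>lborel) \<le> (\<integral>\<^sup>+z. ?k z * e2ennreal (- disk_ext v z) \<partial>lborel)"
  proof (rule nn_integral_mono)
    fix z
    have "ennreal (- ?f z) = ennreal (core_density z) * ennreal (- real_of_ereal (disk_ext v z))"
      using core_density_nonneg[of z] by (simp add: mult.commute flip: ennreal_mult')
    also have "\<dots> \<le> ?k z * e2ennreal (- disk_ext v z)"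
      by (intro mult_left_mono ennreal_minus_real_of_ereal_le) simp
    finally show "ennreal (- ?f z) \<le> ?k z * e2ennreal (- disk_ext v z)" .
  qed
  also have "\<dots> = (\<integral>\<^sup>+z. ?k z * Q (cmod z) \<partial>lborel)"
    unfolding Q_def by (rule nn_integral_radial_average) (use rad in auto)
  also have "\<dots> \<le> (\<integral>\<^sup>+z. ?k z * P (cmod z) \<partial>lborel)"
    by (rule nn_integral_mono) (use kr in blast)
  also have "\<dots> = (\<integral>\<^sup>+z. ?k z * e2ennreal (disk_ext v z) \<partial>lborel)"
    unfolding P_def by (rule nn_integral_radial_average[symmetric]) (use rad in auto)
  also have "\<dots> = (\<integral>\<^sup>+z. ennreal (?f z) \<partial>lborel)"
  proof (rule nn_integral_cong)
    fix z
    have "ennreal (?f z) = ennreal (core_density z) * ennreal (real_of_ereal (disk_ext v z))"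
      using core_density_nonneg[of z] by (simp add: mult.commute flip: ennreal_mult')
    then show "?k z * e2ennreal (disk_ext v z) = ennreal (?f z)"
      using ennreal_real_of_ereal_eq[OF ext_less_top[OF sub bdd], of z] by simp
  qed
  finally have le: "(\<integral>\<^sup>+z. ennreal (- ?f z) \<partial>lborel) \<le> (\<integral>\<^sup>+z. ennreal (?f z) \<partial>lborel)" .
  obtain B where B: "\<And>z. \<bar>core_density z\<bar> \<le> B" using core_density_bounded by blast
  have int: "integrable lborel ?f"
    by (rule integrable_times_bounded[OF e5 _ B]) (use core_density_nonzero(2) in \<open>auto intro: less_imp_le\<close>)
  have fin: "(\<integral>\<^sup>+z. ennreal (?f z) \<partial>lborel) < \<infinity>"
  proof -
    have "(\<integral>\<^sup>+z. ennreal (?f z) \<partial>lborel) \<le> (\<integral>\<^sup>+z. ennreal (norm (?f z)) \<partial>lborel)"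
      by (intro nn_integral_mono ennreal_leI) auto
    then show ?thesis using int by (auto simp: integrable_iff_bounded intro: le_less_trans)
  qed
  have "0 \<le> (\<integral>z. ?f z \<partial>lborel)"
    using enn2real_mono[OF le] fin unfolding real_lebesgue_integral_def[OF int] by simp
  then show ?thesis unfolding core_mass_def by (intro mult_nonneg_nonneg) auto
qed

text \<open>In the distributional identity the core contributes exactly -
  \<open>core_mass v\<close>, while the term with a \<ge> 0 can only grow when v is replaced by a
  majorant W of its positive part. Such a majorant is needed only where a is nonzero.\<close>

lemma riesz_upper:
  assumes \<phi>: "test_function (ball 0 1) \<phi>" "\<And>z. 0 \<le> \<phi> z" "\<And>z. laplacian \<phi> z = a z - core_density z"
    and a: "\<And>z. 0 \<le> a z" "a \<in> borel_measurable borel" "\<exists>C. \<forall>z. a z \<le> C" "\<And>z. a z \<noteq> 0 \<Longrightarrow> cmod z \<le> R" "R < 1"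
    and W: "\<And>z. a z \<noteq> 0 \<Longrightarrow> e2ennreal (v z) \<le> W z" "(\<integral>\<^sup>+z. W z * ennreal (a z) \<partial>lborel) \<le> ennreal (2 * pi * X)" "0 \<le> X"
  shows "(\<integral>\<^sup>+z. ennreal (\<phi> z) \<partial>M) \<le> ennreal (X - core_mass v)"
proof -
  note [measurable] = measurable_ext[OF sub bdd] a(2)
  have sM: "sets M = sets (restrict_space borel (ball 0 1))"
    and fM: "\<And>K. compact K \<Longrightarrow> K \<subseteq> ball 0 1 \<Longrightarrow> emeasure M K < \<infinity>"
    and idM: "(\<integral>z. \<phi> z \<partial>M) = 1 / (2 * pi) * (LINT z:ball 0 1|lborel. real_of_ereal (v z) * laplacian \<phi> z)"
    using riesz \<phi>(1) by (auto simp: riesz_measure_on_def)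
  obtain C where C: "\<And>z. a z \<le> C" using a(3) by blast
  obtain B where B: "\<And>z. \<bar>core_density z\<bar> \<le> B" using core_density_bounded by blast
  have e5: "exp (- 5) < (1::real)" by simp
  have i1: "integrable lborel (\<lambda>z. real_of_ereal (disk_ext v z) * a z)"
    by (rule integrable_times_bounded[OF a(5,2), of C]) (use a C in auto)
  have i2: "integrable lborel (\<lambda>z. real_of_ereal (disk_ext v z) * core_density z)"
    by (rule integrable_times_bounded[OF e5 _ B]) (use core_density_nonzero(2) in \<open>auto intro: less_imp_le\<close>)
  have "(LINT z:ball 0 1|lborel. real_of_ereal (v z) * laplacian \<phi> z)
      = (\<integral>z. real_of_ereal (disk_ext v z) * a z - real_of_ereal (disk_ext v z) * core_density z \<partial>lborel)"
    unfolding set_lebesgue_integral_def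
    by (rule Bochner_Integration.integral_cong) (auto simp: disk_ext_def \<phi>(3) right_diff_distrib)
  also have "\<dots> = (\<integral>z. real_of_ereal (disk_ext v z) * a z \<partial>lborel) - (\<integral>z. real_of_ereal (disk_ext v z) * core_density z \<partial>lborel)"
    using i1 i2 by simp
  finally have id: "(\<integral>z. \<phi> z \<partial>M) = 1 / (2 * pi) * (\<integral>z. real_of_ereal (disk_ext v z) * a z \<partial>lborel) - core_mass v"
    unfolding idM core_mass_def by (simp only: right_diff_distrib)
  have "(\<integral>z. real_of_ereal (disk_ext v z) * a z \<partial>lborel) \<le> enn2real (\<integral>\<^sup>+z. ennreal (real_of_ereal (disk_ext v z) * a z) \<partial>lborel)"
    unfolding real_lebesgue_integral_def[OF i1] by simp
  also have "\<dots> \<le> 2 * pi * X"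
  proof (rule enn2real_leI)
    have "(\<integral>\<^sup>+z. ennreal (real_of_ereal (disk_ext v z) * a z) \<partial>lborel) \<le> (\<integral>\<^sup>+z. W z * ennreal (a z) \<partial>lborel)"
    proof (rule nn_integral_mono)
      fix z
      show "ennreal (real_of_ereal (disk_ext v z) * a z) \<le> W z * ennreal (a z)"
      proof (cases "a z = 0")
        case False
        then have "z \<in> ball 0 1" using a(4)[OF False] a(5) by simp
        then have "disk_ext v z = v z" by (simp add: disk_ext_def)
        moreover have "ennreal (real_of_ereal (disk_ext v z) * a z) = ennreal (real_of_ereal (disk_ext v z)) * ennreal (a z)"
          using a(1) by (rule ennreal_mult'')
        ultimately show ?thesis
          using W(1)[OF False] ennreal_real_of_ereal_eq[OF ext_less_top[OF sub bdd], of z]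
          by (simp add: mult_right_mono)
      qed simp
    qed
    then show "(\<integral>\<^sup>+z. ennreal (real_of_ereal (disk_ext v z) * a z) \<partial>lborel) \<le> ennreal (2 * pi * X)"
      using W(2) by (rule order_trans)
  qed (use W(3) in simp)
  finally have "1 / (2 * pi) * (\<integral>z. real_of_ereal (disk_ext v z) * a z \<partial>lborel) \<le> X"
    by (simp add: field_simps)
  then have le: "(\<integral>z. \<phi> z \<partial>M) \<le> X - core_mass v" unfolding id by simp
  obtain K where K: "compact K" "K \<subseteq> ball 0 1" "\<And>z. z \<notin> K \<Longrightarrow> \<phi> z = 0" "continuous_on UNIV \<phi>"
    by (rule test_function_props[OF \<phi>(1)]) (rule that; (assumption | simp))
  obtain D where D: "\<And>z. \<bar>\<phi> z\<bar> \<le> D" using bounded_continuous_compact_support[OF K(4,1,3)] by blast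
  have "integrable M \<phi>"
  proof (rule integrableI_bounded_set[of K])
    show "K \<in> sets M"
      unfolding sM using K(1,2) by (auto simp: sets_restrict_space image_iff intro!: bexI[of _ K] borel_closed compact_imp_closed)
    show "\<phi> \<in> borel_measurable M"
      unfolding measurable_cong_sets[OF sM refl]
      by (rule measurable_restrict_space1) (rule borel_measurable_continuous_onI[OF K(4)])
    show "emeasure M K < \<infinity>" by (rule fM) (rule K)+
  qed (use D K(3) in auto)
  then have "(\<integral>\<^sup>+z. ennreal (\<phi> z) \<partial>M) = ennreal (\<integral>z. \<phi> z \<partial>M)"
    by (rule nn_integral_eq_integral) (use \<phi>(2) in simp)
  also have "\<dots> \<le> ennreal (X - core_mass v)" using le by (rule ennreal_leI)
  finally show ?thesis .
qed

end

text \<open>A harmonic function integrates to 0 against \<Delta>\<phi>, so its integral against a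
  equals its integral against the core density. That density has mass 2 \<pi> and sees only the disk
  of radius exp(-5): a bound near the origin controls the integral over the remote support of
  a.\<close>

lemma harmonic_majorant:
  assumes \<phi>: "test_function (ball 0 1) \<phi>" "\<And>z. laplacian \<phi> z = a z - core_density z"
    and a: "\<And>z. 0 \<le> a z" "a \<in> borel_measurable borel" "\<exists>C. \<forall>z. a z \<le> C" "\<And>z. a z \<noteq> 0 \<Longrightarrow> cmod z \<le> R" "R < 1"
    and G: "G holomorphic_on ball 0 1" "\<And>z. z \<in> ball 0 1 \<Longrightarrow> 0 \<le> Re (G z)"
    and B: "\<And>z. cmod z \<le> exp (- 5) \<Longrightarrow> Re (G z) \<le> B" "0 \<le> B"
  shows "(\<integral>\<^sup>+z. ennreal (indicator (ball 0 1) z * Re (G z)) * ennreal (a z) \<partial>lborel) \<le> ennreal (2 * pi * B)"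
proof -
  define H where "H z = indicator (ball 0 1) z * Re (G z)" for z
  have e5: "exp (- 5) < (1::real)" by simp
  have contG: "continuous_on (ball 0 1) (\<lambda>z. Re (G z))"
    using holomorphic_on_imp_continuous_on[OF G(1)] by (intro continuous_intros)
  have [measurable]: "H \<in> borel_measurable borel"
    using borel_measurable_continuous_on_indicator[OF _ contG] unfolding H_def[abs_def] by simp
  note [measurable] = a(2)
  have H0: "0 \<le> H z" for z using G(2) by (simp add: H_def indicator_def)
  obtain C where C: "\<And>z. a z \<le> C" using a(3) by blast
  obtain D where D: "\<And>z. \<bar>core_density z\<bar> \<le> D" using core_density_bounded by blast
  have int: "integrable lborel (\<lambda>z. H z * k z)"
    if k [measurable]: "k \<in> borel_measurable borel" "\<And>z. \<bar>k z\<bar> \<le> C'" "\<And>z. k z \<noteq> 0 \<Longrightarrow> cmod z \<le> S" "S < 1" for k C' S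
  proof -
    have "compact ((\<lambda>z. Re (G z)) ` cball 0 S)"
    proof (intro compact_continuous_image continuous_on_subset[OF contG])
      show "cball 0 S \<subseteq> ball (0::complex) 1" using that(4) by auto
    qed simp
    then obtain L where L: "\<And>z. z \<in> cball 0 S \<Longrightarrow> \<bar>Re (G z)\<bar> \<le> L"
      using compact_imp_bounded by (fastforce simp: bounded_iff)
    show ?thesis
    proof (rule integrableI_bounded_set[of "cball 0 S"])
      show "emeasure lborel (cball (0::complex) S) < \<infinity>" by (rule emeasure_bounded_finite[OF bounded_cball])
      show "AE z\<in>cball 0 S in lborel. norm (H z * k z) \<le> max 0 L * C'"
      proof (rule AE_I2, rule impI)
        fix z :: complex assume z: "z \<in> cball 0 S"
        have "\<bar>H z\<bar> \<le> max 0 L" using L[OF z] by (auto simp: H_def indicator_def)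
        then show "norm (H z * k z) \<le> max 0 L * C'"
          unfolding real_norm_def abs_mult using that(2)[of z] by (intro mult_mono) auto
      qed
      show "AE z in lborel. z \<notin> cball 0 S \<longrightarrow> H z * k z = 0"
        using that(3) by (intro AE_I2) auto
    qed (use k in auto)
  qed
  have i1: "integrable lborel (\<lambda>z. H z * a z)" by (rule int[OF a(2) _ a(4,5), of C]) (use a C in auto)
  have i2: "integrable lborel (\<lambda>z. H z * core_density z)"
    by (rule int[OF _ D _ e5]) (use core_density_nonzero(2) in \<open>auto intro: less_imp_le\<close>)
  have i3: "integrable lborel core_density"
    using nn_integral_core_density core_density_nonneg by (intro integrableI_nonneg) auto
  have "0 = (\<integral>z. indicator (ball 0 1) z * (Re (G z) * laplacian \<phi> z) \<partial>lborel)"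
    by (rule integral_Re_holomorphic_laplacian[OF open_ball G(1) \<phi>(1), symmetric])
  also have "\<dots> = (\<integral>z. H z * a z - H z * core_density z \<partial>lborel)"
    by (rule Bochner_Integration.integral_cong) (auto simp: H_def \<phi>(2) right_diff_distrib)
  also have "\<dots> = (\<integral>z. H z * a z \<partial>lborel) - (\<integral>z. H z * core_density z \<partial>lborel)"
    using i1 i2 by simp
  finally have "(\<integral>z. H z * a z \<partial>lborel) = (\<integral>z. H z * core_density z \<partial>lborel)" by simp
  also have "\<dots> \<le> (\<integral>z. B * core_density z \<partial>lborel)"
  proof (rule integral_mono[OF i2])
    show "integrable lborel (\<lambda>z. B * core_density z)" using i3 by simp
    fix z
    show "H z * core_density z \<le> B * core_density z"
    proof (cases "core_density z = 0")
      case False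
      then have "H z \<le> B" using B core_density_nonzero(2)[OF False] by (auto simp: H_def indicator_def)
      then show ?thesis by (rule mult_right_mono[OF _ core_density_nonneg])
    qed simp
  qed
  also have "\<dots> = B * (2 * pi)"
  proof -
    have "(\<integral>z. core_density z \<partial>lborel) = enn2real (\<integral>\<^sup>+z. ennreal (core_density z) \<partial>lborel)"
      by (rule integral_eq_nn_integral) (auto simp: core_density_nonneg)
    then show ?thesis by (simp add: nn_integral_core_density)
  qed
  finally have le: "(\<integral>z. H z * a z \<partial>lborel) \<le> B * (2 * pi)" .
  have "(\<integral>\<^sup>+z. ennreal (H z) * ennreal (a z) \<partial>lborel) = (\<integral>\<^sup>+z. ennreal (H z * a z) \<partial>lborel)"
    by (intro nn_integral_cong) (simp add: ennreal_mult' H0)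
  also have "\<dots> = ennreal (\<integral>z. H z * a z \<partial>lborel)"
    by (rule nn_integral_eq_integral[OF i1]) (use a H0 in simp)
  finally show ?thesis using le by (simp add: H_def mult.commute ennreal_leI)
qed

subsection \<open>The function \<open>max (\<rho>(\<zeta>, E)) t\<close> to the power \<open>-q\<close> on the circle\<close>

text \<open>The cap at distance t bounds the function by t^(-q), so that its Herglotz transform is
  available even if \<rho>^(-q) is not integrable on the circle.\<close>

definition trunc_dist :: "complex set \<Rightarrow> real \<Rightarrow> real \<Rightarrow> complex \<Rightarrow> real" where
  "trunc_dist E q t \<zeta> = max (infdist \<zeta> E) t powr (- q)"

context
  fixes E :: "complex set"
  assumes E: "E \<subseteq> sphere 0 1" "closed E" "E \<noteq> {}"
begin

lemma measurable_infdist_E [measurable]: "(\<lambda>z. infdist z E) \<in> borel_measurable borel"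
  by (intro borel_measurable_continuous_onI continuous_intros)

lemma infdist_le_2: "cmod z \<le> 1 \<Longrightarrow> infdist z E \<le> 2"
proof -
  assume z: "cmod z \<le> 1"
  obtain e where e: "e \<in> E" using E by blast
  have "infdist z E \<le> dist z e" by (rule infdist_le[OF e])
  also have "\<dots> \<le> 2" using norm_triangle_ineq4[of z e] e E z by (auto simp: dist_norm)
  finally show ?thesis .
qed

lemma nu_eq: "nu E s = (\<integral>\<^sup>+\<zeta>. (if cmod \<zeta> = 1 \<and> infdist \<zeta> E < s then 1 else 0) \<partial>circle_measure)"
proof -
  have "nu E s = (\<integral>\<^sup>+\<zeta>. indicator {\<zeta> \<in> sphere 0 1. infdist \<zeta> E < s} \<zeta> \<partial>circle_measure)"
    unfolding nu_def by (rule nn_integral_indicator[symmetric]) measurable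
  then show ?thesis by (simp add: indicator_def of_bool_def)
qed

lemma measurable_nu [measurable]: "nu E \<in> borel_measurable borel"
proof -
  interpret finite_measure circle_measure by (rule finite_measure_circle_measure)
  have "(\<lambda>s. \<integral>\<^sup>+\<zeta>. (if cmod \<zeta> = 1 \<and> infdist \<zeta> E < s then 1 else 0) \<partial>circle_measure) \<in> borel_measurable borel"
    by measurable
  then show ?thesis by (simp add: nu_eq[abs_def])
qed

lemma measurable_trunc_dist [measurable]: "trunc_dist E q t \<in> borel_measurable borel"
  unfolding trunc_dist_def[abs_def] by measurable

lemma trunc_dist_bounds:
  assumes "0 < t" "0 < q"
  shows "0 \<le> trunc_dist E q t \<zeta>" "trunc_dist E q t \<zeta> \<le> t powr (- q)"
  using assms unfolding trunc_dist_def by (auto intro!: powr_mono2')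

text \<open>Layer-cake formula: x^(-q) is 2^(-q) plus the integral of q s^(-q-1) over x < s \<le> 2,
  applied to x = max(\<rho>, t) \<le> 2. Exchanging the integrals turns the condition \<rho> < s
  into \<open>nu E s\<close>.\<close>

lemma nn_integral_trunc_dist_le:
  assumes t: "0 < t" "t \<le> 2" and q: "0 < q"
  shows "(\<integral>\<^sup>+\<zeta>. ennreal (trunc_dist E q t \<zeta>) \<partial>circle_measure)
    \<le> ennreal (2 powr (- q)) + ennreal q * (\<integral>\<^sup>+s. ennreal (s powr (- q - 1)) * nu E s * indicator {t<..2} s \<partial>lborel)"
proof -
  interpret m: finite_measure circle_measure by (rule finite_measure_circle_measure)
  interpret P: pair_sigma_finite circle_measure "lborel :: real measure" ..
  define k where "k \<zeta> s = ennreal (q * s powr (- q - 1)) * (if cmod \<zeta> = 1 \<and> infdist \<zeta> E < s \<and> t < s \<and> s \<le> 2 then 1 else 0)" for \<zeta> :: complex and s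
  have [measurable]: "case_prod k \<in> borel_measurable (circle_measure \<Otimes>\<^sub>M lborel)"
    unfolding k_def case_prod_beta by measurable
  have pt: "ennreal (trunc_dist E q t \<zeta>) \<le> ennreal (2 powr (- q)) + (\<integral>\<^sup>+s. k \<zeta> s \<partial>lborel)" if \<zeta>: "cmod \<zeta> = 1" for \<zeta>
  proof -
    define x where "x = max (infdist \<zeta> E) t"
    have x: "0 < x" "x \<le> 2" using t infdist_le_2[of \<zeta>] \<zeta> by (auto simp: x_def)
    have FTC: "(\<integral>\<^sup>+s. ennreal (q * s powr (- q - 1)) * indicator {x..2} s \<partial>lborel)
        = ennreal ((- (2 powr (- q))) - (- (x powr (- q))))"
    proof (rule nn_integral_FTC_Icc[where F = "\<lambda>s. - (s powr (- q))"])
      fix s assume "s \<in> {x..2}"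
      then have s: "0 < s" using x by auto
      then show "((\<lambda>s. - (s powr (- q))) has_real_derivative q * s powr (- q - 1)) (at s)"
        by (auto intro!: derivative_eq_intros)
      show "0 \<le> q * s powr (- q - 1)" using q by simp
    qed (use x in auto)
    have "(\<integral>\<^sup>+s. ennreal (q * s powr (- q - 1)) * indicator {x..2} s \<partial>lborel) \<le> (\<integral>\<^sup>+s. k \<zeta> s \<partial>lborel)"
    proof (rule nn_integral_mono_AE)
      \<comment> \<open>At s = x one of the strict inequalities in \<open>k\<close> fails; a single
        point is negligible.\<close>
      have "AE s in lborel. s \<noteq> x" by (rule AE_lborel_singleton)
      then show "AE s in lborel. ennreal (q * s powr (- q - 1)) * indicator {x..2} s \<le> k \<zeta> s"
        by eventually_elim (auto simp: k_def indicator_def x_def \<zeta>)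
    qed
    then have *: "ennreal (x powr (- q) - 2 powr (- q)) \<le> (\<integral>\<^sup>+s. k \<zeta> s \<partial>lborel)"
      unfolding FTC by simp
    have "2 powr (- q) \<le> x powr (- q)" using x q by (intro powr_mono2') auto
    then have "ennreal (trunc_dist E q t \<zeta>) = ennreal (2 powr (- q)) + ennreal (x powr (- q) - 2 powr (- q))"
      by (simp add: trunc_dist_def x_def[symmetric] flip: ennreal_plus)
    then show ?thesis using * by (simp add: add_left_mono)
  qed
  have "(\<integral>\<^sup>+\<zeta>. ennreal (trunc_dist E q t \<zeta>) \<partial>circle_measure)
      \<le> (\<integral>\<^sup>+\<zeta>. ennreal (2 powr (- q)) + (\<integral>\<^sup>+s. k \<zeta> s \<partial>lborel) \<partial>circle_measure)"
    by (rule nn_integral_mono_AE) (use AE_circle_measure pt in \<open>auto elim!: eventually_mono\<close>)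
  also have "\<dots> = ennreal (2 powr (- q)) + (\<integral>\<^sup>+\<zeta>. (\<integral>\<^sup>+s. k \<zeta> s \<partial>lborel) \<partial>circle_measure)"
    by (subst nn_integral_add) (auto simp: emeasure_circle_measure_UNIV)
  also have "(\<integral>\<^sup>+\<zeta>. (\<integral>\<^sup>+s. k \<zeta> s \<partial>lborel) \<partial>circle_measure) = (\<integral>\<^sup>+s. (\<integral>\<^sup>+\<zeta>. k \<zeta> s \<partial>circle_measure) \<partial>lborel)"
    by (rule P.Fubini'[symmetric]) measurable
  also have "\<dots> = (\<integral>\<^sup>+s. ennreal q * (ennreal (s powr (- q - 1)) * nu E s * indicator {t<..2} s) \<partial>lborel)"
  proof (rule nn_integral_cong)
    fix s
    have "(\<integral>\<^sup>+\<zeta>. k \<zeta> s \<partial>circle_measure)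
        = (\<integral>\<^sup>+\<zeta>. ennreal (q * s powr (- q - 1)) * indicator {t<..2} s * (if cmod \<zeta> = 1 \<and> infdist \<zeta> E < s then 1 else 0) \<partial>circle_measure)"
      by (rule nn_integral_cong) (auto simp: k_def indicator_def)
    also have "\<dots> = ennreal (q * s powr (- q - 1)) * indicator {t<..2} s * nu E s"
      unfolding nu_eq by (rule nn_integral_cmult) measurable
    finally show "(\<integral>\<^sup>+\<zeta>. k \<zeta> s \<partial>circle_measure) = ennreal q * (ennreal (s powr (- q - 1)) * nu E s * indicator {t<..2} s)"
      using q by (simp add: ennreal_mult' mult_ac)
  qed
  also have "\<dots> = ennreal q * (\<integral>\<^sup>+s. ennreal (s powr (- q - 1)) * nu E s * indicator {t<..2} s \<partial>lborel)"
    by (rule nn_integral_cmult) measurable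
  finally show ?thesis .
qed

lemma I_int_eq: "I_int \<alpha> E = (\<integral>\<^sup>+s. ennreal (s powr (- \<alpha> - 1)) * nu E s * indicator {0<..2} s \<partial>lborel)"
  unfolding I_int_def
proof (rule nn_integral_cong)
  fix s :: real
  show "nu E s / ennreal (s powr (\<alpha> + 1)) * indicator {0<..2} s = ennreal (s powr (- \<alpha> - 1)) * nu E s * indicator {0<..2} s"
  proof (cases "s \<in> {0<..2}")
    case True
    then have "inverse (ennreal (s powr (\<alpha> + 1))) = ennreal (inverse (s powr (\<alpha> + 1)))"
      by (intro inverse_ennreal) auto
    also have "inverse (s powr (\<alpha> + 1)) = s powr (- \<alpha> - 1)"
      by (simp add: powr_minus[symmetric])
    finally show ?thesis by (simp add: divide_ennreal_def mult.commute)
  qed simp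
qed

lemma nn_integral_trunc_dist_le_I_int:
  assumes t: "0 < t" "t \<le> 2" and q: "0 < q"
  shows "(\<integral>\<^sup>+\<zeta>. ennreal (trunc_dist E q t \<zeta>) \<partial>circle_measure) \<le> ennreal (2 powr (- q)) + ennreal q * I_int q E"
proof -
  have "(\<integral>\<^sup>+s. ennreal (s powr (- q - 1)) * nu E s * indicator {t<..2} s \<partial>lborel) \<le> I_int q E"
    unfolding I_int_eq by (intro nn_integral_mono) (use t in \<open>auto simp: indicator_def\<close>)
  then show ?thesis
    using nn_integral_trunc_dist_le[OF t q] by (meson add_left_mono mult_left_mono order_trans zero_le)
qed

text \<open>The exponent \<gamma> - 1 may be negative, so the integrand can be unbounded at 0 and
  the integral is obtained from its improper form.\<close>

lemma nn_integral_powr_Ioc: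
  assumes "0 < \<gamma>" "0 \<le> x"
  shows "(\<integral>\<^sup>+t. ennreal (\<gamma> * t powr (\<gamma> - 1)) * indicator {0<..x} t \<partial>lborel) = ennreal (x powr \<gamma>)"
proof -
  have "((\<lambda>t. \<gamma> * t powr (\<gamma> - 1)) has_integral \<gamma> * (x powr (\<gamma> - 1 + 1) / (\<gamma> - 1 + 1))) {0..x}"
    by (intro has_integral_mult_right has_integral_powr_from_0) (use assms in auto)
  then have "((\<lambda>t. \<gamma> * t powr (\<gamma> - 1)) has_integral x powr \<gamma>) {0..x}" using assms by simp
  then have "((\<lambda>t. if t \<in> {0..x} then \<gamma> * t powr (\<gamma> - 1) else 0) has_integral x powr \<gamma>) UNIV"
    by (simp only: has_integral_restrict_UNIV)
  then have "(\<integral>\<^sup>+t. ennreal (if t \<in> {0..x} then \<gamma> * t powr (\<gamma> - 1) else 0) \<partial>lborel) = ennreal (x powr \<gamma>)"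
    by (intro nn_integral_has_integral_lborel) (use assms in auto)
  moreover have "(\<integral>\<^sup>+t. ennreal (if t \<in> {0..x} then \<gamma> * t powr (\<gamma> - 1) else 0) \<partial>lborel)
      = (\<integral>\<^sup>+t. ennreal (\<gamma> * t powr (\<gamma> - 1)) * indicator {0<..x} t \<partial>lborel)"
  proof (rule nn_integral_cong_AE)
    have "AE t in lborel. t \<noteq> (0::real)" by (rule AE_lborel_singleton)
    then show "AE t in lborel. ennreal (if t \<in> {0..x} then \<gamma> * t powr (\<gamma> - 1) else 0) = ennreal (\<gamma> * t powr (\<gamma> - 1)) * indicator {0<..x} t"
      by eventually_elim (auto simp: indicator_def)
  qed
  ultimately show ?thesis by simp
qed

text \<open>After exchanging the order, the integral of the weight over 0 < t \<le> s is s^(q -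
  \<alpha>), which turns s^(-q-1) into s^(-\<alpha>-1). This is how I(\<alpha>, E) appears where
  I(q, E) may be infinite.\<close>

lemma nn_integral_trunc_dist_weighted:
  assumes q: "0 < q" and \<alpha>: "\<alpha> < q" and T: "0 < T" "T \<le> 2"
  shows "(\<integral>\<^sup>+t. ennreal ((q - \<alpha>) * t powr (q - \<alpha> - 1)) * indicator {0<..T} t *
      (\<integral>\<^sup>+\<zeta>. ennreal (trunc_dist E q t \<zeta>) \<partial>circle_measure) \<partial>lborel)
    \<le> ennreal (2 powr (- q) * T powr (q - \<alpha>)) + ennreal q * I_int \<alpha> E"
proof -
  define \<gamma> where "\<gamma> = q - \<alpha>"
  have \<gamma>: "0 < \<gamma>" using \<alpha> by (simp add: \<gamma>_def)
  define g where "g t = ennreal (\<gamma> * t powr (\<gamma> - 1))" for t :: real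
  have [measurable]: "g \<in> borel_measurable borel" unfolding g_def by measurable
  define N where "N s = ennreal (s powr (- q - 1)) * nu E s" for s
  have [measurable]: "N \<in> borel_measurable borel" unfolding N_def by measurable
  have "(\<integral>\<^sup>+t. g t * indicator {0<..T} t * (\<integral>\<^sup>+\<zeta>. ennreal (trunc_dist E q t \<zeta>) \<partial>circle_measure) \<partial>lborel)
    \<le> (\<integral>\<^sup>+t. ennreal (2 powr (- q)) * (g t * indicator {0<..T} t)
        + ennreal q * (\<integral>\<^sup>+s. g t * indicator {0<..T} t * (N s * indicator {t<..2} s) \<partial>lborel) \<partial>lborel)"
  proof (rule nn_integral_mono)
    fix t
    show "g t * indicator {0<..T} t * (\<integral>\<^sup>+\<zeta>. ennreal (trunc_dist E q t \<zeta>) \<partial>circle_measure)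
      \<le> ennreal (2 powr (- q)) * (g t * indicator {0<..T} t)
        + ennreal q * (\<integral>\<^sup>+s. g t * indicator {0<..T} t * (N s * indicator {t<..2} s) \<partial>lborel)"
    proof (cases "t \<in> {0<..T}")
      case True
      then have t: "0 < t" "t \<le> 2" using T by auto
      have "g t * (\<integral>\<^sup>+\<zeta>. ennreal (trunc_dist E q t \<zeta>) \<partial>circle_measure)
        \<le> g t * (ennreal (2 powr (- q)) + ennreal q * (\<integral>\<^sup>+s. N s * indicator {t<..2} s \<partial>lborel))"
        using nn_integral_trunc_dist_le[OF t q] by (intro mult_left_mono) (simp_all add: N_def)
      also have "\<dots> = ennreal (2 powr (- q)) * g t + ennreal q * (g t * (\<integral>\<^sup>+s. N s * indicator {t<..2} s \<partial>lborel))"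
        by (simp add: distrib_left mult_ac)
      also have "g t * (\<integral>\<^sup>+s. N s * indicator {t<..2} s \<partial>lborel) = (\<integral>\<^sup>+s. g t * (N s * indicator {t<..2} s) \<partial>lborel)"
        by (rule nn_integral_cmult[symmetric]) measurable
      finally show ?thesis using True by simp
    qed simp
  qed
  also have "\<dots> = ennreal (2 powr (- q)) * (\<integral>\<^sup>+t. g t * indicator {0<..T} t \<partial>lborel)
      + ennreal q * (\<integral>\<^sup>+t. (\<integral>\<^sup>+s. g t * indicator {0<..T} t * (N s * indicator {t<..2} s) \<partial>lborel) \<partial>lborel)"
    by (simp add: nn_integral_add nn_integral_cmult indicator_def)
  also have "(\<integral>\<^sup>+t. g t * indicator {0<..T} t \<partial>lborel) = ennreal (T powr \<gamma>)"
    unfolding g_def by (rule nn_integral_powr_Ioc) (use \<gamma> T in auto)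
  also have "(\<integral>\<^sup>+t. (\<integral>\<^sup>+s. g t * indicator {0<..T} t * (N s * indicator {t<..2} s) \<partial>lborel) \<partial>lborel)
      = (\<integral>\<^sup>+s. (\<integral>\<^sup>+t. g t * indicator {0<..T} t * (N s * indicator {t<..2} s) \<partial>lborel) \<partial>lborel)"
    unfolding indicator_def greaterThanAtMost_iff by (rule lborel_pair.Fubini') measurable
  also have "\<dots> \<le> (\<integral>\<^sup>+s. ennreal (s powr (- \<alpha> - 1)) * nu E s * indicator {0<..2} s \<partial>lborel)"
  proof (rule nn_integral_mono)
    fix s :: real
    have "(\<integral>\<^sup>+t. g t * indicator {0<..T} t * (N s * indicator {t<..2} s) \<partial>lborel)
      \<le> (\<integral>\<^sup>+t. (N s * indicator {0<..2} s) * (g t * indicator {0<..s} t) \<partial>lborel)"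
      by (rule nn_integral_mono) (auto simp: indicator_def mult_ac)
    also have "\<dots> = (N s * indicator {0<..2} s) * (\<integral>\<^sup>+t. g t * indicator {0<..s} t \<partial>lborel)"
      by (rule nn_integral_cmult) simp
    also have "\<dots> = ennreal (s powr (- \<alpha> - 1)) * nu E s * indicator {0<..2} s"
    proof (cases "s \<in> {0<..2}")
      case True
      then have "(\<integral>\<^sup>+t. g t * indicator {0<..s} t \<partial>lborel) = ennreal (s powr \<gamma>)"
        unfolding g_def by (intro nn_integral_powr_Ioc) (use \<gamma> in auto)
      moreover have "ennreal (s powr (- q - 1)) * ennreal (s powr \<gamma>) = ennreal (s powr (- \<alpha> - 1))"
      proof -
        have eq: "- q - 1 + \<gamma> = - \<alpha> - 1" by (simp add: \<gamma>_def)
        have "ennreal (s powr (- q - 1)) * ennreal (s powr \<gamma>) = ennreal (s powr (- q - 1) * s powr \<gamma>)"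
          by (rule ennreal_mult'[symmetric]) simp
        then show ?thesis by (simp only: powr_add[symmetric] eq)
      qed
      ultimately show ?thesis using True by (simp add: N_def mult.assoc mult.commute[of "nu E s"]) (metis mult.assoc mult.commute)
    qed simp
    finally show "(\<integral>\<^sup>+t. g t * indicator {0<..T} t * (N s * indicator {t<..2} s) \<partial>lborel)
      \<le> ennreal (s powr (- \<alpha> - 1)) * nu E s * indicator {0<..2} s" .
  qed
  also have "\<dots> = I_int \<alpha> E" by (rule I_int_eq[symmetric])
  finally show ?thesis
    unfolding g_def \<gamma>_def by (simp add: add_left_mono mult_left_mono ennreal_mult')
qed

end

subsection \<open>Harmonic measure of an arc\<close>

lemma norm_cis_diff: "cmod (cis a - cis b) = 2 * \<bar>sin ((a - b) / 2)\<bar>"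
proof (rule power2_eq_imp_eq)
  define h where "h = (a - b) / 2"
  have h: "a - b = 2 * h" by (simp add: h_def)
  have "(cmod (cis a - cis b))\<^sup>2 = (cos a - cos b)\<^sup>2 + (sin a - sin b)\<^sup>2"
    unfolding cmod_power2 by simp
  also have "\<dots> = ((sin a)\<^sup>2 + (cos a)\<^sup>2) + ((sin b)\<^sup>2 + (cos b)\<^sup>2) - 2 * (cos a * cos b + sin a * sin b)"
    unfolding power2_diff by (simp add: algebra_simps)
  also have "\<dots> = 2 - 2 * cos (2 * h)"
    unfolding h[symmetric] cos_diff by simp
  also have "\<dots> = 4 * (sin h)\<^sup>2" unfolding cos_double_sin by simp
  finally show "(cmod (cis a - cis b))\<^sup>2 = (2 * \<bar>sin ((a - b) / 2)\<bar>)\<^sup>2"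
    by (simp add: power_mult_distrib h_def)
qed auto

lemma norm_cis_diff_le: "cmod (cis a - cis b) \<le> \<bar>a - b\<bar>"
  using abs_sin_x_le_abs_x[of "(a - b) / 2"] by (simp add: norm_cis_diff)

text \<open>The law of cosines arranged so that the radial distance 1 - r and the chord |w - e|
  separate.\<close>

lemma norm_scaled_diff_square:
  assumes "cmod w = 1" "cmod e = 1"
  shows "(cmod (of_real r * w - e))\<^sup>2 = (1 - r)\<^sup>2 + r * (cmod (w - e))\<^sup>2"
proof -
  have w: "(Re w)\<^sup>2 + (Im w)\<^sup>2 = 1" "(Re e)\<^sup>2 + (Im e)\<^sup>2 = 1"
    using assms by (simp_all flip: cmod_power2)
  define c where "c = Re w * Re e + Im w * Im e"
  have "(cmod (of_real r * w - e))\<^sup>2 = r\<^sup>2 * ((Re w)\<^sup>2 + (Im w)\<^sup>2) + ((Re e)\<^sup>2 + (Im e)\<^sup>2) - 2 * r * c"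
    unfolding cmod_power2 c_def by (simp add: power2_eq_square algebra_simps)
  then have 1: "(cmod (of_real r * w - e))\<^sup>2 = r\<^sup>2 + 1 - 2 * r * c" unfolding w by simp
  have "(cmod (w - e))\<^sup>2 = ((Re w)\<^sup>2 + (Im w)\<^sup>2) + ((Re e)\<^sup>2 + (Im e)\<^sup>2) - 2 * c"
    unfolding cmod_power2 c_def by (simp add: power2_eq_square algebra_simps)
  then have 2: "(cmod (w - e))\<^sup>2 = 2 - 2 * c" unfolding w by simp
  show ?thesis unfolding 1 2 by (simp add: power2_diff algebra_simps)
qed

text \<open>The mean value theorem leaves cos y with y \<le> 1/4, and cos y \<ge> 1 - 2 (1/8)^2 =
  31/32.\<close>

lemma sin_ge_31_32:
  assumes "0 \<le> x" "x \<le> 1 / 4"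
  shows "31 / 32 * x \<le> sin (x::real)"
proof (cases "x = 0")
  case False
  then have x: "0 < x" using assms by simp
  obtain y where y: "0 < y" "y < x" "sin x - sin 0 = (x - 0) * cos y"
    using MVT2[OF x, of sin cos] DERIV_sin by blast
  have "cos y = 1 - 2 * (sin (y / 2))\<^sup>2" using cos_double_sin[of "y / 2"] by simp
  moreover have "(sin (y / 2))\<^sup>2 \<le> (1 / 8)\<^sup>2"
    using abs_sin_x_le_abs_x[of "y / 2"] y assms by (intro power2_le_iff_abs_le[THEN iffD2]) auto
  ultimately have "31 / 32 \<le> cos y" by (simp add: power2_eq_square)
  then have "x * (31 / 32) \<le> x * cos y" using x by (intro mult_left_mono) auto
  then show ?thesis using y by simp
qed simp

text \<open>A point at distance \<open>\<delta>\<close> from the circle at distance \<open>s\<close> from \<open>e\<close>: moving from its radial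
  projection towards \<open>e\<close> by an angle between \<open>\<delta> / 2\<close> and \<open>\<delta>\<close> leads within distance \<open>s\<close> of \<open>e\<close>.
  The projection itself may be further from \<open>e\<close> than \<open>s\<close>.\<close>

lemma chord_towards_le:
  fixes \<theta> \<delta> s \<tau> :: real
  assumes \<theta>: "0 \<le> \<theta>" "\<theta> \<le> pi" and \<delta>: "0 < \<delta>" and s: "0 \<le> s" "s \<le> 1 / 2"
    and eq: "s\<^sup>2 = \<delta>\<^sup>2 + (1 - \<delta>) * (2 * sin (\<theta> / 2))\<^sup>2" and \<delta>1: "\<delta> \<le> 1"
    and \<tau>: "\<delta> / 2 \<le> \<tau>" "\<tau> \<le> \<delta>"
  shows "2 * \<bar>sin ((\<tau> - \<theta>) / 2)\<bar> \<le> s"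
proof -
  define d where "d = 2 * sin (\<theta> / 2)"
  have d0: "0 \<le> d" using \<theta> sin_ge_zero[of "\<theta> / 2"] by (simp add: d_def)
  have "\<delta>\<^sup>2 \<le> s\<^sup>2" using eq \<delta>1 by simp
  then have \<delta>s: "\<delta> \<le> s" by (rule power2_le_imp_le[OF _ s(1)])
  show ?thesis
  proof (cases "\<theta> \<le> \<tau>")
    case True
    then show ?thesis using abs_sin_x_le_abs_x[of "(\<tau> - \<theta>) / 2"] \<theta> \<tau> \<delta>s by simp
  next
    case False
    define x where "x = \<tau> / 2"
    have x: "0 \<le> x" "x \<le> 1 / 4" "x \<le> \<theta> / 2" "\<delta> / 4 \<le> x" using \<tau> \<delta> \<delta>s s False by (auto simp: x_def)
    have e1: "(\<tau> - \<theta>) / 2 = - (\<theta> / 2 - x)" by (simp add: x_def field_simps)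
    have pos: "0 \<le> sin (\<theta> / 2 - x)" using x \<theta> by (intro sin_ge_zero) auto
    have e2: "2 * \<bar>sin ((\<tau> - \<theta>) / 2)\<bar> = 2 * sin (\<theta> / 2 - x)" unfolding e1 sin_minus using pos by simp
    show ?thesis
    proof (cases "d \<le> s")
      case True
      have "sin (\<theta> / 2 - x) \<le> sin (\<theta> / 2)" using x \<theta> by (intro sin_monotone_2pi_le) auto
      then show ?thesis using e2 True by (simp add: d_def)
    next
      case False
      define c where "c = cos (\<theta> / 2)"
      have c0: "0 \<le> c" using \<theta> by (auto simp: c_def intro!: cos_ge_zero)
      have dc: "d\<^sup>2 = 4 * (1 - c\<^sup>2)" unfolding d_def c_def by (simp add: power_mult_distrib sin_squared_eq)
      have sd: "s\<^sup>2 = \<delta>\<^sup>2 + (1 - \<delta>) * d\<^sup>2" using eq by (simp add: d_def)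
      have half: "1 / 2 * d\<^sup>2 \<le> (1 - \<delta>) * d\<^sup>2" using \<delta>s s by (intro mult_right_mono) auto
      have "s\<^sup>2 \<le> (1 / 2)\<^sup>2" using s by (intro power_mono) auto
      then have "s\<^sup>2 \<le> 1 / 4" by (simp add: power2_eq_square)
      then have d2: "d\<^sup>2 \<le> 1 / 2" using half sd zero_le_power2[of \<delta>] by linarith
      \<comment> \<open>From d^2 \<le> 1/2 and d^2 = 4 (1 - c^2) one gets c^2 \<ge> 7/8, slightly
        more than 0.93^2.\<close>
      have c2: "(93 / 100)\<^sup>2 \<le> c\<^sup>2" using dc d2 by (simp add: power2_eq_square)
      have c: "93 / 100 \<le> c" by (rule power2_le_imp_le[OF c2 c0])
      have "d\<^sup>2 \<le> (71 / 100)\<^sup>2" using d2 by (simp add: power2_eq_square)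
      then have d1: "d \<le> 71 / 100" by (rule power2_le_imp_le) simp
      have "(7 / 10 * d)\<^sup>2 \<le> s\<^sup>2"
      proof -
        have "(7 / 10 * d)\<^sup>2 = 49 / 100 * d\<^sup>2" by (simp add: power2_eq_square)
        also have "\<dots> \<le> 1 / 2 * d\<^sup>2" by simp
        also have "\<dots> \<le> s\<^sup>2" using half sd zero_le_power2[of \<delta>] by linarith
        finally show ?thesis .
      qed
      then have s7: "7 / 10 * d \<le> s" by (rule power2_le_imp_le[OF _ s(1)])
      \<comment> \<open>The projection can be further from e than s by at most (10/17) \<delta> d,
        about 0.418 \<delta>, since d + s \<ge> 1.7 d and d \<le> 0.71. Moving by an angle of at
        least \<delta> / 2 gains 2 * 0.93 * (31/32) * \<delta> / 4, about 0.450 \<delta>, which is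
        more.\<close>
      have "(d - s) * (d + s) = \<delta> * d\<^sup>2 - \<delta>\<^sup>2" using sd by (simp add: power2_eq_square algebra_simps)
      also have "\<dots> \<le> \<delta> * d * d" by (simp add: power2_eq_square)
      also have "\<dots> \<le> \<delta> * d * ((d + s) / (17 / 10))"
        using s7 d0 \<delta> by (intro mult_left_mono) auto
      also have "\<dots> = (\<delta> * d * (10 / 17)) * (d + s)" by simp
      finally have "(d - s) * (d + s) \<le> (\<delta> * d * (10 / 17)) * (d + s)" .
      moreover have "0 < d + s" using False d0 s by simp
      ultimately have "d - s \<le> \<delta> * d * (10 / 17)" by (rule mult_right_le_imp_le)
      also have "\<dots> \<le> \<delta> * (71 / 100) * (10 / 17)" using d1 \<delta> by (intro mult_right_mono mult_left_mono) auto
      finally have ds: "d - s \<le> 71 / 170 * \<delta>" by simp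
      have "2 * sin (\<theta> / 2 - x) = d * cos x - 2 * (c * sin x)"
        by (simp add: sin_diff d_def c_def algebra_simps)
      also have "\<dots> \<le> d * 1 - 2 * (93 / 100 * (31 / 32 * (\<delta> / 4)))"
      proof -
        have "31 / 32 * (\<delta> / 4) \<le> sin x" using sin_ge_31_32[OF x(1,2)] x(4) by linarith
        then have "93 / 100 * (31 / 32 * (\<delta> / 4)) \<le> c * sin x" using c c0 \<delta> by (intro mult_mono) auto
        moreover have "d * cos x \<le> d * 1" using d0 by (intro mult_left_mono) auto
        ultimately show ?thesis by linarith
      qed
      also have "\<dots> \<le> s" using ds \<delta> by simp
      finally show ?thesis unfolding e2 .
    qed
  qed
qed

text \<open>With \<delta> = 1 - |z| the arc at angles between \<delta> / 2 and \<delta> from the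
  projection of z towards e has normalized length \<delta> / (4 \<pi>), and the kernel there is at
  least (1 + |z|) / (2 \<delta>); \<delta> cancels in the product. The two alternatives for y are
  the cases in which this arc is known to lie within y of e: y is the distance of z itself if that
  is at most 1/2, or the distance of the projection if that is at least \<delta>.\<close>

lemma poisson_integral_window_ge:
  assumes z: "cmod z < 1" "z \<noteq> 0" and e: "cmod e = 1"
    and f: "f \<in> borel_measurable borel" and c: "0 \<le> c"
    and fc: "\<And>\<zeta>. cmod \<zeta> = 1 \<Longrightarrow> cmod (\<zeta> - e) \<le> y \<Longrightarrow> ennreal c \<le> f \<zeta>"
    and y: "(cmod (z - e) \<le> 1 / 2 \<and> y = cmod (z - e)) \<or> (1 - cmod z \<le> cmod (sgn z - e) \<and> y = cmod (sgn z - e))"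
  shows "ennreal (c * ((1 + cmod z) / (8 * pi))) \<le> (\<integral>\<^sup>+\<zeta>. f \<zeta> * ennreal (poisson z \<zeta>) \<partial>circle_measure)"
proof -
  note [measurable] = f
  define r where "r = cmod z"
  define \<delta> where "\<delta> = 1 - r"
  define w where "w = sgn z"
  have r: "0 < r" "r < 1" using z by (auto simp: r_def)
  have \<delta>: "0 < \<delta>" "\<delta> < 1" using r by (auto simp: \<delta>_def)
  have w: "cmod w = 1" using z by (simp add: w_def norm_sgn)
  have zw: "z = of_real r * w" using z by (simp add: w_def r_def sgn_eq)
  define \<theta>' where "\<theta>' = Arg (e / w)"
  have "cmod (e / w) = 1" using w e by (simp add: norm_divide)
  moreover have "e \<noteq> 0" "w \<noteq> 0" using w e by auto
  ultimately have ew: "e = w * cis \<theta>'"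
    using w cis_Arg[of "e / w"] by (auto simp: \<theta>'_def sgn_eq field_simps)
  have \<theta>'b: "\<bar>\<theta>'\<bar> \<le> pi" using Arg_bounded[of "e / w"] by (auto simp: \<theta>'_def)
  define \<theta> where "\<theta> = \<bar>\<theta>'\<bar>"
  \<comment> \<open>The sign selects the direction from the projection w towards e along the shorter
    arc, so that a positive \<tau> always means moving towards e.\<close>
  define \<sigma> :: real where "\<sigma> = (if 0 \<le> \<theta>' then 1 else - 1)"
  have \<sigma>: "\<sigma> = 1 \<or> \<sigma> = - 1" "\<theta>' = \<sigma> * \<theta>" by (auto simp: \<sigma>_def \<theta>_def)
  have \<theta>: "0 \<le> \<theta>" "\<theta> \<le> pi" using \<theta>'b by (auto simp: \<theta>_def)
  have dist_e: "cmod (w * cis (\<sigma> * \<tau>) - e) = 2 * \<bar>sin ((\<tau> - \<theta>) / 2)\<bar>" for \<tau>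
  proof -
    have "cmod (w * cis (\<sigma> * \<tau>) - e) = cmod (cis (\<sigma> * \<tau>) - cis (\<sigma> * \<theta>))"
      using w by (simp add: ew \<sigma>(2) flip: right_diff_distrib) (simp add: norm_mult)
    also have "\<dots> = 2 * \<bar>sin ((\<sigma> * \<tau> - \<sigma> * \<theta>) / 2)\<bar>" by (rule norm_cis_diff)
    also have "\<bar>sin ((\<sigma> * \<tau> - \<sigma> * \<theta>) / 2)\<bar> = \<bar>sin ((\<tau> - \<theta>) / 2)\<bar>"
    proof -
      have "(- \<tau> + \<theta>) / 2 = - ((\<tau> - \<theta>) / 2)"
        by (simp add: diff_divide_distrib add_divide_distrib)
      then show ?thesis using \<sigma>(1) by (auto simp only: mult_1_left mult_minus1 diff_minus_eq_add sin_minus abs_minus_cancel)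
    qed
    finally show ?thesis .
  qed
  have we: "cmod (w - e) = 2 * sin (\<theta> / 2)"
    using dist_e[of 0] sin_ge_zero[of "\<theta> / 2"] \<theta> by simp
  have ze: "(cmod (z - e))\<^sup>2 = \<delta>\<^sup>2 + (1 - \<delta>) * (2 * sin (\<theta> / 2))\<^sup>2"
    using norm_scaled_diff_square[OF w e, of r] unfolding zw[symmetric] we by (simp add: \<delta>_def)
  have near: "cmod (w * cis (\<sigma> * \<tau>) - e) \<le> y" if \<tau>: "\<delta> / 2 \<le> \<tau>" "\<tau> \<le> \<delta>" for \<tau>
    using y
  proof
    assume a: "cmod (z - e) \<le> 1 / 2 \<and> y = cmod (z - e)"
    show ?thesis
      unfolding dist_e a[THEN conjunct2]
      by (rule chord_towards_le[OF \<theta> \<delta>(1) _ _ ze]) (use a \<delta> \<tau> in auto)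
  next
    assume a: "1 - cmod z \<le> cmod (sgn z - e) \<and> y = cmod (sgn z - e)"
    then have "\<delta> \<le> 2 * sin (\<theta> / 2)" "y = 2 * sin (\<theta> / 2)" using we by (simp_all add: \<delta>_def r_def w_def)
    moreover have "2 * sin (\<theta> / 2) \<le> \<theta>" using sin_x_le_x[of "\<theta> / 2"] \<theta> by simp
    ultimately have t: "\<tau> \<le> \<theta>" using \<tau> by linarith
    have e1: "(\<tau> - \<theta>) / 2 = - (\<theta> / 2 - \<tau> / 2)" by (simp add: field_simps)
    have "0 \<le> sin (\<theta> / 2 - \<tau> / 2)" using t \<tau> \<theta> \<delta> by (intro sin_ge_zero) auto
    moreover have "sin (\<theta> / 2 - \<tau> / 2) \<le> sin (\<theta> / 2)" using t \<tau> \<theta> \<delta> by (intro sin_monotone_2pi_le) auto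
    ultimately show ?thesis unfolding dist_e e1 sin_minus \<open>y = 2 * sin (\<theta> / 2)\<close> by simp
  qed
  have pz: "(1 + r) / (2 * \<delta>) \<le> poisson z (w * cis (\<sigma> * \<tau>))" if \<tau>: "\<delta> / 2 \<le> \<tau>" "\<tau> \<le> \<delta>" for \<tau>
  proof -
    define \<zeta> where "\<zeta> = w * cis (\<sigma> * \<tau>)"
    have \<zeta>: "cmod \<zeta> = 1" using w by (simp add: \<zeta>_def norm_mult)
    have "cmod (w - \<zeta>) \<le> \<tau>"
    proof -
      have "cmod (w - \<zeta>) = cmod w * cmod (cis 0 - cis (\<sigma> * \<tau>))"
        by (simp add: \<zeta>_def right_diff_distrib flip: norm_mult)
      also have "\<dots> \<le> \<bar>0 - \<sigma> * \<tau>\<bar>" using norm_cis_diff_le[of 0 "\<sigma> * \<tau>"] w by simp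
      also have "\<dots> = \<tau>" using \<sigma>(1) \<tau> \<delta> by (auto simp: abs_mult)
      finally show ?thesis .
    qed
    then have "(cmod (w - \<zeta>))\<^sup>2 \<le> \<delta>\<^sup>2" using \<tau> by (intro power_mono) auto
    then have "r * (cmod (w - \<zeta>))\<^sup>2 \<le> 1 * \<delta>\<^sup>2" using r by (intro mult_mono) auto
    then have up: "(cmod (z - \<zeta>))\<^sup>2 \<le> 2 * \<delta>\<^sup>2"
      using norm_scaled_diff_square[OF w \<zeta>, of r] unfolding zw[symmetric] by (simp add: \<delta>_def)
    have "z \<noteq> \<zeta>" using z \<zeta> by auto
    then have "0 < (cmod (z - \<zeta>))\<^sup>2" by simp
    have "(1 + r) / (2 * \<delta>) = (1 - r\<^sup>2) / (2 * \<delta>\<^sup>2)"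
    proof -
      have "1 - r\<^sup>2 = (1 + r) * \<delta>" by (simp add: \<delta>_def power2_eq_square algebra_simps)
      then show ?thesis using \<delta> by (simp add: power2_eq_square)
    qed
    also have "\<dots> \<le> (1 - r\<^sup>2) / (cmod (z - \<zeta>))\<^sup>2"
      by (intro divide_left_mono up mult_pos_pos) (use r \<delta> \<open>0 < (cmod (z - \<zeta>))\<^sup>2\<close> in \<open>auto simp: power_le_one\<close>)
    finally show ?thesis by (simp add: poisson_def r_def \<zeta>_def)
  qed
  define C where "C = ennreal (c * ((1 + r) / (2 * \<delta>)))"
  have bound: "C \<le> f (w * cis (\<sigma> * \<tau>)) * ennreal (poisson z (w * cis (\<sigma> * \<tau>)))" if "\<delta> / 2 \<le> \<tau>" "\<tau> \<le> \<delta>" for \<tau>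
  proof -
    have "C = ennreal c * ennreal ((1 + r) / (2 * \<delta>))" unfolding C_def using c by (rule ennreal_mult')
    also have "\<dots> \<le> f (w * cis (\<sigma> * \<tau>)) * ennreal (poisson z (w * cis (\<sigma> * \<tau>)))"
      by (intro mult_mono fc near pz that ennreal_leI) (use w in \<open>auto simp: norm_mult\<close>)
    finally show ?thesis .
  qed
  \<comment> \<open>Left end of the arc as a parameter interval: for \<sigma> = -1 the arc is
    reflected to {-\<delta>..-\<delta> / 2}.\<close>
  define x1 where "x1 = (if \<sigma> = 1 then \<delta> / 2 else - \<delta>)"
  have "C * ennreal (((x1 + \<delta> / 2) - x1) / (2 * pi)) \<le> (\<integral>\<^sup>+\<zeta>. f \<zeta> * ennreal (poisson z \<zeta>) \<partial>circle_measure)"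
  proof (rule nn_integral_circle_arc_ge[OF _ w])
    fix \<tau> assume t: "x1 \<le> \<tau>" "\<tau> \<le> x1 + \<delta> / 2"
    have "\<tau> = \<sigma> * (\<sigma> * \<tau>)" "\<delta> / 2 \<le> \<sigma> * \<tau>" "\<sigma> * \<tau> \<le> \<delta>"
      using \<sigma>(1) t by (auto simp: x1_def)
    then show "C \<le> f (w * cis \<tau>) * ennreal (poisson z (w * cis \<tau>))" using bound[of "\<sigma> * \<tau>"] by metis
  qed (use \<delta> pi_gt_zero pi_ge_two in auto)
  moreover have "C * ennreal (((x1 + \<delta> / 2) - x1) / (2 * pi)) = ennreal (c * ((1 + r) / (8 * pi)))"
    unfolding C_def using c r \<delta> by (subst ennreal_mult[symmetric]) (auto simp: field_simps)
  ultimately show ?thesis by (simp add: r_def)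
qed

section \<open>Poisson integrals of nonnegative functions and the barrier\<close>

lemma Re_herglotz_nn_integral:
  assumes g [measurable]: "g \<in> borel_measurable borel" and gb: "\<And>\<zeta>. 0 \<le> g \<zeta>" "\<And>\<zeta>. g \<zeta> \<le> C" and z: "cmod z < 1"
  shows "0 \<le> Re (herglotz g z)"
    and "ennreal (Re (herglotz g z)) = (\<integral>\<^sup>+\<zeta>. ennreal (g \<zeta>) * ennreal (poisson z \<zeta>) \<partial>circle_measure)"
proof -
  have ab: "\<bar>g \<zeta>\<bar> \<le> C" for \<zeta> using gb[of \<zeta>] by simp
  have nn: "0 \<le> g \<zeta> * poisson z \<zeta>" for \<zeta> using gb(1) poisson_nonneg[of z \<zeta>] z by simp
  have eq: "Re (herglotz g z) = (\<integral>\<zeta>. g \<zeta> * poisson z \<zeta> \<partial>circle_measure)"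
    by (rule Re_herglotz[OF g ab z])
  show "0 \<le> Re (herglotz g z)" unfolding eq by (rule Bochner_Integration.integral_nonneg) (rule nn)
  have "(\<integral>\<^sup>+\<zeta>. ennreal (g \<zeta> * poisson z \<zeta>) \<partial>circle_measure) = ennreal (\<integral>\<zeta>. g \<zeta> * poisson z \<zeta> \<partial>circle_measure)"
    by (rule nn_integral_eq_integral[OF integrable_poisson[OF g ab z]]) (use nn in simp)
  then show "ennreal (Re (herglotz g z)) = (\<integral>\<^sup>+\<zeta>. ennreal (g \<zeta>) * ennreal (poisson z \<zeta>) \<partial>circle_measure)"
    unfolding eq using gb(1) by (simp add: ennreal_mult')
qed

lemma nn_integral_poisson:
  assumes z: "cmod z < 1"
  shows "(\<integral>\<^sup>+\<zeta>. ennreal (poisson z \<zeta>) \<partial>circle_measure) = 1"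
proof -
  have "integrable circle_measure (\<lambda>\<zeta>. 1 * poisson z \<zeta>)"
    by (rule integrable_poisson[where C = 1 and f = "\<lambda>_. 1"]) (use z in auto)
  then have "(\<integral>\<^sup>+\<zeta>. ennreal (poisson z \<zeta>) \<partial>circle_measure) = ennreal (\<integral>\<zeta>. poisson z \<zeta> \<partial>circle_measure)"
    by (intro nn_integral_eq_integral) (use poisson_nonneg[of z] z in auto)
  then show ?thesis by (simp add: integral_poisson_eq_1[OF z])
qed

lemma poisson_ge:
  assumes "cmod z < 1" "cmod \<zeta> = 1" "cmod (z - \<zeta>) \<le> y"
  shows "(1 - (cmod z)\<^sup>2) / y\<^sup>2 \<le> poisson z \<zeta>"
proof -
  have "0 < cmod (z - \<zeta>)" using assms by auto
  moreover from this have "0 < y" using assms(3) by linarith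
  ultimately have "0 < (cmod (z - \<zeta>))\<^sup>2" "0 < y\<^sup>2" by simp_all
  moreover have "(cmod (z - \<zeta>))\<^sup>2 \<le> y\<^sup>2" using assms(3) by (intro power_mono) auto
  ultimately show ?thesis
    unfolding poisson_def using assms(1) by (intro divide_left_mono mult_pos_pos) (auto simp: power_le_one)
qed

definition barrier :: "complex set \<Rightarrow> real \<Rightarrow> complex \<Rightarrow> complex" where
  "barrier E t = herglotz (\<lambda>\<zeta>. if infdist \<zeta> E < t then 7 * t else 0)"

context
  fixes E :: "complex set" and t :: real
  assumes E: "E \<subseteq> sphere 0 1" "closed E" "E \<noteq> {}" and t: "0 < t" "t \<le> 1 / 45"
begin

lemma measurable_barrier_weight [measurable]: "(\<lambda>\<zeta>. if infdist \<zeta> E < t then 7 * t else 0) \<in> borel_measurable borel"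
proof -
  note [measurable] = measurable_infdist_E[OF E]
  show ?thesis by measurable
qed

lemma barrier_holomorphic: "barrier E t holomorphic_on ball 0 1"
  unfolding barrier_def by (rule holomorphic_herglotz[where C = "7 * t"]) (use t in auto)

lemma barrier_nonneg: "cmod z < 1 \<Longrightarrow> 0 \<le> Re (barrier E t z)"
  unfolding barrier_def by (rule Re_herglotz_nn_integral(1)[where C = "7 * t"]) (use t in auto)

lemma barrier_nn_integral: "cmod z < 1 \<Longrightarrow> ennreal (Re (barrier E t z))
    = (\<integral>\<^sup>+\<zeta>. ennreal (if infdist \<zeta> E < t then 7 * t else 0) * ennreal (poisson z \<zeta>) \<partial>circle_measure)"
  unfolding barrier_def by (rule Re_herglotz_nn_integral(2)[where C = "7 * t"]) (use t in auto)

text \<open>Let e be a nearest point of E. The arc of half-angle 49/50 t about e stays strictly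
  within t of E, and its points are within 2t of z. Weight, kernel and arc length give 343 / (200
  \<pi>) > 0.54 times 1 - r^2, whereas - ln r is at most 0.54 (1 - r^2) for r \<ge> 44/45. A weight
  of 6t on the same arc would give a factor below 1/2.\<close>

lemma barrier_ge_ln:
  assumes z: "cmod z < 1" and near: "infdist z E \<le> t"
  shows "- ln (cmod z) \<le> Re (barrier E t z)"
proof -
  define r where "r = cmod z"
  obtain e where e: "e \<in> E" "infdist z E = dist z e"
    using infdist_attains_inf[OF E(2,3)] by blast
  have e1: "cmod e = 1" using E e by auto
  have "1 - r \<le> t" using near e norm_circle_diff_ge[OF e1, of z] by (simp add: dist_norm norm_minus_commute r_def)
  then have r: "44 / 45 \<le> r" "r < 1" using t z by (auto simp: r_def)
  have r2: "(44 / 45)\<^sup>2 \<le> r\<^sup>2" using r by (intro power_mono) auto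
  have r21: "r\<^sup>2 < 1" using r by (simp add: power2_eq_square mult_less_cancel_left1 less_le_trans mult_strict_mono'[of r 1 r 1, simplified])
  define c where "c = 7 * t * ((1 - r\<^sup>2) / (2 * t)\<^sup>2)"
  have c0: "0 \<le> c" using t r21 by (simp add: c_def)
  have "ennreal c * ennreal ((49 / 50 * t - - (49 / 50 * t)) / (2 * pi)) \<le> ennreal (Re (barrier E t z))"
    unfolding barrier_nn_integral[OF z]
  proof (rule nn_integral_circle_arc_ge[OF _ e1])
    fix \<tau> assume \<tau>: "- (49 / 50 * t) \<le> \<tau>" "\<tau> \<le> 49 / 50 * t"
    define \<zeta> where "\<zeta> = e * cis \<tau>"
    have \<zeta>: "cmod \<zeta> = 1" using e1 by (simp add: \<zeta>_def norm_mult)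
    have "dist \<zeta> e = cmod (cis \<tau> - cis 0)"
    proof -
      have "\<zeta> - e = e * (cis \<tau> - cis 0)" by (simp add: \<zeta>_def right_diff_distrib)
      then show ?thesis using e1 by (simp add: dist_norm norm_mult)
    qed
    also have "\<dots> \<le> \<bar>\<tau>\<bar>" using norm_cis_diff_le[of \<tau> 0] by simp
    also have "\<dots> < t" using \<tau> t by linarith
    finally have de: "dist \<zeta> e < t" .
    then have "infdist \<zeta> E < t" using infdist_le[OF e(1), of \<zeta>] by simp
    moreover have "cmod (z - \<zeta>) \<le> 2 * t"
      using de e near dist_triangle[of z \<zeta> e] by (simp add: dist_norm norm_minus_commute)
    from poisson_ge[OF z \<zeta> this] have "(1 - r\<^sup>2) / (2 * t)\<^sup>2 \<le> poisson z \<zeta>" by (simp add: r_def)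
    then have "c \<le> 7 * t * poisson z \<zeta>" unfolding c_def using t by (intro mult_left_mono) auto
    ultimately show "ennreal c \<le> ennreal (if infdist (e * cis \<tau>) E < t then 7 * t else 0) * ennreal (poisson z (e * cis \<tau>))"
      using t by (simp add: \<zeta>_def ennreal_leI flip: ennreal_mult')
  next
    show "49 / 50 * t - - (49 / 50 * t) \<le> 2 * pi" using t pi_gt3 by linarith
  qed (use t in auto)
  then have "ennreal (c * ((49 / 50 * t - - (49 / 50 * t)) / (2 * pi))) \<le> ennreal (Re (barrier E t z))"
    by (simp only: ennreal_mult'[OF c0])
  then have 1: "c * ((49 / 50 * t - - (49 / 50 * t)) / (2 * pi)) \<le> Re (barrier E t z)"
    by (simp add: barrier_nonneg[OF z])
  have "c * ((49 / 50 * t - - (49 / 50 * t)) / (2 * pi)) = (1 - r\<^sup>2) * (343 / (200 * pi))"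
    using t by (simp add: c_def power2_eq_square field_simps)
  moreover have "54 / 100 \<le> 343 / (200 * pi)"
    using pi_approx(2) by (simp add: field_simps)
  then have "(1 - r\<^sup>2) * (54 / 100) \<le> (1 - r\<^sup>2) * (343 / (200 * pi))" using r21 by (intro mult_left_mono) auto
  ultimately have 2: "(1 - r\<^sup>2) * (54 / 100) \<le> Re (barrier E t z)" using 1 by linarith
  \<comment> \<open>Halving ln (1 / r^2) produces the factor 1 - r^2 that the Poisson kernel also
    contains.\<close>
  have "- ln r = ln (1 / r\<^sup>2) / 2" using r by (simp add: ln_div ln_realpow)
  also have "\<dots> \<le> (1 / r\<^sup>2 - 1) / 2" using ln_le_minus_one[of "1 / r\<^sup>2"] r by (simp add: zero_less_power)
  also have "\<dots> = (1 - r\<^sup>2) * (1 / (2 * r\<^sup>2))" using r by (simp add: field_simps)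
  also have "\<dots> \<le> (1 - r\<^sup>2) * (54 / 100)"
  proof (intro mult_left_mono)
    have "1 / (2 * r\<^sup>2) \<le> 1 / (2 * (44 / 45)\<^sup>2)" using r2 by (intro divide_left_mono) (auto simp: power2_eq_square)
    then show "1 / (2 * r\<^sup>2) \<le> 54 / 100" by (simp add: power2_eq_square)
  qed (use r21 in simp)
  finally show ?thesis using 2 by (simp add: r_def)
qed

text \<open>Estimating the kernel by 1 / s^2, s = \<rho>(z, E), would lose a factor 1 / s. Instead
  the kernel is compared with that of the point z' of modulus 1 - s on the same radius, whose
  Poisson integral is 1. For \<zeta> within t \<le> s / 20 of E one has |z - \<zeta>| \<ge> 19/20 s,
  hence |z' - \<zeta>|^2 \<le> s^2 + |z - \<zeta>|^2 \<le> 2.11 |z - \<zeta>|^2. The denominator s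
  (2 - s) is 1 - |z'|^2, and 7 * 2.11 * 2 \<le> 30.\<close>

lemma barrier_le:
  assumes z: "cmod z < 1" and far: "20 * t \<le> infdist z E"
  shows "infdist z E \<le> 1 \<Longrightarrow> Re (barrier E t z) \<le> 30 * t * (1 - cmod z) / (infdist z E * (2 - infdist z E))"
    and "1 \<le> infdist z E \<Longrightarrow> Re (barrier E t z) \<le> 16 * t * (1 - cmod z)"
proof -
  define r where "r = cmod z"
  define s where "s = infdist z E"
  have r: "0 \<le> r" "r < 1" using z by (auto simp: r_def)
  have r1: "1 - r\<^sup>2 \<le> 2 * (1 - r)"
  proof -
    have "0 \<le> (1 - r)\<^sup>2" by simp
    then show ?thesis by (simp add: power2_eq_square algebra_simps)
  qed
  have r0: "0 \<le> 1 - r\<^sup>2" using r by (simp add: power_le_one)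
  have s20: "20 * t \<le> s" using far by (simp add: s_def)
  have s0: "0 < s" using s20 t by linarith
  have dz: "19 / 20 * s \<le> cmod (z - \<zeta>)" if "infdist \<zeta> E < t" for \<zeta>
    using infdist_triangle[of z E \<zeta>] that s20 by (simp add: s_def dist_norm)
  have up: "Re (barrier E t z) \<le> K"
    if K: "0 \<le> K" "cmod z' < 1"
      "\<And>\<zeta>. cmod \<zeta> = 1 \<Longrightarrow> infdist \<zeta> E < t \<Longrightarrow> 7 * t * poisson z \<zeta> \<le> K * poisson z' \<zeta>" for K z'
  proof -
    have "ennreal (Re (barrier E t z)) \<le> (\<integral>\<^sup>+\<zeta>. ennreal K * ennreal (poisson z' \<zeta>) \<partial>circle_measure)"
      unfolding barrier_nn_integral[OF z]
    proof (rule nn_integral_mono_AE, use AE_circle_measure in eventually_elim)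
      fix \<zeta> :: complex assume \<zeta>: "cmod \<zeta> = 1"
      show "ennreal (if infdist \<zeta> E < t then 7 * t else 0) * ennreal (poisson z \<zeta>) \<le> ennreal K * ennreal (poisson z' \<zeta>)"
        using K(1) K(3)[OF \<zeta>] t by (auto simp: ennreal_leI simp flip: ennreal_mult')
    qed
    also have "\<dots> = ennreal K"
      using nn_integral_poisson[OF K(2)] by (simp add: nn_integral_cmult)
    finally show ?thesis using K(1) by simp
  qed
  show "Re (barrier E t z) \<le> 30 * t * (1 - cmod z) / (infdist z E * (2 - infdist z E))" if s1: "infdist z E \<le> 1"
  proof -
    have s: "s \<le> 1" using s1 by (simp add: s_def)
    define r' where "r' = 1 - s"
    define w where "w = sgn z"
    have "1 - r \<le> s"
    proof -
      obtain e where e: "e \<in> E" "infdist z E = dist z e" using infdist_attains_inf[OF E(2,3)] by blast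
      then have "cmod e = 1" using E by auto
      then show ?thesis using e norm_circle_diff_ge[of e z] by (simp add: s_def r_def dist_norm norm_minus_commute)
    qed
    then have r': "0 \<le> r'" "r' \<le> r" "r' < 1" using s s0 by (auto simp: r'_def)
    define z' where "z' = of_real r' * w"
    have nz': "cmod z' = r'"
    proof (cases "z = 0")
      case True
      then have "r' = 0" using r' by (simp add: r_def)
      then show ?thesis by (simp add: z'_def)
    next
      case False
      then show ?thesis using r' by (simp add: z'_def w_def norm_mult norm_sgn)
    qed
    define Q where "Q = s * (2 - s)"
    have Q: "1 - r'\<^sup>2 = Q" "0 < Q"
      using s s0 by (simp add: r'_def Q_def power2_eq_square algebra_simps)
        (use s s0 in \<open>simp add: Q_def\<close>)
    define K where "K = 7 * t * (211 / 100) * (1 - r\<^sup>2) / Q"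
    have "Re (barrier E t z) \<le> K"
    proof (rule up[where z' = z'])
      show "0 \<le> K" using t r0 Q by (simp add: K_def)
      show "cmod z' < 1" using nz' r' by simp
      fix \<zeta> assume \<zeta>: "cmod \<zeta> = 1" "infdist \<zeta> E < t"
      define D where "D = (cmod (z - \<zeta>))\<^sup>2"
      define D' where "D' = (cmod (z' - \<zeta>))\<^sup>2"
      have "(19 / 20 * s)\<^sup>2 \<le> D" unfolding D_def using dz[OF \<zeta>(2)] s0 by (intro power_mono) auto
      then have "361 / 400 * s\<^sup>2 \<le> D" by (simp add: power2_eq_square)
      then have sD: "s\<^sup>2 \<le> 111 / 100 * D" using zero_le_power2[of s] by linarith
      have D'D: "D' \<le> s\<^sup>2 + D"
      proof (cases "z = 0")
        case True
        then have "r' = 0" "s = 1" using r' by (auto simp: r_def r'_def)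
        then show ?thesis using \<zeta> by (simp add: D'_def D_def z'_def)
      next
        case False
        then have w: "cmod w = 1" and zw: "z = of_real r * w" by (simp_all add: w_def norm_sgn r_def) (simp add: sgn_eq)
        have "D' = s\<^sup>2 + r' * (cmod (w - \<zeta>))\<^sup>2"
          unfolding D'_def z'_def norm_scaled_diff_square[OF w \<zeta>(1)] by (simp add: r'_def)
        also have "\<dots> \<le> s\<^sup>2 + ((1 - r)\<^sup>2 + r * (cmod (w - \<zeta>))\<^sup>2)"
          using r' by (intro add_left_mono) (meson add_increasing mult_right_mono zero_le_power2)
        also have "\<dots> = s\<^sup>2 + D"
          unfolding D_def zw norm_scaled_diff_square[OF w \<zeta>(1)] ..
        finally show ?thesis .
      qed
      have "z \<noteq> \<zeta>" "z' \<noteq> \<zeta>" using z \<zeta> nz' r' by auto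
      then have pos: "0 < D" "0 < D'" by (simp_all add: D_def D'_def)
      have le: "D' \<le> 211 / 100 * D" using sD D'D by simp
      have "7 * t * poisson z \<zeta> = 7 * t * (1 - r\<^sup>2) * (1 / D)" by (simp add: poisson_def D_def r_def)
      also have "\<dots> \<le> 7 * t * (1 - r\<^sup>2) * (211 / 100 / D')"
        using le pos t r0 by (intro mult_left_mono) (simp_all add: field_simps)
      also have "\<dots> = K * poisson z' \<zeta>"
        using Q pos by (simp add: K_def poisson_def nz' D'_def[symmetric])
      finally show "7 * t * poisson z \<zeta> \<le> K * poisson z' \<zeta>" .
    qed
    also have "K \<le> 30 * t * (1 - r) / Q"
      unfolding K_def
    proof (intro divide_right_mono)
      have "7 * t * (211 / 100) * (1 - r\<^sup>2) \<le> 7 * t * (211 / 100) * (2 * (1 - r))" using r1 t by (intro mult_left_mono) auto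
      also have "\<dots> = (2954 / 100) * (t * (1 - r))" by simp
      also have "\<dots> \<le> 30 * (t * (1 - r))" using t r by (intro mult_right_mono) auto
      finally show "7 * t * (211 / 100) * (1 - r\<^sup>2) \<le> 30 * t * (1 - r)" by simp
    qed (use Q in simp)
    finally show ?thesis by (simp add: Q_def s_def r_def)
  qed
  \<comment> \<open>Far from E the comparison point is the origin: (19/20)^2 \<ge> 9/10 and 7 * 2 /
    (9/10) \<le> 16.\<close>
  show "Re (barrier E t z) \<le> 16 * t * (1 - cmod z)" if s1: "1 \<le> infdist z E"
  proof -
    define K where "K = 7 * t * ((1 - r\<^sup>2) / (9 / 10))"
    have "Re (barrier E t z) \<le> K"
    proof (rule up[where z' = 0])
      show "0 \<le> K" using t r0 by (simp add: K_def)
      fix \<zeta> assume \<zeta>: "cmod \<zeta> = 1" "infdist \<zeta> E < t"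
      have "19 / 20 \<le> cmod (z - \<zeta>)" using dz[OF \<zeta>(2)] s1 by (simp add: s_def)
      then have "(19 / 20)\<^sup>2 \<le> (cmod (z - \<zeta>))\<^sup>2" by (intro power_mono) auto
      then have D: "9 / 10 \<le> (cmod (z - \<zeta>))\<^sup>2" by (simp add: power2_eq_square)
      have "poisson z \<zeta> \<le> (1 - r\<^sup>2) / (9 / 10)"
        unfolding poisson_def r_def[symmetric] using D r0 by (intro divide_left_mono) auto
      then have "7 * t * poisson z \<zeta> \<le> K" unfolding K_def using t by (intro mult_left_mono) auto
      then show "7 * t * poisson z \<zeta> \<le> K * poisson 0 \<zeta>" using \<zeta> by (simp add: poisson_def)
    qed simp
    also have "K \<le> 7 * t * (2 * (1 - r) / (9 / 10))" unfolding K_def using r1 t by (intro mult_left_mono divide_right_mono) auto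
    also have "\<dots> = 140 / 9 * (t * (1 - r))" by simp
    also have "\<dots> \<le> 16 * (t * (1 - r))" using t r by (intro mult_right_mono) auto
    finally show ?thesis by (simp add: r_def)
  qed
qed

text \<open>For s \<le> 1 it remains to bound s (2 - s) from below, by 3/4 if s \<ge> 1/2 and by s
  in general; for s > 1 the condition 16/45 \<le> k suffices because t \<le> 1/45. The first bound
  leaves a tenth of 1 - |z|, which forces support points of a far from E to lie near the circle; the
  second leaves the half that the test function retains.\<close>

lemma barrier_le_far:
  assumes z: "cmod z < 1"
  shows "1 / 2 \<le> infdist z E \<Longrightarrow> Re (barrier E t z) \<le> 9 / 10 * (1 - cmod z)"
    and "90 * t \<le> infdist z E \<Longrightarrow> Re (barrier E t z) \<le> 1 / 2 * (1 - cmod z)"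
proof -
  define s where "s = infdist z E"
  have *: "Re (barrier E t z) \<le> k * (1 - cmod z)" if far: "20 * t \<le> s" and k: "16 / 45 \<le> k" "s \<le> 1 \<Longrightarrow> 30 * t \<le> k * (s * (2 - s))" for k
  proof (cases "s \<le> 1")
    case True
    have s0: "0 < s" using far t by linarith
    then have Q: "0 < s * (2 - s)" using True by (intro mult_pos_pos) auto
    have "Re (barrier E t z) \<le> 30 * t * (1 - cmod z) / (s * (2 - s))"
      using barrier_le(1)[OF z] far True by (simp add: s_def)
    also have "\<dots> \<le> k * (s * (2 - s)) * (1 - cmod z) / (s * (2 - s))"
      using k(2)[OF True] Q z by (intro divide_right_mono mult_right_mono) auto
    also have "\<dots> = k * (1 - cmod z) * (s * (2 - s)) / (s * (2 - s))" by (simp only: mult_ac)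
    also have "\<dots> = k * (1 - cmod z)" by (rule nonzero_mult_div_cancel_right) (use Q in auto)
    finally show ?thesis .
  next
    case False
    then have "Re (barrier E t z) \<le> 16 * t * (1 - cmod z)" using barrier_le(2)[OF z] far by (simp add: s_def)
    also have "\<dots> \<le> k * (1 - cmod z)" using t k z by (intro mult_right_mono) auto
    finally show ?thesis .
  qed
  show "Re (barrier E t z) \<le> 9 / 10 * (1 - cmod z)" if "1 / 2 \<le> infdist z E"
  proof (rule *)
    assume s1: "s \<le> 1"
    have "0 \<le> (s - 1 / 2) * (3 / 2 - s)" using s1 that by (intro mult_nonneg_nonneg) (auto simp: s_def)
    moreover have "(s - 1 / 2) * (3 / 2 - s) = s * (2 - s) - 3 / 4" by (simp add: field_simps)
    ultimately have "3 / 4 \<le> s * (2 - s)" by linarith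
    then show "30 * t \<le> 9 / 10 * (s * (2 - s))" using t by linarith
  qed (use that t in \<open>auto simp: s_def\<close>)
  show "Re (barrier E t z) \<le> 1 / 2 * (1 - cmod z)" if "90 * t \<le> infdist z E"
  proof (rule *)
    assume s1: "s \<le> 1"
    have s0: "0 \<le> s" by (simp add: s_def infdist_nonneg)
    have "s * 1 \<le> s * (2 - s)" using s1 s0 by (intro mult_left_mono) auto
    moreover have "90 * t \<le> s" using that by (simp add: s_def)
    ultimately show "30 * t \<le> 1 / 2 * (s * (2 - s))" using t by linarith
  qed (use that t in \<open>auto simp: s_def\<close>)
qed

text \<open>For s = \<rho>(z, E) \<le> 1/2 one has |z| \<ge> 1/2, and (1 + |z|) / (8 \<pi>) \<ge>
  1/17. For larger s the window is taken relative to the projection, at distance d from E. There s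
  \<ge> sqrt(r) d, so passing from d to s costs a factor r^(-q/2), at most 5/4 by the condition on
  (4/5)^(2/q); since 17 * 1.9 / (8 \<pi>) exceeds 5/4, the same constant 17 covers it.\<close>

lemma trunc_dist_poisson_ge:
  assumes q: "0 < q" and z: "cmod z < 1" "z \<noteq> 0"
    and c: "(t \<le> infdist z E \<and> infdist z E \<le> 1 / 2) \<or>
      (1 / 2 \<le> infdist z E \<and> 9 / 10 \<le> cmod z \<and> (4 / 5) powr (2 / q) \<le> cmod z)"
  shows "infdist z E powr (- q) \<le> 17 * Re (herglotz (trunc_dist E q t) z)"
proof -
  define r where "r = cmod z"
  define s where "s = infdist z E"
  note cb = trunc_dist_bounds[OF E t(1) q] and cd = trunc_dist_def
  note cm [measurable] = measurable_trunc_dist[OF E]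
  note H = Re_herglotz_nn_integral[OF cm cb z(1)]
  have real: "x \<le> Re (herglotz (trunc_dist E q t) z)"
    if "0 \<le> x" "ennreal x \<le> (\<integral>\<^sup>+\<zeta>. ennreal (trunc_dist E q t \<zeta>) * ennreal (poisson z \<zeta>) \<partial>circle_measure)" for x
    using that H by (metis ennreal_le_iff)
  from c show ?thesis
  proof
    assume a: "t \<le> infdist z E \<and> infdist z E \<le> 1 / 2"
    obtain e where e: "e \<in> E" "infdist z E = dist z e" using infdist_attains_inf[OF E(2,3)] by blast
    have e1: "cmod e = 1" using E e by auto
    have s: "s = cmod (z - e)" "t \<le> s" "s \<le> 1 / 2" "0 < s" using e a t by (auto simp: s_def dist_norm)
    have "1 - r \<le> s" using norm_circle_diff_ge[OF e1, of z] by (simp add: s r_def norm_minus_commute)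
    then have r: "1 / 2 \<le> r" using s by simp
    have "s powr (- q) * ((1 + r) / (8 * pi)) \<le> Re (herglotz (trunc_dist E q t) z)"
    proof (rule real)
      show "ennreal (s powr (- q) * ((1 + r) / (8 * pi))) \<le> (\<integral>\<^sup>+\<zeta>. ennreal (trunc_dist E q t \<zeta>) * ennreal (poisson z \<zeta>) \<partial>circle_measure)"
        unfolding r_def
      proof (rule poisson_integral_window_ge[OF z e1, where y = s])
        fix \<zeta> assume "cmod \<zeta> = 1" "cmod (\<zeta> - e) \<le> s"
        then have "infdist \<zeta> E \<le> s" using infdist_le[OF e(1), of \<zeta>] by (simp add: dist_norm)
        then show "ennreal (s powr (- q)) \<le> ennreal (trunc_dist E q t \<zeta>)"
          unfolding cd using s t q by (intro ennreal_leI powr_mono2') auto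
      qed (use s in auto)
    qed (use r in auto)
    moreover have "1 / 17 \<le> (1 + r) / (8 * pi)" using r pi_approx(2) by (simp add: field_simps)
    then have "s powr (- q) * (1 / 17) \<le> s powr (- q) * ((1 + r) / (8 * pi))" by (intro mult_left_mono) auto
    ultimately show ?thesis by (simp add: s_def)
  next
    assume a: "1 / 2 \<le> infdist z E \<and> 9 / 10 \<le> cmod z \<and> (4 / 5) powr (2 / q) \<le> cmod z"
    define w where "w = sgn z"
    have w: "cmod w = 1" and zw: "z = of_real r * w" using z by (simp_all add: w_def norm_sgn r_def) (simp add: sgn_eq)
    have r: "9 / 10 \<le> r" "r < 1" "(4 / 5) powr (2 / q) \<le> r" using a z by (auto simp: r_def)
    obtain e where e: "e \<in> E" "infdist w E = dist w e" using infdist_attains_inf[OF E(2,3)] by blast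
    have e1: "cmod e = 1" using E e by auto
    define d where "d = cmod (w - e)"
    have dd: "infdist w E = d" using e by (simp add: d_def dist_norm)
    have "dist z w = 1 - r"
    proof -
      have "z - w = of_real (r - 1) * w" by (simp add: zw left_diff_distrib)
      then have "dist z w = \<bar>r - 1\<bar> * 1" by (simp only: dist_norm norm_mult norm_of_real w)
      then show ?thesis using r by simp
    qed
    \<comment> \<open>From s \<ge> 1/2 and 1 - r \<le> 1/10. It ensures both 1 - r \<le> d, as the
      window estimate demands, and t \<le> d.\<close>
    then have d: "4 / 10 \<le> d" using infdist_triangle[of z E w] dd a r by simp
    have sd: "sqrt r * d \<le> s"
    proof -
      obtain e' where e': "e' \<in> E" "infdist z E = dist z e'" using infdist_attains_inf[OF E(2,3)] by blast
      have "cmod e' = 1" using E e' by auto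
      from norm_scaled_diff_square[OF w this, of r]
      have "r * (cmod (w - e'))\<^sup>2 \<le> s\<^sup>2" using e' zw by (simp add: s_def dist_norm)
      moreover have "d \<le> cmod (w - e')" using infdist_le[OF e'(1), of w] dd by (simp add: dist_norm)
      then have "r * d\<^sup>2 \<le> r * (cmod (w - e'))\<^sup>2" using r d by (intro mult_left_mono power_mono) auto
      ultimately have "r * d\<^sup>2 \<le> s\<^sup>2" by linarith
      then have "(sqrt r * d)\<^sup>2 \<le> s\<^sup>2" using r by (simp add: power_mult_distrib)
      then show ?thesis by (rule power2_le_imp_le) (simp add: s_def infdist_nonneg)
    qed
    have "d powr (- q) * ((1 + r) / (8 * pi)) \<le> Re (herglotz (trunc_dist E q t) z)"
    proof (rule real)
      show "ennreal (d powr (- q) * ((1 + r) / (8 * pi))) \<le> (\<integral>\<^sup>+\<zeta>. ennreal (trunc_dist E q t \<zeta>) * ennreal (poisson z \<zeta>) \<partial>circle_measure)"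
        unfolding r_def
      proof (rule poisson_integral_window_ge[OF z e1, where y = d])
        fix \<zeta> assume "cmod \<zeta> = 1" "cmod (\<zeta> - e) \<le> d"
        then have "infdist \<zeta> E \<le> d" using infdist_le[OF e(1), of \<zeta>] by (simp add: dist_norm)
        then show "ennreal (d powr (- q)) \<le> ennreal (trunc_dist E q t \<zeta>)"
          unfolding cd using d t q by (intro ennreal_leI powr_mono2') auto
      qed (use d r in \<open>auto simp: d_def w_def r_def\<close>)
    qed (use r in auto)
    moreover have "s powr (- q) \<le> d powr (- q) * (5 / 4)"
    proof -
      have "s powr (- q) \<le> (sqrt r * d) powr (- q)" using sd r d q by (intro powr_mono2') auto
      also have "\<dots> = (sqrt r) powr (- q) * d powr (- q)" using r d by (simp add: powr_mult)
      also have "(sqrt r) powr (- q) = r powr (- (q / 2))" using r by (simp add: powr_half_sqrt[symmetric] powr_powr)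
      also have "r powr (- (q / 2)) \<le> ((4 / 5) powr (2 / q)) powr (- (q / 2))" using r q by (intro powr_mono2') auto
      also have "((4 / 5) powr (2 / q)) powr (- (q / 2)) = (4 / 5 :: real) powr (- 1)" using q by (simp add: powr_powr)
      also have "\<dots> = 5 / 4" by (simp add: powr_minus)
      finally show ?thesis by (simp add: mult.commute mult_right_mono)
    qed
    moreover have "5 / 4 \<le> 17 * ((1 + r) / (8 * pi))" using r pi_approx(2) by (simp add: field_simps)
    then have "d powr (- q) * (5 / 4) \<le> d powr (- q) * (17 * ((1 + r) / (8 * pi)))" by (intro mult_left_mono) auto
    moreover have "d powr (- q) * (17 * ((1 + r) / (8 * pi))) = 17 * (d powr (- q) * ((1 + r) / (8 * pi)))" by simp
    ultimately show ?thesis unfolding s_def[symmetric] by linarith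
  qed
qed

end

subsection \<open>Proof of the theorem\<close>

text \<open>The test functions dominate h only up to 2e; Fatou's lemma along e = e0 / (n + 1)
  removes the error.\<close>

lemma nn_integral_le_shift:
  fixes h :: "'a \<Rightarrow> real"
  assumes [measurable]: "h \<in> borel_measurable M" and e0: "0 < e0"
    and le: "\<And>e. 0 < e \<Longrightarrow> e \<le> e0 \<Longrightarrow> (\<integral>\<^sup>+z. ennreal (h z - 2 * e) \<partial>M) \<le> B"
  shows "(\<integral>\<^sup>+z. ennreal (h z) \<partial>M) \<le> B"
proof -
  define e where "e n = e0 * inverse (real (Suc n))" for n
  have e: "0 < e n" "e n \<le> e0" for n
    using e0 by (auto simp: e_def field_simps)
  have "e \<longlonglongrightarrow> e0 * 0" unfolding e_def by (intro tendsto_intros LIMSEQ_inverse_real_of_nat)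
  then have "(\<lambda>n. ennreal (h z - 2 * e n)) \<longlonglongrightarrow> ennreal (h z - 2 * (e0 * 0))" for z
    by (intro tendsto_ennrealI tendsto_intros)
  then have lim: "liminf (\<lambda>n. ennreal (h z - 2 * e n)) = ennreal (h z)" for z
    using lim_imp_Liminf[of sequentially] by fastforce
  have "(\<integral>\<^sup>+z. ennreal (h z) \<partial>M) = (\<integral>\<^sup>+z. liminf (\<lambda>n. ennreal (h z - 2 * e n)) \<partial>M)"
    by (simp only: lim)
  also have "\<dots> \<le> liminf (\<lambda>n. \<integral>\<^sup>+z. ennreal (h z - 2 * e n) \<partial>M)"
    by (rule nn_integral_liminf) simp
  also have "\<dots> \<le> limsup (\<lambda>n. \<integral>\<^sup>+z. ennreal (h z - 2 * e n) \<partial>M)"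
    by (rule Liminf_le_Limsup) simp
  also have "\<dots> \<le> B"
    by (rule Limsup_bounded) (use le e in \<open>auto intro: always_eventually\<close>)
  finally show ?thesis .
qed

text \<open>A lower bound, up to the smoothing error, for the test function with barrier at level t.
  Its integral in t against a power weight rebuilds a power of the distance to E.\<close>

definition far_weight :: "complex set \<Rightarrow> real \<Rightarrow> complex \<Rightarrow> real" where
  "far_weight E t z = (if 90 * t \<le> infdist z E then 1 / 2 * (1 - cmod z) else 0)"

context
  fixes E :: "complex set" and q :: real and v :: "complex \<Rightarrow> ereal" and M :: "complex measure"
  assumes E: "E \<subseteq> sphere 0 1" "closed E" "E \<noteq> {}" and q: "q > 0"
    and sub: "subharmonic_on v (ball 0 1)" and ne: "\<exists>z\<in>ball 0 1. v z \<noteq> -\<infinity>"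
    and riesz: "riesz_measure_on (ball 0 1) v M"
    and bound: "\<forall>z\<in>ball 0 1. v z \<le> ereal (1 / infdist z E powr q)"
begin

lemma infdist_ge: "1 - cmod z \<le> infdist z E"
proof -
  obtain e where e: "e \<in> E" "infdist z E = dist z e" using infdist_attains_inf[OF E(2,3)] by blast
  then have "cmod e = 1" using E by auto
  then show ?thesis using e norm_circle_diff_ge[of e z] by (simp add: dist_norm norm_minus_commute)
qed

lemma v_le: "z \<in> ball 0 1 \<Longrightarrow> v z \<le> ereal (infdist z E powr (- q))"
  using bound by (simp add: powr_minus_divide)

lemma v_bdd: "R < 1 \<Longrightarrow> \<exists>C\<ge>0. \<forall>z\<in>cball 0 R. v z \<le> ereal C"
proof (intro exI[of _ "(1 - R) powr (- q)"] conjI ballI)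
  fix z :: complex assume R: "R < 1" and z: "z \<in> cball 0 R"
  then have "v z \<le> ereal (infdist z E powr (- q))" by (intro v_le) auto
  also have "infdist z E powr (- q) \<le> (1 - R) powr (- q)"
    using infdist_ge[of z] z R q by (intro powr_mono2') auto
  finally show "v z \<le> ereal ((1 - R) powr (- q))" by simp
qed simp

lemma space_M: "space M = ball 0 1" and sets_M: "sets M = sets (restrict_space borel (ball 0 1))"
proof -
  show s: "sets M = sets (restrict_space borel (ball 0 1))" using riesz by (simp add: riesz_measure_on_def)
  show "space M = ball 0 1" using sets_eq_imp_space_eq[OF s] by simp
qed

lemma measurable_M: "f \<in> borel_measurable borel \<Longrightarrow> f \<in> borel_measurable M"
  unfolding measurable_cong_sets[OF sets_M refl] by (rule measurable_restrict_space1)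

text \<open>Exhausting the disk by closed disks of finite mass makes Fubini's theorem available for
  the Riesz measure and the level t.\<close>

lemma sigma_finite_M: "sigma_finite_measure M"
proof
  let ?A = "range (\<lambda>n. cball (0::complex) (1 - inverse (real (Suc n))))"
  have sub: "cball (0::complex) (1 - inverse (real (Suc n))) \<subseteq> ball 0 1" for n
  proof
    fix z :: complex assume "z \<in> cball 0 (1 - inverse (real (Suc n)))"
    moreover have "0 < inverse (real (Suc n))" by simp
    ultimately show "z \<in> ball 0 1" unfolding mem_cball_0 mem_ball_0 by linarith
  qed
  have "(\<Union>?A) = space M"
  proof
    show "(\<Union>?A) \<subseteq> space M" using sub by (auto simp: space_M)
    show "space M \<subseteq> (\<Union>?A)"
    proof
      fix z assume "z \<in> space M"
      then have "0 < 1 - cmod z" by (simp add: space_M)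
      from reals_Archimedean[OF this] obtain n where "inverse (real (Suc n)) < 1 - cmod z" by blast
      then have "z \<in> cball 0 (1 - inverse (real (Suc n)))" unfolding mem_cball_0 by linarith
      then show "z \<in> (\<Union>?A)" by blast
    qed
  qed
  moreover have "?A \<subseteq> sets M"
  proof
    fix A assume "A \<in> ?A"
    then obtain n where A: "A = cball 0 (1 - inverse (real (Suc n)))" by blast
    have "A = ball 0 1 \<inter> A" using sub[of n] A by blast
    moreover have "A \<in> sets borel" using A by simp
    ultimately show "A \<in> sets M" unfolding sets_M sets_restrict_space by blast
  qed
  moreover have "\<forall>a\<in>?A. emeasure M a \<noteq> \<infinity>"
    using riesz sub by (auto simp: riesz_measure_on_def less_top[symmetric])
  ultimately show "\<exists>A. countable A \<and> A \<subseteq> sets M \<and> \<Union>A = space M \<and> (\<forall>a\<in>A. emeasure M a \<noteq> \<infinity>)"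
    by (intro exI[of _ ?A]) auto
qed

text \<open>With no barrier a is radial, so the majorant, which depends only on the direction of z,
  may be replaced by its mean over the circle. Testing with the harmonic function 1 shows that a has
  mass at most 2 \<pi>. The factor 2^q comes from \<rho>(sgn z, E) \<le> 2 \<rho>(z, E); its product
  with 2^(-q) is the summand 1.\<close>

lemma part_i:
  assumes I: "I_int q E = ennreal i" "0 \<le> i"
  shows "(\<integral>\<^sup>+w. ennreal (1 - cmod w) \<partial>M) \<le> ennreal (1 + q * 2 powr q * i - core_mass v)"
proof (rule nn_integral_le_shift)
  show "(\<lambda>w. 1 - cmod w) \<in> borel_measurable M" by (rule measurable_M) simp
  show "(0::real) < 1" by simp
  fix e :: real assume e: "0 < e" "e \<le> 1"
  show "(\<integral>\<^sup>+w. ennreal (1 - cmod w - 2 * e) \<partial>M) \<le> ennreal (1 + q * 2 powr q * i - core_mass v)"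
  proof (rule Green_test_function[of "\<lambda>_. 0" e])
    show "(\<lambda>_. 0) holomorphic_on ball 0 1" by simp
  next
    fix \<phi> a
    assume \<phi>: "test_function (ball 0 1) \<phi>" "\<And>z. 0 \<le> \<phi> z"
      "\<And>z. z \<in> ball 0 1 \<Longrightarrow> trunc_log z - Re 0 - 2 * e \<le> \<phi> z"
      "\<And>z. laplacian \<phi> z = a z - core_density z"
    assume a: "\<And>z. 0 \<le> a z" "a \<in> borel_measurable borel" "\<exists>C. \<forall>z. a z \<le> C"
    assume supp: "\<And>z. a z \<noteq> 0 \<Longrightarrow> exp (- 5) < cmod z \<and> cmod z \<le> exp (- e) \<and> - ln (cmod z) - Re 0 \<le> 2 * e
        \<and> 0 < - ln (cmod z) - Re 0"
    assume "\<And>z. (\<lambda>_::complex. 0::complex) = (\<lambda>_. 0) \<Longrightarrow> a z = a (of_real (cmod z))"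
    then have rad: "\<And>z. a z = a (of_real (cmod z))" by simp
    define R where "R = exp (- e)"
    have R: "R < 1" using e by (simp add: R_def)
    \<comment> \<open>On the support of a one has \<rho> \<ge> 1 - |z| \<ge> 1 - R = t / 2, so
      truncating at t stays within the same factor 2.\<close>
    define t where "t = 2 * (1 - R)"
    have t: "0 < t" "t \<le> 2" using R by (auto simp: t_def R_def)
    note [measurable] = measurable_trunc_dist[OF E] a(2)
    define W where "W z = ennreal (2 powr q) * ennreal (trunc_dist E q t (sgn z))" for z
    have sgn_meas [measurable]: "(sgn :: complex \<Rightarrow> complex) \<in> borel_measurable borel" by measurable
    have [measurable]: "W \<in> borel_measurable borel" unfolding W_def by measurable
    let ?J = "\<integral>\<^sup>+\<zeta>. ennreal (trunc_dist E q t \<zeta>) \<partial>circle_measure"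
    have "?J \<le> ennreal (2 powr (- q)) + ennreal q * I_int q E"
      by (rule nn_integral_trunc_dist_le_I_int[OF E t q])
    then have J: "ennreal (2 powr q) * ?J \<le> ennreal (1 + q * 2 powr q * i)"
    proof -
      assume "?J \<le> ennreal (2 powr (- q)) + ennreal q * I_int q E"
      then have "ennreal (2 powr q) * ?J \<le> ennreal (2 powr q) * (ennreal (2 powr (- q)) + ennreal q * ennreal i)"
        unfolding I by (intro mult_left_mono) auto
      also have "\<dots> = ennreal (2 powr q * (2 powr (- q) + q * i))"
        using q I by (simp add: ennreal_mult' ennreal_plus)
      also have "2 powr q * (2 powr (- q) + q * i) = 1 + q * 2 powr q * i"
        by (simp add: distrib_left powr_minus)
      finally show ?thesis .
    qed
    have a_int: "(\<integral>\<^sup>+z. ennreal (a z) \<partial>lborel) \<le> ennreal (2 * pi)"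
    proof -
      have "(\<integral>\<^sup>+z. ennreal (indicator (ball 0 1) z * Re 1) * ennreal (a z) \<partial>lborel) \<le> ennreal (2 * pi * 1)"
        by (rule harmonic_majorant[OF \<phi>(1,4) a, of R "\<lambda>_. 1" 1]) (use supp R in \<open>auto simp: R_def\<close>)
      moreover have "(\<integral>\<^sup>+z. ennreal (indicator (ball 0 1) z * Re 1) * ennreal (a z) \<partial>lborel) = (\<integral>\<^sup>+z. ennreal (a z) \<partial>lborel)"
      proof (rule nn_integral_cong)
        fix z
        show "ennreal (indicator (ball 0 1) z * Re 1) * ennreal (a z) = ennreal (a z)"
        proof (cases "a z = 0")
          case False
          then have "z \<in> ball 0 1" using supp[OF False] R unfolding R_def mem_ball_0 by linarith
          then show ?thesis by simp
        qed simp
      qed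
      ultimately show ?thesis by simp
    qed
    have "(\<integral>\<^sup>+z. ennreal (\<phi> z) \<partial>M) \<le> ennreal ((1 + q * 2 powr q * i) - core_mass v)"
    proof (rule riesz_upper[OF sub v_bdd ne riesz \<phi>(1,2,4) a _ R])
      fix z assume az: "a z \<noteq> 0"
      show "cmod z \<le> R" using supp[OF az] by (simp add: R_def)
      then have zD: "z \<in> ball 0 1" using R by simp
      have z0: "z \<noteq> 0" using supp[OF az] exp_gt_zero[of "- 5 :: real"] by (metis norm_zero less_asym)
      define s where "s = infdist z E"
      have s: "1 - cmod z \<le> s" "t \<le> 2 * s" "0 < s"
        using infdist_ge[of z] \<open>cmod z \<le> R\<close> R by (auto simp: s_def t_def)
      have "dist (sgn z) z = 1 - cmod z"
      proof -
        have "of_real (cmod z) * sgn z = z" using z0 by (simp add: sgn_eq)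
        then have "sgn z - z = of_real (1 - cmod z) * sgn z" by (simp add: left_diff_distrib)
        then have "dist (sgn z) z = \<bar>1 - cmod z\<bar> * cmod (sgn z)" by (simp only: dist_norm norm_mult norm_of_real)
        then show ?thesis using z0 zD by (simp add: norm_sgn)
      qed
      then have "infdist (sgn z) E \<le> 2 * s" using infdist_triangle[of "sgn z" E z] s by (simp add: s_def)
      then have m: "max (infdist (sgn z) E) t \<le> 2 * s" using s by simp
      have "s powr (- q) = 2 powr q * (2 * s) powr (- q)"
        using s by (simp add: powr_mult powr_minus)
      also have "\<dots> \<le> 2 powr q * trunc_dist E q t (sgn z)"
        unfolding trunc_dist_def using m t q by (intro mult_left_mono powr_mono2') auto
      finally have "ennreal (s powr (- q)) \<le> W z"
        unfolding W_def by (subst ennreal_mult'[symmetric]) (auto intro: ennreal_leI)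
      moreover have "e2ennreal (v z) \<le> ennreal (s powr (- q))"
        using e2ennreal_mono[OF v_le[OF zD]] by (simp add: s_def)
      ultimately show "e2ennreal (v z) \<le> W z" by simp
    next
      have "(\<integral>\<^sup>+z. W z * ennreal (a z) \<partial>lborel) = (\<integral>\<^sup>+z. ennreal (a z) * W z \<partial>lborel)" by (simp only: mult.commute)
      also have "\<dots> = (\<integral>\<^sup>+z. ennreal (a z) * (\<integral>\<^sup>+\<zeta>. W (of_real (cmod z) * \<zeta>) \<partial>circle_measure) \<partial>lborel)"
        by (rule nn_integral_radial_average) (auto simp: rad[symmetric])
      also have "\<dots> = (\<integral>\<^sup>+z. (ennreal (2 powr q) * ?J) * ennreal (a z) \<partial>lborel)"
      proof (rule nn_integral_cong)
        fix z
        show "ennreal (a z) * (\<integral>\<^sup>+\<zeta>. W (of_real (cmod z) * \<zeta>) \<partial>circle_measure) = (ennreal (2 powr q) * ?J) * ennreal (a z)"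
        proof (cases "a z = 0")
          case False
          then have z0: "cmod z > 0" using supp[OF False] exp_gt_zero[of "- 5 :: real"] by linarith
          have "(\<integral>\<^sup>+\<zeta>. W (of_real (cmod z) * \<zeta>) \<partial>circle_measure) = (\<integral>\<^sup>+\<zeta>. ennreal (2 powr q) * ennreal (trunc_dist E q t \<zeta>) \<partial>circle_measure)"
          proof (rule nn_integral_cong_AE, use AE_circle_measure in eventually_elim)
            fix \<zeta> :: complex assume "cmod \<zeta> = 1"
            then have "sgn (of_real (cmod z) * \<zeta>) = \<zeta>" using z0 by (simp add: sgn_eq norm_mult)
            then show "W (of_real (cmod z) * \<zeta>) = ennreal (2 powr q) * ennreal (trunc_dist E q t \<zeta>)" by (simp add: W_def)
          qed
          also have "\<dots> = ennreal (2 powr q) * ?J" by (rule nn_integral_cmult) measurable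
          finally show ?thesis by (simp add: mult.commute)
        qed simp
      qed
      also have "\<dots> = (ennreal (2 powr q) * ?J) * (\<integral>\<^sup>+z. ennreal (a z) \<partial>lborel)"
        by (rule nn_integral_cmult) measurable
      also have "\<dots> \<le> ennreal (1 + q * 2 powr q * i) * ennreal (2 * pi)"
        by (rule mult_mono[OF J a_int]) auto
      also have "\<dots> = ennreal (2 * pi * (1 + q * 2 powr q * i))"
        using q I by (subst ennreal_mult[symmetric]) (auto simp: mult.commute)
      finally show "(\<integral>\<^sup>+z. W z * ennreal (a z) \<partial>lborel) \<le> ennreal (2 * pi * (1 + q * 2 powr q * i))" .
      show "0 \<le> 1 + q * 2 powr q * i" using q I by simp
    qed
    moreover have "(\<integral>\<^sup>+w. ennreal (1 - cmod w - 2 * e) \<partial>M) \<le> (\<integral>\<^sup>+w. ennreal (\<phi> w) \<partial>M)"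
    proof (rule nn_integral_mono, rule ennreal_leI)
      fix w assume "w \<in> space M"
      then have w: "w \<in> ball 0 1" by (simp add: space_M)
      then show "1 - cmod w - 2 * e \<le> \<phi> w" using \<phi>(3)[OF w] trunc_log_ge[of w] by simp
    qed
    ultimately show "(\<integral>\<^sup>+w. ennreal (1 - cmod w - 2 * e) \<partial>M) \<le> ennreal (1 + q * 2 powr q * i - core_mass v)"
      by (rule order_trans[rotated])
  qed (use e in auto)
qed

section \<open>Mass away from E at a fixed level, and integration over the levels\<close>

lemma exp_minus_5_le: "exp (- 5 :: real) \<le> 1 / 100"
proof -
  have e5: "exp (1 :: real) ^ 5 = exp 5" using exp_of_nat_mult[of 5 "1::real"] by simp
  have "exp (1::real) \<ge> 27 / 10" using e_approx_32 by (simp add: abs_if split: if_splits)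
  then have "(27 / 10) ^ 5 \<le> exp (1 :: real) ^ 5" by (intro power_mono) auto
  then have "100 \<le> exp (5 :: real)" unfolding e5 by (simp add: power_numeral_reduce)
  then show ?thesis by (simp add: exp_minus field_simps)
qed

lemma measurable_far_weight: "case_prod (far_weight E) \<in> borel_measurable borel"
proof -
  note [measurable] = measurable_infdist_E[OF E]
  show ?thesis unfolding far_weight_def case_prod_beta borel_prod[symmetric] by measurable
qed

text \<open>The majorant of v is 17 times the Poisson integral of the truncated power. In the core,
  where |z| \<le> 1/100, Harnack's inequality bounds that integral by 101/99 times the mean over the
  circle, and 1717/99 = 17 * 101/99.\<close>

lemma far_part_le:
  assumes t: "0 < t" "t \<le> 1 / 45"
  shows "(\<integral>\<^sup>+w. ennreal (far_weight E t w) \<partial>M)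
    \<le> ennreal (1717 / 99) * (\<integral>\<^sup>+\<zeta>. ennreal (trunc_dist E q t \<zeta>) \<partial>circle_measure) + ennreal (max 0 (- core_mass v))"
proof -
  note [measurable] = measurable_trunc_dist[OF E]
  note cb = trunc_dist_bounds[OF E t(1) q]
  let ?J = "\<integral>\<^sup>+\<zeta>. ennreal (trunc_dist E q t \<zeta>) \<partial>circle_measure"
  have "?J \<le> (\<integral>\<^sup>+\<zeta>. ennreal (t powr (- q)) \<partial>circle_measure)" by (intro nn_integral_mono ennreal_leI cb)
  also have "\<dots> < \<infinity>" by (simp add: emeasure_circle_measure_UNIV)
  finally obtain j where j: "?J = ennreal j" "0 \<le> j" by (cases ?J) auto
  define X where "X = 1717 / 99 * j"
  have X0: "0 \<le> X" using j by (simp add: X_def)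
  \<comment> \<open>A support point with \<rho> \<ge> 1/2 satisfies 1 - |z| \<le> - ln |z| \<le>
    9/10 (1 - |z|) + 2e, hence 1 - |z| \<le> 20e. The choice of \<open>e0\<close> then gives |z|
    \<ge> 9/10 and |z| \<ge> (4/5)^(2/q).\<close>
  define e0 where "e0 = min (1 / 200) ((1 - (4 / 5) powr (2 / q)) / 20)"
  have "(4 / 5) powr (2 / q) < (1::real)" using q powr_less_mono2[of "2 / q" "4 / 5" 1] by simp
  then have e0: "0 < e0" by (simp add: e0_def)
  have u1: "Re (barrier E t z) \<le> 1" if "cmod z \<le> exp (- 5)" for z
  proof -
    have z: "cmod z \<le> 1 / 100" using that exp_minus_5_le by linarith
    then have "1 / 2 \<le> infdist z E" using infdist_ge[of z] by simp
    from barrier_le_far(1)[OF E t _ this] have "Re (barrier E t z) \<le> 9 / 10 * (1 - cmod z)" using z by simp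
    also have "\<dots> \<le> 9 / 10 * 1" by (intro mult_left_mono) auto
    also have "\<dots> \<le> 1" by simp
    finally show ?thesis .
  qed
  let ?H = "herglotz (trunc_dist E q t)"
  have hol: "?H holomorphic_on ball 0 1"
    by (rule holomorphic_herglotz[where C = "t powr (- q)"]) (use cb in auto)
  note H = Re_herglotz_nn_integral[OF measurable_trunc_dist[OF E] cb]
  have "(\<integral>\<^sup>+w. ennreal (far_weight E t w) \<partial>M) \<le> ennreal (X - core_mass v)"
  proof (rule nn_integral_le_shift[OF _ e0])
    have "far_weight E t \<in> borel_measurable borel"
      using measurable_Pair2[of "case_prod (far_weight E)" borel borel borel t] measurable_far_weight by (simp add: borel_prod)
    then show "far_weight E t \<in> borel_measurable M" by (rule measurable_M)
    fix e assume e: "0 < e" "e \<le> e0"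
    have e1: "e \<le> 1" "20 * e \<le> 1 / 10" "20 * e \<le> 1 - (4 / 5) powr (2 / q)" using e by (auto simp: e0_def)
    obtain \<phi> a where \<phi>: "test_function (ball 0 1) \<phi>" "\<And>z. 0 \<le> \<phi> z"
      "\<And>z. z \<in> ball 0 1 \<Longrightarrow> trunc_log z - Re (barrier E t z) - 2 * e \<le> \<phi> z"
      "\<And>z. laplacian \<phi> z = a z - core_density z"
      and a: "\<And>z. 0 \<le> a z" "a \<in> borel_measurable borel" "\<exists>C. \<forall>z. a z \<le> C"
      and supp: "\<And>z. a z \<noteq> 0 \<Longrightarrow> exp (- 5) < cmod z \<and> cmod z \<le> exp (- e) \<and> - ln (cmod z) - Re (barrier E t z) \<le> 2 * e
          \<and> 0 < - ln (cmod z) - Re (barrier E t z)"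
      by (rule Green_test_function[OF barrier_holomorphic[OF E t] _ u1 e(1) e1(1)])
        (use barrier_nonneg[OF E t] in \<open>auto intro: that\<close>)
    define R where "R = exp (- e)"
    have R: "R < 1" using e by (simp add: R_def)
    have "(\<integral>\<^sup>+z. ennreal (\<phi> z) \<partial>M) \<le> ennreal (X - core_mass v)"
    proof (rule riesz_upper[OF sub v_bdd ne riesz \<phi>(1,2,4) a _ R])
      fix z assume az: "a z \<noteq> 0"
      show "cmod z \<le> R" using supp[OF az] by (simp add: R_def)
      then have z1: "cmod z < 1" using R by simp
      then have zD: "z \<in> ball 0 1" by simp
      have z0: "z \<noteq> 0" using supp[OF az] exp_gt_zero[of "- 5 :: real"] by (metis norm_zero less_asym)
      have far: "t < infdist z E"
        \<comment> \<open>On the support of a the logarithm strictly exceeds the barrier, which is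
          impossible within t of E; there the truncated power would not dominate v.\<close>
        using barrier_ge_ln[OF E t z1] supp[OF az] by (meson not_le diff_gt_0_iff_gt)
      have "infdist z E powr (- q) \<le> 17 * Re (?H z)"
      proof (rule trunc_dist_poisson_ge[OF E t q z1 z0])
        show "(t \<le> infdist z E \<and> infdist z E \<le> 1 / 2) \<or>
          (1 / 2 \<le> infdist z E \<and> 9 / 10 \<le> cmod z \<and> (4 / 5) powr (2 / q) \<le> cmod z)"
        proof (cases "infdist z E \<le> 1 / 2")
          case False
          then have "Re (barrier E t z) \<le> 9 / 10 * (1 - cmod z)" by (intro barrier_le_far(1)[OF E t z1]) simp
          moreover have "1 - cmod z \<le> - ln (cmod z)" using ln_le_minus_one[of "cmod z"] z0 by simp
          ultimately have "1 - cmod z \<le> 20 * e" using supp[OF az] by argo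
          then show ?thesis using False e1 by auto
        qed (use far in simp)
      qed
      then have "ennreal (infdist z E powr (- q)) \<le> ennreal (indicator (ball 0 1) z * Re (17 * ?H z))"
        using zD by (intro ennreal_leI) simp
      moreover have "e2ennreal (v z) \<le> ennreal (infdist z E powr (- q))"
        using e2ennreal_mono[OF v_le[OF zD]] by simp
      ultimately show "e2ennreal (v z) \<le> ennreal (indicator (ball 0 1) z * Re (17 * ?H z))" by simp
    next
      show "(\<integral>\<^sup>+z. ennreal (indicator (ball 0 1) z * Re (17 * ?H z)) * ennreal (a z) \<partial>lborel) \<le> ennreal (2 * pi * X)"
      proof (rule harmonic_majorant[OF \<phi>(1,4) a _ R])
        show "cmod z \<le> R" if "a z \<noteq> 0" for z using supp[OF that] by (simp add: R_def)
        show "(\<lambda>z. 17 * ?H z) holomorphic_on ball 0 1" by (intro holomorphic_intros hol)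
        show "0 \<le> Re (17 * ?H z)" if "z \<in> ball 0 1" for z using H(1)[of z] that by simp
        fix z :: complex assume "cmod z \<le> exp (- 5)"
        then have z: "cmod z \<le> 1 / 100" using exp_minus_5_le by linarith
        then have z1: "cmod z < 1" by simp
        have "ennreal (Re (?H z)) \<le> (\<integral>\<^sup>+\<zeta>. ennreal (101 / 99) * ennreal (trunc_dist E q t \<zeta>) \<partial>circle_measure)"
          unfolding H(2)[OF z1]
        proof (rule nn_integral_mono_AE, use AE_circle_measure in eventually_elim)
          fix \<zeta> :: complex assume "cmod \<zeta> = 1"
          then have "poisson z \<zeta> \<le> (1 + cmod z) / (1 - cmod z)" by (rule poisson_le_Harnack[OF z1])
          also have "\<dots> \<le> 101 / 99" using z by (simp add: field_simps)
          finally show "ennreal (trunc_dist E q t \<zeta>) * ennreal (poisson z \<zeta>) \<le> ennreal (101 / 99) * ennreal (trunc_dist E q t \<zeta>)"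
            by (subst mult.commute) (intro mult_right_mono ennreal_leI, auto)
        qed
        also have "\<dots> = ennreal (101 / 99) * ?J" by (rule nn_integral_cmult) measurable
        also have "\<dots> = ennreal (101 / 99 * j)" unfolding j(1) by (rule ennreal_mult'[symmetric]) simp
        finally have "Re (?H z) \<le> 101 / 99 * j" using j by simp
        then show "Re (17 * ?H z) \<le> X" by (simp add: X_def)
      qed (rule X0)
      show "0 \<le> X" by (rule X0)
    qed
    moreover have "(\<integral>\<^sup>+w. ennreal (far_weight E t w - 2 * e) \<partial>M) \<le> (\<integral>\<^sup>+w. ennreal (\<phi> w) \<partial>M)"
    proof (rule nn_integral_mono, rule ennreal_leI)
      fix w assume "w \<in> space M"
      then have w: "w \<in> ball 0 1" by (simp add: space_M)
      show "far_weight E t w - 2 * e \<le> \<phi> w"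
      proof (cases "90 * t \<le> infdist w E")
        case True
        then have "Re (barrier E t w) \<le> 1 / 2 * (1 - cmod w)" using w by (intro barrier_le_far(2)[OF E t]) auto
        moreover have "1 - cmod w \<le> trunc_log w" using w by (intro trunc_log_ge) simp
        moreover have "far_weight E t w = 1 / 2 * (1 - cmod w)" using True by (simp add: far_weight_def)
        ultimately show ?thesis using \<phi>(3)[OF w] by argo
      qed (use \<phi>(2)[of w] e in \<open>simp add: far_weight_def\<close>)
    qed
    ultimately show "(\<integral>\<^sup>+w. ennreal (far_weight E t w - 2 * e) \<partial>M) \<le> ennreal (X - core_mass v)"
      by (rule order_trans[rotated])
  qed
  \<comment> \<open>The difference is weakened to a sum of nonnegative terms, which integrates over
    t in [0, \<infinity>] term by term.\<close>
  also have "\<dots> \<le> ennreal (X + max 0 (- core_mass v))" by (intro ennreal_leI) simp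
  also have "\<dots> = ennreal (1717 / 99) * ?J + ennreal (max 0 (- core_mass v))"
  proof -
    have "ennreal (1717 / 99) * ennreal j = ennreal X" unfolding X_def by (rule ennreal_mult'[symmetric]) simp
    then show ?thesis using j X0 by (simp only: ennreal_plus max.cobounded1)
  qed
  finally show ?thesis .
qed

text \<open>With s = \<rho>(w, E) the far weight is 1/2 (1 - |w|) exactly for t \<le> s / 90, so
  integrating it against \<gamma> t^(\<gamma> - 1), \<gamma> = q - \<alpha>, gives (s /
  90)^\<gamma>; since s \<le> 2, the range t \<le> 1/45 loses nothing. On the other side 90^\<gamma>
  (1/45)^\<gamma> = 2^\<gamma> converts 2^(-q) into 2^(-\<alpha>), and undoing the factor 1/2
  doubles 1717/99.\<close>

lemma part_ii:
  assumes \<alpha>: "\<alpha> < q"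
  shows "(\<integral>\<^sup>+w. ennreal ((1 - cmod w) * infdist w E powr (q - \<alpha>)) \<partial>M)
    \<le> ennreal (3434 / 99) * (ennreal (2 powr (- \<alpha>)) + ennreal (q * 90 powr (q - \<alpha>)) * I_int \<alpha> E)
      + ennreal (2 * 2 powr (q - \<alpha>) * max 0 (- core_mass v))"
proof -
  define \<gamma> where "\<gamma> = q - \<alpha>"
  have \<gamma>: "0 < \<gamma>" using \<alpha> by (simp add: \<gamma>_def)
  define K where "K = max 0 (- core_mass v)"
  define g where "g t = ennreal (\<gamma> * t powr (\<gamma> - 1)) * indicator {0<..1 / 45} t" for t :: real
  have [measurable]: "g \<in> borel_measurable borel" unfolding g_def by measurable
  interpret M: sigma_finite_measure M by (rule sigma_finite_M)
  interpret P: pair_sigma_finite M "lborel :: real measure" ..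
  have fw: "(\<lambda>(w, t). far_weight E t w) \<in> borel_measurable (M \<Otimes>\<^sub>M lborel)"
  proof -
    have "(\<lambda>x. x) \<in> measurable M borel" by (rule measurable_M) simp
    then have [measurable]: "fst \<in> measurable (M \<Otimes>\<^sub>M lborel) borel"
      using measurable_compose[OF measurable_fst] by fastforce
    have "(\<lambda>p. (snd p, fst p)) \<in> measurable (M \<Otimes>\<^sub>M lborel) (borel \<Otimes>\<^sub>M borel)"
      by measurable
    from measurable_compose[OF this, of "case_prod (far_weight E)" borel] measurable_far_weight
    show ?thesis by (simp add: borel_prod case_prod_beta)
  qed
  have fw1: "far_weight E t \<in> borel_measurable M" for t
  proof -
    have "far_weight E t \<in> borel_measurable borel"
      using measurable_Pair2[of "case_prod (far_weight E)" borel borel borel t] measurable_far_weight by (simp add: borel_prod)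
    then show ?thesis by (rule measurable_M)
  qed
  have "(\<integral>\<^sup>+w. ennreal ((1 - cmod w) * infdist w E powr \<gamma>) \<partial>M)
      = (\<integral>\<^sup>+w. ennreal (2 * 90 powr \<gamma>) * (\<integral>\<^sup>+t. g t * ennreal (far_weight E t w) \<partial>lborel) \<partial>M)"
  proof (rule nn_integral_cong)
    fix w assume "w \<in> space M"
    then have w: "cmod w < 1" by (simp add: space_M)
    define s where "s = infdist w E"
    have s: "0 < s" "s \<le> 2" using infdist_ge[of w] w infdist_le_2[OF E, of w] by (auto simp: s_def)
    have "(\<integral>\<^sup>+t. g t * ennreal (far_weight E t w) \<partial>lborel)
        = (\<integral>\<^sup>+t. ennreal (1 / 2 * (1 - cmod w)) * (ennreal (\<gamma> * t powr (\<gamma> - 1)) * indicator {0<..s / 90} t) \<partial>lborel)"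
      by (rule nn_integral_cong) (use s in \<open>auto simp: g_def far_weight_def s_def[symmetric] indicator_def mult.commute\<close>)
    also have "\<dots> = ennreal (1 / 2 * (1 - cmod w)) * (\<integral>\<^sup>+t. ennreal (\<gamma> * t powr (\<gamma> - 1)) * indicator {0<..s / 90} t \<partial>lborel)"
      by (rule nn_integral_cmult) measurable
    also have "(\<integral>\<^sup>+t. ennreal (\<gamma> * t powr (\<gamma> - 1)) * indicator {0<..s / 90} t \<partial>lborel) = ennreal ((s / 90) powr \<gamma>)"
      by (rule nn_integral_powr_Ioc[OF E \<gamma>]) (use s in auto)
    also have "ennreal (1 / 2 * (1 - cmod w)) * ennreal ((s / 90) powr \<gamma>) = ennreal (1 / 2 * (1 - cmod w) * (s / 90) powr \<gamma>)"
      by (rule ennreal_mult''[symmetric]) simp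
    finally have "ennreal (2 * 90 powr \<gamma>) * (\<integral>\<^sup>+t. g t * ennreal (far_weight E t w) \<partial>lborel)
        = ennreal (2 * 90 powr \<gamma> * (1 / 2 * (1 - cmod w) * (s / 90) powr \<gamma>))"
      by (simp only:) (rule ennreal_mult'[symmetric], simp)
    also have "2 * 90 powr \<gamma> * (1 / 2 * (1 - cmod w) * (s / 90) powr \<gamma>) = (1 - cmod w) * s powr \<gamma>"
      using s by (simp add: powr_divide)
    finally show "ennreal ((1 - cmod w) * infdist w E powr \<gamma>) = ennreal (2 * 90 powr \<gamma>) * (\<integral>\<^sup>+t. g t * ennreal (far_weight E t w) \<partial>lborel)"
      by (simp add: s_def)
  qed
  also have "\<dots> = ennreal (2 * 90 powr \<gamma>) * (\<integral>\<^sup>+w. (\<integral>\<^sup>+t. g t * ennreal (far_weight E t w) \<partial>lborel) \<partial>M)"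
    by (rule nn_integral_cmult) (use fw in measurable)
  also have "(\<integral>\<^sup>+w. (\<integral>\<^sup>+t. g t * ennreal (far_weight E t w) \<partial>lborel) \<partial>M) = (\<integral>\<^sup>+t. (\<integral>\<^sup>+w. g t * ennreal (far_weight E t w) \<partial>M) \<partial>lborel)"
    by (rule P.Fubini'[symmetric]) (use fw in measurable)
  also have "\<dots> \<le> (\<integral>\<^sup>+t. ennreal (1717 / 99) * (g t * (\<integral>\<^sup>+\<zeta>. ennreal (trunc_dist E q t \<zeta>) \<partial>circle_measure)) + ennreal K * g t \<partial>lborel)"
  proof (rule nn_integral_mono)
    fix t :: real
    have "(\<integral>\<^sup>+w. g t * ennreal (far_weight E t w) \<partial>M) = g t * (\<integral>\<^sup>+w. ennreal (far_weight E t w) \<partial>M)"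
      by (rule nn_integral_cmult) (use fw1 in measurable)
    also have "\<dots> \<le> g t * (ennreal (1717 / 99) * (\<integral>\<^sup>+\<zeta>. ennreal (trunc_dist E q t \<zeta>) \<partial>circle_measure) + ennreal K)"
    proof (cases "t \<in> {0<..1 / 45}")
      case True
      then show ?thesis using far_part_le[of t] by (intro mult_left_mono) (auto simp: K_def)
    qed (simp add: g_def)
    also have "\<dots> = ennreal (1717 / 99) * (g t * (\<integral>\<^sup>+\<zeta>. ennreal (trunc_dist E q t \<zeta>) \<partial>circle_measure)) + ennreal K * g t"
      by (simp add: distrib_left mult_ac)
    finally show "(\<integral>\<^sup>+w. g t * ennreal (far_weight E t w) \<partial>M)
        \<le> ennreal (1717 / 99) * (g t * (\<integral>\<^sup>+\<zeta>. ennreal (trunc_dist E q t \<zeta>) \<partial>circle_measure)) + ennreal K * g t" .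
  qed
  also have "\<dots> = ennreal (1717 / 99) * (\<integral>\<^sup>+t. g t * (\<integral>\<^sup>+\<zeta>. ennreal (trunc_dist E q t \<zeta>) \<partial>circle_measure) \<partial>lborel)
      + ennreal K * (\<integral>\<^sup>+t. g t \<partial>lborel)"
  proof -
    interpret m: finite_measure circle_measure by (rule finite_measure_circle_measure)
    have "(\<lambda>(t, \<zeta>). ennreal (trunc_dist E q t \<zeta>)) \<in> borel_measurable (borel \<Otimes>\<^sub>M circle_measure)"
    proof -
      note [measurable] = measurable_infdist_E[OF E]
      show ?thesis unfolding trunc_dist_def case_prod_beta by measurable
    qed
    then have [measurable]: "(\<lambda>t. \<integral>\<^sup>+\<zeta>. ennreal (trunc_dist E q t \<zeta>) \<partial>circle_measure) \<in> borel_measurable borel"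
      by (rule m.borel_measurable_nn_integral)
    show ?thesis by (simp add: nn_integral_add nn_integral_cmult)
  qed
  also have "\<dots> \<le> ennreal (1717 / 99) * (ennreal (2 powr (- q) * (1 / 45) powr \<gamma>) + ennreal q * I_int \<alpha> E) + ennreal K * ennreal ((1 / 45) powr \<gamma>)"
  proof (intro add_mono mult_left_mono)
    show "(\<integral>\<^sup>+t. g t * (\<integral>\<^sup>+\<zeta>. ennreal (trunc_dist E q t \<zeta>) \<partial>circle_measure) \<partial>lborel) \<le> ennreal (2 powr (- q) * (1 / 45) powr \<gamma>) + ennreal q * I_int \<alpha> E"
      using nn_integral_trunc_dist_weighted[OF E q \<alpha>, of "1 / 45"] by (simp add: g_def \<gamma>_def)
    show "(\<integral>\<^sup>+t. g t \<partial>lborel) \<le> ennreal ((1 / 45) powr \<gamma>)"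
      using nn_integral_powr_Ioc[OF E \<gamma>, of "1 / 45"] by (simp add: g_def)
  qed auto
  finally have "(\<integral>\<^sup>+w. ennreal ((1 - cmod w) * infdist w E powr \<gamma>) \<partial>M)
    \<le> ennreal (2 * 90 powr \<gamma>) * (ennreal (1717 / 99) * (ennreal (2 powr (- q) * (1 / 45) powr \<gamma>) + ennreal q * I_int \<alpha> E) + ennreal K * ennreal ((1 / 45) powr \<gamma>))"
    by (simp add: mult_left_mono)
  also have "\<dots> = ennreal (2 * 90 powr \<gamma> * (1717 / 99)) * ennreal (2 powr (- q) * (1 / 45) powr \<gamma>)
      + ennreal (2 * 90 powr \<gamma> * (1717 / 99)) * ennreal q * I_int \<alpha> E + ennreal (2 * 90 powr \<gamma>) * ennreal K * ennreal ((1 / 45) powr \<gamma>)"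
  proof -
    have "ennreal (2 * 90 powr \<gamma> * (1717 / 99)) = ennreal (2 * 90 powr \<gamma>) * ennreal (1717 / 99)"
      by (rule ennreal_mult') simp
    then show ?thesis by (simp only: distrib_left mult.assoc add.assoc)
  qed
  also have "ennreal (2 * 90 powr \<gamma> * (1717 / 99)) * ennreal (2 powr (- q) * (1 / 45) powr \<gamma>) = ennreal (3434 / 99) * ennreal (2 powr (- \<alpha>))"
  proof -
    have "90 powr \<gamma> * (1 / 45) powr \<gamma> = (2::real) powr \<gamma>" by (simp add: powr_mult[symmetric])
    then have "2 * 90 powr \<gamma> * (1717 / 99) * (2 powr (- q) * (1 / 45) powr \<gamma>) = 3434 / 99 * (2 powr (- q) * 2 powr \<gamma>)"
      by (simp add: mult_ac)
    also have "2 powr (- q) * 2 powr \<gamma> = (2::real) powr (- \<alpha>)" by (simp add: \<gamma>_def flip: powr_add)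
    finally show ?thesis by (simp add: ennreal_mult'[symmetric])
  qed
  also have "ennreal (2 * 90 powr \<gamma> * (1717 / 99)) * ennreal q = ennreal (3434 / 99) * ennreal (q * 90 powr \<gamma>)"
    using q by (simp add: ennreal_mult'[symmetric] mult_ac)
  also have "ennreal (2 * 90 powr \<gamma>) * ennreal K * ennreal ((1 / 45) powr \<gamma>) = ennreal (2 * 2 powr \<gamma> * K)"
  proof -
    have "90 powr \<gamma> * (1 / 45) powr \<gamma> = (2::real) powr \<gamma>" by (simp add: powr_mult[symmetric])
    moreover have "0 \<le> K" by (simp add: K_def)
    ultimately show ?thesis by (simp add: ennreal_mult'[symmetric] mult_ac)
  qed
  finally show ?thesis by (simp add: \<gamma>_def K_def distrib_left mult.assoc)
qed

end

theorem theorem1: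
  fixes E :: "complex set" and q :: real and v :: "complex \<Rightarrow> ereal" and \<mu> :: "complex measure"
  assumes "E \<subseteq> sphere 0 1" and "closed E" and "E \<noteq> {}"
    and "q > 0"
    and "subharmonic_on v (ball 0 1)" and "\<exists>z\<in>ball 0 1. v z \<noteq> -\<infinity>"
    and "riesz_measure_on (ball 0 1) v \<mu>"
    and "\<forall>z\<in>ball 0 1. v z \<le> ereal (1 / infdist z E powr q)"
  shows "(I_int q E < \<infinity> \<longrightarrow>
            (\<integral>\<^sup>+w. ennreal (1 - cmod w) \<partial>\<mu>) < \<infinity> \<and>
            (v 0 \<ge> 0 \<longrightarrow>
               (\<integral>\<^sup>+w. ennreal (1 - cmod w) \<partial>\<mu>) \<le> 1 + ennreal (q * 2 powr q) * I_int q E))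
       \<and> (\<forall>\<alpha>::real. I_int q E = \<infinity> \<and> \<alpha> < q \<and> I_int \<alpha> E < \<infinity> \<longrightarrow>
            (\<integral>\<^sup>+w. ennreal ((1 - cmod w) * infdist w E powr (q - \<alpha>)) \<partial>\<mu>) < \<infinity> \<and>
            (v 0 \<ge> 0 \<longrightarrow>
               (\<integral>\<^sup>+w. ennreal ((1 - cmod w) * infdist w E powr (q - \<alpha>)) \<partial>\<mu>)
                 < 36 * (ennreal (2 powr (-\<alpha>)) + ennreal (q * 90 powr (q - \<alpha>)) * I_int \<alpha> E)))"
proof (rule conjI)
  have cm: "0 \<le> v 0 \<Longrightarrow> 0 \<le> core_mass v"
    using core_mass_nonneg[OF assms(5) v_bdd[OF assms] assms(6,7)] by blast
  show "I_int q E < \<infinity> \<longrightarrow>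
            (\<integral>\<^sup>+w. ennreal (1 - cmod w) \<partial>\<mu>) < \<infinity> \<and>
            (v 0 \<ge> 0 \<longrightarrow>
               (\<integral>\<^sup>+w. ennreal (1 - cmod w) \<partial>\<mu>) \<le> 1 + ennreal (q * 2 powr q) * I_int q E)"
  proof (intro impI conjI)
    assume "I_int q E < \<infinity>"
    then obtain i where i: "I_int q E = ennreal i" "0 \<le> i" by (cases "I_int q E") auto
    note le = part_i[OF assms i]
    show "(\<integral>\<^sup>+w. ennreal (1 - cmod w) \<partial>\<mu>) < \<infinity>" using le by (rule order.strict_trans1) simp
    assume "v 0 \<ge> 0"
    then have "ennreal (1 + q * 2 powr q * i - core_mass v) \<le> ennreal (1 + q * 2 powr q * i)"
      using cm by (intro ennreal_leI) simp
    also have "\<dots> = 1 + ennreal (q * 2 powr q) * I_int q E"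
      using assms(4) i by (simp add: ennreal_plus ennreal_mult'')
    finally show "(\<integral>\<^sup>+w. ennreal (1 - cmod w) \<partial>\<mu>) \<le> 1 + ennreal (q * 2 powr q) * I_int q E"
      using le by (rule order_trans[rotated])
  qed
  show "\<forall>\<alpha>::real. I_int q E = \<infinity> \<and> \<alpha> < q \<and> I_int \<alpha> E < \<infinity> \<longrightarrow>
            (\<integral>\<^sup>+w. ennreal ((1 - cmod w) * infdist w E powr (q - \<alpha>)) \<partial>\<mu>) < \<infinity> \<and>
            (v 0 \<ge> 0 \<longrightarrow>
               (\<integral>\<^sup>+w. ennreal ((1 - cmod w) * infdist w E powr (q - \<alpha>)) \<partial>\<mu>)
                 < 36 * (ennreal (2 powr (-\<alpha>)) + ennreal (q * 90 powr (q - \<alpha>)) * I_int \<alpha> E))"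
  proof (intro allI impI conjI; elim conjE)
    fix \<alpha> assume \<alpha>: "\<alpha> < q" and fin: "I_int \<alpha> E < \<infinity>"
    obtain i where i: "I_int \<alpha> E = ennreal i" "0 \<le> i" using fin by (cases "I_int \<alpha> E") auto
    define Y where "Y = 2 powr (- \<alpha>) + q * 90 powr (q - \<alpha>) * i"
    have Y: "0 < Y" using assms(4) i by (auto simp: Y_def intro!: add_pos_nonneg)
    have YE: "ennreal (2 powr (- \<alpha>)) + ennreal (q * 90 powr (q - \<alpha>)) * I_int \<alpha> E = ennreal Y"
      using assms(4) i by (simp add: Y_def ennreal_plus ennreal_mult'')
    note le = part_ii[OF assms \<alpha>, unfolded YE]
    show "(\<integral>\<^sup>+w. ennreal ((1 - cmod w) * infdist w E powr (q - \<alpha>)) \<partial>\<mu>) < \<infinity>"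
      using le by (rule order.strict_trans1) (simp add: ennreal_mult_less_top)
    assume "v 0 \<ge> 0"
    then have "max 0 (- core_mass v) = 0" using cm by simp
    then have "(\<integral>\<^sup>+w. ennreal ((1 - cmod w) * infdist w E powr (q - \<alpha>)) \<partial>\<mu>) \<le> ennreal (3434 / 99 * Y)"
      using le Y by (simp add: ennreal_mult'[of "3434 / 99" Y] del: times_divide_eq_left)
    \<comment> \<open>Strictness comes from 3434/99 < 36 together with Y > 0; finiteness of
      I(\<alpha>, E) makes Y a real number.\<close>
    also have "\<dots> < ennreal (36 * Y)" using Y by (intro ennreal_lessI) auto
    also have "\<dots> = 36 * ennreal Y" using Y by (simp add: ennreal_mult')
    finally show "(\<integral>\<^sup>+w. ennreal ((1 - cmod w) * infdist w E powr (q - \<alpha>)) \<partial>\<mu>)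
       < 36 * (ennreal (2 powr (-\<alpha>)) + ennreal (q * 90 powr (q - \<alpha>)) * I_int \<alpha> E)" unfolding YE .
  qed
qed

end
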